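(* Let $\mathcal{H}$ be a separable real Hilbert space, $f:\mathcal{H}\to\mathbb{R}$ convex and differentiable with $L_{\nabla f}$-Lipschitz continuous gradient and $\operatorname{argmin} f\neq\emptyset$. Let $\alpha>1$. For given $t_0\ge 0$ and $s_0>0$, consider the dynamical systems $$\text{(A)}\quad\begin{cases} dY(t)=X(t)\,dt\\ dX(t)=\left(-X(t)-\left(\frac{s_0}{\alpha-1}\right)^2\exp\left(\frac{2(t-t_0)}{\alpha-1}\right)\nabla f(Y(t))\right)dt+\sigma_Y(t)\,dW(t)\\ Y(t_0)=Y_0,\ X(t_0)=X_0\end{cases}$$ on $[t_0,+\infty)$, and $$\text{(B)}\quad\begin{cases} dZ(s)=Q(s)\,ds\\ dQ(s)=\left(-\frac{\alpha}{s}Q(s)-\nabla f(Z(s))\right)ds+\sigma_Z(s)\,dW(s)\\ Z(s_0)=Z_0,\ Q(s_0)=Q_0\end{cases}$$ on $[s_0,+\infty)$. Then, the following statements are true: (i) Let $(Y,X)$ be a strong solution of (A). Then, for $\tau(s):=t_0+(\alpha-1)\log\left(\frac{s}{s_0}\right)$ for all $s\ge s_0$, it holds that $(Z,Q)$, defined by $Z(s):=Y(\tau(s))$ and $Q(s):=\frac{\alpha-1}{s}X(\tau(s))$, is a strong solution of (B) with initial conditions $Z(s_0)=Z_0=Y_0$ and $Q(s_0)=Q_0=\frac{\alpha-1}{s_0}X_0$, and diffusion term $$\sigma_Z(s)=(\dot\tau(s))^{3/2}\sigma_Y(\tau(s))=\left(\frac{\alpha-1}{s}\right)^{3/2}\sigma_Y(\tau(s)).$$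 (ii) Let $(Z,Q)$ be a strong solution of (B). Then, for $\kappa(t):=s_0\exp\left(\frac{t-t_0}{\alpha-1}\right)$ for all $t\ge t_0$, it holds that $(Y,X)$, defined by $Y(t):=Z(\kappa(t))$ and $X(t):=\frac{s_0}{\alpha-1}\exp\left(\frac{t-t_0}{\alpha-1}\right)Q(\kappa(t))$, is a strong solution of (A) with initial conditions $Y(t_0)=Y_0=Z_0$ and $X(t_0)=X_0=\frac{s_0}{\alpha-1}Q_0$, and diffusion term $$\sigma_Y(t)=(\dot\kappa(t))^{3/2}\sigma_Z(\kappa(t))=\left(\frac{s_0}{\alpha-1}\exp\left(\frac{t-t_0}{\alpha-1}\right)\right)^{3/2}\sigma_Z(\kappa(t)).$$
   Context: The systems are defined on a filtered probability space $(\Omega,\mathcal{F},\{\mathcal{F}_t\},\mathbb{P})$, $W$ denotes an $\mathcal{H}$-valued Brownian motion, and the diffusion terms $\sigma_Y:[t_0,+\infty)\to\mathcal{L}(\mathcal{H},\mathcal{H})$ and $\sigma_Z:[s_0,+\infty)\to\mathcal{L}(\mathcal{H},\mathcal{H})$ are measurable maps, where $\mathcal{L}(\mathcal{H},\mathcal{H})$ carries the Hilbert–Schmidt norm $\|\cdot\|_{HS}$. A dot denotes the derivative of a function of one real variable. Strong solution: for a stochastic differential equation $dX(t)=F(t,X(t))\,dt+G(t,X(t))\,dW(t)$ on $[t_0,+\infty)$ with initial condition $X(t_0)=X_0$ in a Hilbert space, a stochastic process $X$ is a strong solution if (1) $X$ is continuous on $[t_0,+\infty)$ almost surely; (2) for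 every $t\ge t_0$, $\int_{t_0}^t\left(\|F(s,X(s))\|+\|G(s,X(s))\|_{HS}^2\right)ds<+\infty$ almost surely; (3) for every $t\ge t_0$, $X(t)=X(t_0)+\int_{t_0}^tF(s,X(s))\,ds+\int_{t_0}^tG(s,X(s))\,dW(s)$ almost surely. Here this notion is applied to the pairs $(Y,X)$ on $[t_0,+\infty)$ and $(Z,Q)$ on $[s_0,+\infty)$, with values in $\mathcal{H}\times\mathcal{H}$.
   Formalization: The transformed system is driven not by the same W, for which the claim fails, but by the time-changed Brownian motion W'(s)=∫_{t0}^{τ(s)} √(κ'(r)) dW(r) with filtration F_{τ(s)} in (i), and symmetrically (τ and κ exchanged) in (ii). *)

theory Defs
  imports "HOL-Probability.Probability"
begin

section \<open>Hilbert--Schmidt operators\<close>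

definition orthonormal_basis :: "'a::real_inner set \<Rightarrow> bool" where
  "orthonormal_basis B \<longleftrightarrow>
     (\<forall>e\<in>B. norm e = 1) \<and> pairwise orthogonal B \<and> closure (span B) = UNIV"

text \<open>The value does not depend on the chosen basis; it is infinite if the operator is not
  Hilbert--Schmidt.\<close>

definition hs_norm_sq :: "('a::real_inner \<Rightarrow>\<^sub>L 'b::real_normed_vector) \<Rightarrow> ennreal" where
  "hs_norm_sq T =
     (\<integral>\<^sup>+ e. ennreal ((norm (blinfun_apply T e))\<^sup>2) \<partial>count_space (SOME B. orthonormal_basis B))"

text \<open>The space of Hilbert--Schmidt operators with the Borel \<open>\<sigma>\<close>-algebra of the Hilbert--Schmidt
  norm.  (The library's \<open>borel\<close> on bounded operators refers to the operator norm.)\<close>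

definition hs_borel :: "('a::real_inner \<Rightarrow>\<^sub>L 'b::real_normed_vector) measure" where
  "hs_borel =
     sigma {T. hs_norm_sq T < \<infinity>}
       {U. U \<subseteq> {T. hs_norm_sq T < \<infinity>} \<and>
           (\<forall>T\<in>U. \<exists>\<epsilon>>0. \<forall>S. hs_norm_sq (S - T) < ennreal (\<epsilon>\<^sup>2) \<longrightarrow> S \<in> U)}"

definition diffusion_coefficient ::
  "real \<Rightarrow> (real \<Rightarrow> 'h::real_inner \<Rightarrow>\<^sub>L 'k::real_normed_vector) \<Rightarrow> bool" where
  "diffusion_coefficient t0 \<sigma> \<longleftrightarrow> \<sigma> \<in> restrict_space borel {t0..} \<rightarrow>\<^sub>M hs_borel"

section \<open>Filtrations and Brownian motion on a half-line\<close>

definition filtration_from :: "'w measure \<Rightarrow> real \<Rightarrow> (real \<Rightarrow> 'w measure) \<Rightarrow> bool" where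
  "filtration_from M t0 F \<longleftrightarrow>
     (\<forall>t\<ge>t0. subalgebra M (F t)) \<and> (\<forall>s\<ge>t0. \<forall>t\<ge>s. sets (F s) \<subseteq> sets (F t))"

definition centred_gaussian :: "real \<Rightarrow> real measure" where
  "centred_gaussian v =
     (if v = 0 then return borel 0 else density lborel (\<lambda>x. ennreal (normal_density 0 (sqrt v) x)))"

text \<open>Brownian motion on the Hilbert space with covariance operator \<open>C\<close>, restricted to times
  \<open>t \<ge> t0\<close>; \<open>W t h\<close> stands for the inner product of \<open>W(t)\<close> with \<open>h\<close>.
  For \<open>C\<close> the identity this is standard Brownian motion if the space is finite dimensional and
  cylindrical Brownian motion otherwise.  A process that really takes its values in an
  infinite-dimensional space has a trace class \<open>C\<close>; that case is singled out
  by \<open>takes_values_in_space\<close> below.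
  Stochastic equations on \<open>[t0,\<infinity>)\<close> only involve the increments after \<open>t0\<close>, so no value
  is prescribed at \<open>t0\<close>: a Brownian motion on \<open>[0,\<infinity>)\<close> is one on \<open>[t0,\<infinity>)\<close> for
  every \<open>t0 \<ge> 0\<close>.\<close>

definition brownian_motion_from ::
  "'w measure \<Rightarrow> real \<Rightarrow> (real \<Rightarrow> 'w measure) \<Rightarrow> ('h::real_inner \<Rightarrow>\<^sub>L 'h) \<Rightarrow>
     (real \<Rightarrow> 'h \<Rightarrow> 'w \<Rightarrow> real) \<Rightarrow> bool" where
  "brownian_motion_from M t0 F C W \<longleftrightarrow>
     (\<forall>h k. blinfun_apply C h \<bullet> k = h \<bullet> blinfun_apply C k) \<and>
     (\<forall>h. 0 \<le> blinfun_apply C h \<bullet> h) \<and>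
     (\<forall>t\<ge>t0. \<forall>h. W t h \<in> borel_measurable (F t)) \<and>
     (\<forall>t\<ge>t0. \<forall>a b h k. AE \<omega> in M. W t (a *\<^sub>R h + b *\<^sub>R k) \<omega> = a * W t h \<omega> + b * W t k \<omega>) \<and>
     (\<forall>h. AE \<omega> in M. continuous_on {t0..} (\<lambda>t. W t h \<omega>)) \<and>
     (\<forall>s\<ge>t0. \<forall>t\<ge>s. \<forall>h.
        prob_space.indep_set M (sets (F s))
          {(\<lambda>\<omega>. W t h \<omega> - W s h \<omega>) -` B \<inter> space M | B. B \<in> sets borel} \<and>
        distr M borel (\<lambda>\<omega>. W t h \<omega> - W s h \<omega>)
          = centred_gaussian ((t - s) * (blinfun_apply C h \<bullet> h)))"

definition takes_values_in_space ::
  "'w measure \<Rightarrow> real \<Rightarrow> (real \<Rightarrow> 'w measure) \<Rightarrow> (real \<Rightarrow> 'h::real_inner \<Rightarrow> 'w \<Rightarrow> real) \<Rightarrow> bool" where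
  "takes_values_in_space M t0 F W \<longleftrightarrow>
     (\<exists>V :: real \<Rightarrow> 'w \<Rightarrow> 'h.
        (\<forall>t\<ge>t0. V t \<in> borel_measurable (F t)) \<and>
        (AE \<omega> in M. continuous_on {t0..} (\<lambda>t. V t \<omega>)) \<and>
        (\<forall>t\<ge>t0. \<forall>h. AE \<omega> in M. W t h \<omega> = V t \<omega> \<bullet> h))"

section \<open>The stochastic integral\<close>

lift_definition rank_one :: "'h::real_inner \<Rightarrow> 'k::real_normed_vector \<Rightarrow> 'h \<Rightarrow>\<^sub>L 'k"
  is "\<lambda>h g x. (h \<bullet> x) *\<^sub>R g"
  by (intro bounded_linear_scaleR_const bounded_linear_inner_right)

text \<open>A list of tuples \<open>(a, b, \<xi>, h, g)\<close> encodes the elementary process that is the sum of the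
  terms \<open>1_{(a,b]}(t) \<xi>(\<omega>) (h \<otimes> g)\<close>, with \<open>\<xi>\<close> bounded and measurable at time \<open>a\<close>.\<close>

type_synonym ('w, 'h, 'k) elementary = "(real \<times> real \<times> ('w \<Rightarrow> real) \<times> 'h \<times> 'k) list"

definition elementary_process ::
  "'w measure \<Rightarrow> real \<Rightarrow> (real \<Rightarrow> 'w measure) \<Rightarrow> ('w, 'h, 'k) elementary \<Rightarrow> bool" where
  "elementary_process M t0 F S \<longleftrightarrow>
     (\<forall>(a, b, \<xi>, h, g) \<in> set S.
        t0 \<le> a \<and> a \<le> b \<and> \<xi> \<in> borel_measurable (F a) \<and> bounded (\<xi> ` space M))"

definition elementary_value ::
  "('w, 'h::real_inner, 'k::real_normed_vector) elementary \<Rightarrow> real \<Rightarrow> 'w \<Rightarrow> 'h \<Rightarrow>\<^sub>L 'k" where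
  "elementary_value S t \<omega> =
     (\<Sum>(a, b, \<xi>, h, g)\<leftarrow>S. if a < t \<and> t \<le> b then \<xi> \<omega> *\<^sub>R rank_one h g else 0)"

definition elementary_integral ::
  "(real \<Rightarrow> 'h \<Rightarrow> 'w \<Rightarrow> real) \<Rightarrow> ('w, 'h, 'k::real_normed_vector) elementary \<Rightarrow> real \<Rightarrow> 'w \<Rightarrow> 'k" where
  "elementary_integral W S t \<omega> =
     (\<Sum>(a, b, \<xi>, h, g)\<leftarrow>S. (\<xi> \<omega> * (W (min b t) h \<omega> - W (min a t) h \<omega>)) *\<^sub>R g)"

text \<open>\<open>I\<close> is (a continuous version of) the Ito integral process of \<open>\<Phi>\<close> against \<open>W\<close> started at
  \<open>t0\<close>.  The usual convergence in probability, of the integrands in \<open>L\<^sup>2(t0,T)\<close> and of the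
  integrals uniformly on \<open>[t0,T]\<close>, is almost sure convergence along a subsequence.  The integral
  is determined up to indistinguishability.\<close>

definition ito_integral ::
  "'w measure \<Rightarrow> real \<Rightarrow> (real \<Rightarrow> 'w measure) \<Rightarrow> (real \<Rightarrow> 'h::real_inner \<Rightarrow> 'w \<Rightarrow> real) \<Rightarrow>
     (real \<Rightarrow> 'w \<Rightarrow> 'h \<Rightarrow>\<^sub>L 'k::real_normed_vector) \<Rightarrow> (real \<Rightarrow> 'w \<Rightarrow> 'k) \<Rightarrow> bool" where
  "ito_integral M t0 F W \<Phi> I \<longleftrightarrow>
     (\<exists>S :: nat \<Rightarrow> ('w, 'h, 'k) elementary.
        (\<forall>n. elementary_process M t0 F (S n)) \<and>
        (AE \<omega> in M. \<forall>T\<ge>t0.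
           (\<lambda>n. \<integral>\<^sup>+ t\<in>{t0..T}. hs_norm_sq (elementary_value (S n) t \<omega> - \<Phi> t \<omega>) \<partial>lborel)
             \<longlonglongrightarrow> 0) \<and>
        (AE \<omega> in M. \<forall>T\<ge>t0.
           uniform_limit {t0..T} (\<lambda>n t. elementary_integral W (S n) t \<omega>) (\<lambda>t. I t \<omega>) sequentially))"

section \<open>Strong solutions\<close>

text \<open>Strong solution of \<open>dX = b(t,X) dt + G(t,X) dW\<close> on \<open>[t0,\<infinity>)\<close> with \<open>X(t0) = X0\<close>, for
  measurable coefficients \<open>b\<close> and \<open>G\<close>.\<close>

definition strong_solution ::
  "'w measure \<Rightarrow> real \<Rightarrow> (real \<Rightarrow> 'w measure) \<Rightarrow> (real \<Rightarrow> 'h::real_inner \<Rightarrow> 'w \<Rightarrow> real) \<Rightarrow>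
     (real \<Rightarrow> 'k \<Rightarrow> 'k) \<Rightarrow> (real \<Rightarrow> 'k \<Rightarrow> 'h \<Rightarrow>\<^sub>L 'k) \<Rightarrow> ('w \<Rightarrow> 'k) \<Rightarrow>
     (real \<Rightarrow> 'w \<Rightarrow> 'k::{banach, second_countable_topology}) \<Rightarrow> bool" where
  "strong_solution M t0 F W b G X0 X \<longleftrightarrow>
     (\<forall>t\<ge>t0. X t \<in> borel_measurable M) \<and>
     (AE \<omega> in M. X t0 \<omega> = X0 \<omega>) \<and>
     (AE \<omega> in M. continuous_on {t0..} (\<lambda>t. X t \<omega>)) \<and>
     (\<forall>t\<ge>t0. AE \<omega> in M.
        (\<integral>\<^sup>+ s\<in>{t0..t}. (ennreal (norm (b s (X s \<omega>))) + hs_norm_sq (G s (X s \<omega>))) \<partial>lborel) < \<infinity>) \<and>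
     (\<exists>I. ito_integral M t0 F W (\<lambda>s \<omega>. G s (X s \<omega>)) I \<and>
        (\<forall>t\<ge>t0. AE \<omega> in M.
           X t \<omega> = X t0 \<omega> + (LINT s:{t0..t}|lborel. b s (X s \<omega>)) + I t \<omega>))"

text \<open>The noise acts on the second component only.\<close>

lift_definition in_second :: "('h::real_normed_vector \<Rightarrow>\<^sub>L 'k::real_normed_vector) \<Rightarrow>
    'h \<Rightarrow>\<^sub>L ('l::real_normed_vector \<times> 'k)"
  is "\<lambda>T x. (0, T x)"
  by (intro bounded_linear_Pair bounded_linear_zero)

definition solves_A where
  "solves_A M F W \<alpha> t0 s0 gradf \<sigma> Y0 X0 Y X \<longleftrightarrow>
     strong_solution M t0 F W
       (\<lambda>t (y, x). (x, - x - ((s0 / (\<alpha> - 1))\<^sup>2 * exp (2 * (t - t0) / (\<alpha> - 1))) *\<^sub>R gradf y))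
       (\<lambda>t _. in_second (\<sigma> t))
       (\<lambda>\<omega>. (Y0 \<omega>, X0 \<omega>)) (\<lambda>t \<omega>. (Y t \<omega>, X t \<omega>))"

definition solves_B where
  "solves_B M F W \<alpha> s0 gradf \<sigma> Z0 Q0 Z Q \<longleftrightarrow>
     strong_solution M s0 F W
       (\<lambda>s (z, q). (q, - (\<alpha> / s) *\<^sub>R q - gradf z))
       (\<lambda>s _. in_second (\<sigma> s))
       (\<lambda>\<omega>. (Z0 \<omega>, Q0 \<omega>)) (\<lambda>s \<omega>. (Z s \<omega>, Q s \<omega>))"

section \<open>Change of the driving Brownian motion under a change of time\<close>

text \<open>An equation whose time is changed by the inverse of \<open>\<theta>\<close> is driven, not by \<open>W\<close>, but by the
  process \<open>W'\<close> with \<open>W'(\<theta>(u)) = \<integral> sqrt(\<theta>'(r)) dW(r)\<close> over \<open>[a,u]\<close>, stated for all inner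
  products with a fixed vector \<open>h\<close>.\<close>

definition time_changed_noise ::
  "'w measure \<Rightarrow> real \<Rightarrow> (real \<Rightarrow> 'w measure) \<Rightarrow> (real \<Rightarrow> 'h::real_inner \<Rightarrow> 'w \<Rightarrow> real) \<Rightarrow>
     (real \<Rightarrow> real) \<Rightarrow> (real \<Rightarrow> 'h \<Rightarrow> 'w \<Rightarrow> real) \<Rightarrow> bool" where
  "time_changed_noise M a F W \<theta> W' \<longleftrightarrow>
     (\<forall>h. ito_integral M a F W
        (\<lambda>u \<omega>. sqrt (deriv \<theta> u) *\<^sub>R blinfun_inner_right h) (\<lambda>u. W' (\<theta> u) h))"

end

theory Submission
  imports Defs
begin

text \<open>The change of time is a smooth deterministic function, so no Ito calculus is needed: every
  stochastic integral that has to be transformed is integrated pathwise by parts.  Integrating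
  \<open>sqrt(\<theta>')\<close> against \<open>W\<close> in this way gives the new noise, whose increments are
  limits of Riemann sums of independent Gaussian variables and hence, by their characteristic
  functions, Gaussian with the right variance and independent of the past.  An elementary process
  approximating the old integrand becomes, after the change of time, an elementary process times a
  smooth weight; freezing the weight on a fine grid makes it elementary again, at the cost of an error
  that vanishes pathwise as the mesh tends to zero, and a diagonal choice of the meshes
  controls all errors almost surely.  The transformed equation is then a pathwise product rule.\<close>

section \<open>Pathwise integrals of smooth functions\<close>

text \<open>The exponent 3/2 comes from two scalings. With dW' = sqrt(\<theta>') dW on the new clock
  \<theta>, dW equals (\<theta>')^(-1/2) dW', and the velocity, a derivative with respect to time,
  is multiplied by 1 / \<theta>'. In terms of the inverse clock \<phi>, where \<phi>' = 1 /
  \<theta>', the diffusion term is multiplied by (\<phi>')^(3/2). The two directions of the theorem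
  are one statement about a clock and its inverse, applied to (\<kappa>, \<tau>) and to (\<tau>,
  \<kappa>). Two obstacles shape the details. The integrand of an Ito integral is accessible only
  through the errors of elementary approximations, and measurability of these errors in time is not
  established, so they are estimated as lower integrals. The paths of the noise are continuous only
  almost surely and for each direction separately, so null sets have to be collected over countably
  many directions, times and grids before any pathwise argument starts.\<close>

definition C1_from :: "real \<Rightarrow> (real \<Rightarrow> real) \<Rightarrow> (real \<Rightarrow> real) \<Rightarrow> bool" where
  "C1_from a p p' \<longleftrightarrow>
     (\<forall>u\<ge>a. (p has_real_derivative p' u) (at u within {a..})) \<and> continuous_on {a..} p'"

text \<open>\<open>y\<close> is the integral of \<open>p\<close> against the merely continuous path \<open>x\<close>, started at
  \<open>a\<close>: the derivative of \<open>y - p x\<close> is what integration by parts prescribes.\<close>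

definition path_integral ::
  "real \<Rightarrow> (real \<Rightarrow> real) \<Rightarrow> (real \<Rightarrow> real) \<Rightarrow> (real \<Rightarrow> 'b::real_normed_vector) \<Rightarrow> (real \<Rightarrow> 'b) \<Rightarrow> bool" where
  "path_integral a p p' x y \<longleftrightarrow> y a = 0 \<and>
     (\<forall>u\<ge>a. ((\<lambda>u. y u - p u *\<^sub>R x u) has_vector_derivative - (p' u *\<^sub>R x u)) (at u within {a..}))"

lemma C1_from_continuous: "C1_from a p p' \<Longrightarrow> continuous_on {a..} p"
  unfolding C1_from_def by (auto intro!: DERIV_continuous_on)

lemma C1_from_continuous': "C1_from a p p' \<Longrightarrow> continuous_on {a..} p'"
  unfolding C1_from_def by auto

lemma C1_fromD:
  "C1_from a p p' \<Longrightarrow> a \<le> u \<Longrightarrow> (p has_real_derivative p' u) (at u within {a..})"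
  unfolding C1_from_def by auto

lemma C1_from_bound:
  assumes "C1_from a p p'"
  obtains K where "K > 0" "\<And>u. a \<le> u \<Longrightarrow> u \<le> b \<Longrightarrow> \<bar>p u\<bar> \<le> K" "\<And>u. a \<le> u \<Longrightarrow> u \<le> b \<Longrightarrow> \<bar>p' u\<bar> \<le> K"
proof -
  have "bounded (p ` {a..b})" "bounded (p' ` {a..b})"
    by (auto intro!: compact_imp_bounded compact_continuous_image
        intro: continuous_on_subset[OF C1_from_continuous[OF assms]]
               continuous_on_subset[OF C1_from_continuous'[OF assms]])
  then obtain K1 K2 where K: "K1 > 0" "\<forall>u\<in>{a..b}. \<bar>p u\<bar> \<le> K1" "\<forall>u\<in>{a..b}. \<bar>p' u\<bar> \<le> K2"
    unfolding bounded_pos by auto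
  show thesis by (rule that[of "max K1 K2"]) (use K in \<open>force simp: le_max_iff_disj\<close>)+
qed

lemma has_vector_derivative_atLeastI:
  assumes "(f has_vector_derivative D) (at u within {a..u + 1})"
  shows "(f has_vector_derivative D) (at (u::real) within {a..})"
proof -
  have "at u within {a..} = at u within {a..u+1}"
    by (rule at_within_nhd[of _ "{u - 1<..<u + 1}"]) auto
  then show ?thesis using assms by simp
qed

lemma integral_has_vector_derivative_atLeast:
  fixes f :: "real \<Rightarrow> 'b::banach"
  assumes "continuous_on {a..} f" "a \<le> u"
  shows "((\<lambda>u. integral {a..u} f) has_vector_derivative f u) (at u within {a..})"
  by (rule has_vector_derivative_atLeastI, rule integral_has_vector_derivative)
     (use assms in \<open>auto intro: continuous_on_subset\<close>)

text \<open>Integration by parts, solved for the integral of \<open>p\<close> against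
  \<open>x\<close>: only \<open>p\<close> is differentiated, so continuity of \<open>x\<close>
  suffices.\<close>

lemma path_integral_exists:
  fixes x :: "real \<Rightarrow> 'b::banach"
  assumes p: "C1_from a p p'" and x: "continuous_on {a..} x"
  shows "path_integral a p p' x
    (\<lambda>u. p u *\<^sub>R x u - p a *\<^sub>R x a - integral {a..u} (\<lambda>r. p' r *\<^sub>R x r))"
  unfolding path_integral_def
proof (intro conjI allI impI)
  fix u assume u: "a \<le> u"
  have c: "continuous_on {a..} (\<lambda>r. p' r *\<^sub>R x r)"
    by (intro continuous_intros x C1_from_continuous'[OF p])
  have "((\<lambda>u. - (p a *\<^sub>R x a) - integral {a..u} (\<lambda>r. p' r *\<^sub>R x r)) has_vector_derivative
     (0 - (p' u *\<^sub>R x u))) (at u within {a..})"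
    by (intro has_vector_derivative_diff integral_has_vector_derivative_atLeast c u) auto
  then show "((\<lambda>u. p u *\<^sub>R x u - p a *\<^sub>R x a - integral {a..u} (\<lambda>r. p' r *\<^sub>R x r) - p u *\<^sub>R x u)
     has_vector_derivative - (p' u *\<^sub>R x u)) (at u within {a..})"
    by (simp add: algebra_simps)
qed simp

lemma path_integral_continuous:
  assumes "C1_from a p p'" "path_integral a p p' x y" "continuous_on {a..} x"
  shows "continuous_on {a..} y"
proof -
  have "continuous_on {a..} (\<lambda>u. y u - p u *\<^sub>R x u)"
    unfolding continuous_on_eq_continuous_within
    using assms(2) has_vector_derivative_continuous by (fastforce simp: path_integral_def)
  then have "continuous_on {a..} (\<lambda>u. (y u - p u *\<^sub>R x u) + p u *\<^sub>R x u)"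
    by (intro continuous_on_add continuous_on_scaleR assms(3) C1_from_continuous[OF assms(1)])
  then show ?thesis by (simp only: diff_add_cancel)
qed

text \<open>Associativity of integration. Writing z - q p x as (z - q y) + q (y - p x), the terms q'
  y cancel after differentiation.\<close>

lemma path_integral_chain:
  assumes q: "C1_from a q q'"
    and xy: "path_integral a p p' x y" and yz: "path_integral a q q' y z"
  shows "path_integral a (\<lambda>u. q u * p u) (\<lambda>u. q' u * p u + q u * p' u) x z"
  unfolding path_integral_def
proof (intro conjI allI impI)
  fix u assume u: "a \<le> u"
  have "((\<lambda>u. (z u - q u *\<^sub>R y u) + q u *\<^sub>R (y u - p u *\<^sub>R x u)) has_vector_derivative
     (- (q' u *\<^sub>R y u) + (q u *\<^sub>R (- (p' u *\<^sub>R x u)) + q' u *\<^sub>R (y u - p u *\<^sub>R x u)))) (at u within {a..})"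
    using xy yz u C1_fromD[OF q u] unfolding path_integral_def
    by (intro has_vector_derivative_add has_vector_derivative_scaleR) auto
  then show "((\<lambda>u. z u - (q u * p u) *\<^sub>R x u) has_vector_derivative
     - ((q' u * p u + q u * p' u) *\<^sub>R x u)) (at u within {a..})"
    by (simp add: algebra_simps)
qed (use yz in \<open>simp add: path_integral_def\<close>)

lemma path_integral_cong:
  assumes "path_integral a p p' x y"
    and "\<And>u. a \<le> u \<Longrightarrow> q u = p u" "\<And>u. a \<le> u \<Longrightarrow> q' u = p' u"
    and "\<And>u. a \<le> u \<Longrightarrow> x1 u = x u" "\<And>u. a \<le> u \<Longrightarrow> y1 u = y u"
  shows "path_integral a q q' x1 y1"
  unfolding path_integral_def
proof (intro conjI allI impI)
  fix u assume u: "a \<le> u"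
  have "((\<lambda>u. y u - p u *\<^sub>R x u) has_vector_derivative - (p' u *\<^sub>R x u)) (at u within {a..})"
    using assms(1) u by (auto simp: path_integral_def)
  then show "((\<lambda>u. y1 u - q u *\<^sub>R x1 u) has_vector_derivative - (q' u *\<^sub>R x1 u)) (at u within {a..})"
    by (subst has_vector_derivative_cong_ev[where g="\<lambda>u. y u - p u *\<^sub>R x u"]) (use assms u in auto)
qed (use assms in \<open>auto simp: path_integral_def\<close>)

lemma path_integral_linear:
  assumes "bounded_linear L" "path_integral a p p' x y"
  shows "path_integral a p p' (\<lambda>u. L (x u)) (\<lambda>u. L (y u))"
proof -
  interpret bounded_linear L by fact
  have "((\<lambda>u. L (y u) - p u *\<^sub>R L (x u)) has_vector_derivative - (p' u *\<^sub>R L (x u)))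
      (at u within {a..})" if "a \<le> u" for u
  proof -
    have "((\<lambda>u. y u - p u *\<^sub>R x u) has_vector_derivative - (p' u *\<^sub>R x u)) (at u within {a..})"
      using assms(2) that by (simp add: path_integral_def)
    from has_vector_derivative[OF this] show ?thesis
      by (simp only: diff scaleR neg)
  qed
  then show ?thesis using assms(2) by (simp add: path_integral_def zero)
qed

lemma path_integral_zero: "path_integral a p p' (\<lambda>_. 0) (\<lambda>_. 0)"
  by (simp add: path_integral_def)

lemma path_integral_add:
  assumes "path_integral a p p' x y" "path_integral a p p' x2 y2"
  shows "path_integral a p p' (\<lambda>u. x u + x2 u) (\<lambda>u. y u + y2 u)"
  unfolding path_integral_def
proof (intro conjI allI impI)
  fix u assume u: "a \<le> u"
  have "((\<lambda>u. (y u - p u *\<^sub>R x u) + (y2 u - p u *\<^sub>R x2 u)) has_vector_derivative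
     (- (p' u *\<^sub>R x u) + - (p' u *\<^sub>R x2 u))) (at u within {a..})"
    using assms u unfolding path_integral_def by (intro has_vector_derivative_add) auto
  then show "((\<lambda>u. y u + y2 u - p u *\<^sub>R (x u + x2 u)) has_vector_derivative
     - (p' u *\<^sub>R (x u + x2 u))) (at u within {a..})"
    by (simp add: algebra_simps)
qed (use assms in \<open>auto simp: path_integral_def\<close>)

lemma path_integral_diff:
  assumes "path_integral a p p' x y" "path_integral a p p' x2 y2"
  shows "path_integral a p p' (\<lambda>u. x u - x2 u) (\<lambda>u. y u - y2 u)"
  using path_integral_add[OF assms(1) path_integral_linear[OF bounded_linear_minus[OF bounded_linear_ident] assms(2)]]
  by simp

text \<open>Elementary integrals are combinations of stopped paths. Beyond \<open>c\<close> the path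
  is constant and y c - p x c has derivative - p' x c, so the defining equation persists.\<close>

lemma path_integral_stop:
  assumes p: "C1_from a p p'" and xy: "path_integral a p p' x y" and c: "a \<le> c"
  shows "path_integral a p p' (\<lambda>u. x (min c u)) (\<lambda>u. y (min c u))"
  unfolding path_integral_def
proof (intro conjI allI impI)
  fix u assume u: "a \<le> u"
  let ?f = "\<lambda>u. y (min c u) - p u *\<^sub>R x (min c u)"
  let ?D = "- (p' u *\<^sub>R x (min c u))"
  have left: "(?f has_vector_derivative ?D) (at u within {a..c})" if uc: "u \<le> c"
  proof -
    have "((\<lambda>u. y u - p u *\<^sub>R x u) has_vector_derivative - (p' u *\<^sub>R x u)) (at u within {a..c})"
      using xy u uc unfolding path_integral_def
      by (auto intro: has_vector_derivative_within_subset)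
    then show ?thesis
      by (subst has_vector_derivative_cong_ev[where g="\<lambda>u. y u - p u *\<^sub>R x u"]) (use uc in \<open>auto simp: min_def\<close>)
  qed
  have right: "(?f has_vector_derivative ?D) (at u within {c..})" if uc: "u \<ge> c"
  proof -
    have "(p has_vector_derivative p' u) (at u within {c..})"
      using C1_fromD[OF p u] c
      by (auto simp: has_real_derivative_iff_has_vector_derivative
          intro: has_vector_derivative_within_subset)
    then have "((\<lambda>u. y c - p u *\<^sub>R x c) has_vector_derivative 0 - (p u *\<^sub>R 0 + p' u *\<^sub>R x c)) (at u within {c..})"
      by (intro has_vector_derivative_diff has_vector_derivative_scaleR)
         (auto simp: has_real_derivative_iff_has_vector_derivative)
    then show ?thesis
      by (subst has_vector_derivative_cong_ev[where g="\<lambda>u. y c - p u *\<^sub>R x c"]) (use uc in \<open>auto simp: min_def\<close>)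
  qed
  have U: "{a..} = {a..c} \<union> {c..}" using c by auto
  consider "u < c" | "u = c" | "u > c" by linarith
  then show "(?f has_vector_derivative ?D) (at u within {a..})"
  proof cases
    case 1
    have "at u within {a..} = at u within {a..c}"
      by (rule at_within_nhd[of _ "{..<c}"]) (use 1 in auto)
    then show ?thesis using left 1 by simp
  next
    \<comment> \<open>At the stopping time the left and the right derivative agree, and together
      they give the derivative within the union.\<close>
    case 2
    then show ?thesis
      using left right unfolding U has_vector_derivative_def has_derivative_within
      by (auto simp: Lim_within_Un)
  next
    case 3
    have "at u within {a..} = at u within {c..}"
      by (rule at_within_nhd[of _ "{c<..}"]) (use 3 c in auto)
    then show ?thesis using right 3 by simp
  qed
qed (use assms in \<open>auto simp: path_integral_def min_def\<close>)

text \<open>The chain rule applied to y - p x; the clock contributes the factor \<theta>' to the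
  derivative of the weight.\<close>

lemma path_integral_subst:
  assumes \<theta>: "C1_from a \<theta> \<theta>'" "\<theta> a = a'" "\<And>u. a \<le> u \<Longrightarrow> a' \<le> \<theta> u"
    and xy: "path_integral a' p p' x y"
  shows "path_integral a (\<lambda>u. p (\<theta> u)) (\<lambda>u. p' (\<theta> u) * \<theta>' u) (\<lambda>u. x (\<theta> u)) (\<lambda>u. y (\<theta> u))"
  unfolding path_integral_def
proof (intro conjI allI impI)
  fix u assume u: "a \<le> u"
  let ?f = "\<lambda>u. y u - p u *\<^sub>R x u"
  have "(?f has_vector_derivative - (p' (\<theta> u) *\<^sub>R x (\<theta> u))) (at (\<theta> u) within {a'..})"
    using xy \<theta>(3)[OF u] by (simp add: path_integral_def)
  then have "(?f has_vector_derivative - (p' (\<theta> u) *\<^sub>R x (\<theta> u))) (at (\<theta> u) within \<theta> ` {a..})"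
    by (rule has_vector_derivative_within_subset) (use \<theta>(3) in auto)
  from vector_diff_chain_within[OF _ this, of "\<theta>' u"]
  show "((\<lambda>u. y (\<theta> u) - p (\<theta> u) *\<^sub>R x (\<theta> u)) has_vector_derivative
         - ((p' (\<theta> u) * \<theta>' u) *\<^sub>R x (\<theta> u))) (at u within {a..})"
    using C1_fromD[OF \<theta>(1) u]
    by (auto simp: has_real_derivative_iff_has_vector_derivative o_def mult.commute)
qed (use assms in \<open>auto simp: path_integral_def\<close>)

lemma norm_diff_le_of_vector_derivative:
  fixes f :: "real \<Rightarrow> 'b::real_normed_vector"
  assumes "\<And>r. c \<le> r \<Longrightarrow> r \<le> v \<Longrightarrow> (f has_vector_derivative f' r) (at r within {c..v})"
    and "\<And>r. c \<le> r \<Longrightarrow> r \<le> v \<Longrightarrow> norm (f' r) \<le> B" and "c \<le> v"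
  shows "norm (f v - f c) \<le> B * (v - c)"
proof -
  have "norm (f v - f c) \<le> B * norm (v - c)"
  proof (rule differentiable_bound[of "{c..v}" f "\<lambda>r h. h *\<^sub>R f' r"])
    fix r assume r: "r \<in> {c..v}"
    have B: "norm (f' r) \<le> B" using assms(2)[of r] r by auto
    show "onorm (\<lambda>h. h *\<^sub>R f' r) \<le> B"
      by (rule onorm_bound) (use B in \<open>auto simp: mult.commute[of B] intro!: mult_left_mono
           intro: order_trans[OF norm_ge_zero]\<close>)
  qed (use assms in \<open>auto simp: has_vector_derivative_def\<close>)
  then show ?thesis using assms by simp
qed

text \<open>The 2 counts the boundary terms of integration by parts, u - a comes from integrating p'
  x. A bound by the sup norm of the path takes the place of probabilistic estimates.\<close>

lemma path_integral_bound:
  assumes xy: "path_integral a p p' x y" and T: "a \<le> u"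
    and P: "\<And>r. a \<le> r \<Longrightarrow> r \<le> u \<Longrightarrow> \<bar>p r\<bar> \<le> K" "\<And>r. a \<le> r \<Longrightarrow> r \<le> u \<Longrightarrow> \<bar>p' r\<bar> \<le> K"
    and e: "\<And>r. a \<le> r \<Longrightarrow> r \<le> u \<Longrightarrow> norm (x r) \<le> e"
  shows "norm (y u) \<le> K * e * (2 + (u - a))"
proof -
  let ?f = "\<lambda>u. y u - p u *\<^sub>R x u"
  have e0: "0 \<le> e" using e[of a] T norm_ge_zero[of "x a"] by linarith
  have K0: "0 \<le> K" using P(1)[of a] T by auto
  have "norm (?f u - ?f a) \<le> (K * e) * (u - a)"
    by (rule norm_diff_le_of_vector_derivative[where f'="\<lambda>r. - (p' r *\<^sub>R x r)"])
       (use xy T P e e0 K0 in \<open>auto simp: path_integral_def intro!: mult_mono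
          intro: has_vector_derivative_within_subset\<close>)
  moreover have "y u = (?f u - ?f a) + p u *\<^sub>R x u - p a *\<^sub>R x a"
    using xy by (simp add: path_integral_def)
  moreover have "norm (p u *\<^sub>R x u) \<le> K * e" "norm (p a *\<^sub>R x a) \<le> K * e"
    using P e T e0 K0 by (auto intro!: mult_mono)
  ultimately have "norm (y u) \<le> (K * e) * (u - a) + K * e + K * e"
    by (smt (verit) norm_triangle_ineq norm_triangle_ineq4)
  then show ?thesis by (simp add: algebra_simps)
qed

text \<open>By linearity \<open>path_integral_bound\<close> applies to the differences. This carries
  the almost sure uniform limit that defines an Ito integral through a change of weight.\<close>

lemma path_integral_uniform_limit:
  assumes p: "C1_from a p p'" and xy: "\<And>n. path_integral a p p' (x n) (y n)"
    and xy0: "path_integral a p p' x0 y0"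
    and lim: "uniform_limit {a..T} x x0 sequentially"
  shows "uniform_limit {a..T} y y0 sequentially"
proof (cases "a \<le> T")
  case True
  obtain K where K: "K > 0" "\<And>u. a \<le> u \<Longrightarrow> u \<le> T \<Longrightarrow> \<bar>p u\<bar> \<le> K" "\<And>u. a \<le> u \<Longrightarrow> u \<le> T \<Longrightarrow> \<bar>p' u\<bar> \<le> K"
    using C1_from_bound[OF p] by blast
  show ?thesis
  proof (rule uniform_limitI)
    fix e :: real assume e: "e > 0"
    define N where "N = 2 + (T - a)"
    have N: "N > 0" using True by (simp add: N_def)
    define d where "d = e / (K * N) / 2"
    have d: "d > 0" "K * d * (2 + (T - a)) < e" using e K(1) N
      unfolding N_def[symmetric] by (auto simp: d_def)
    from uniform_limitD[OF lim d(1)]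
    show "\<forall>\<^sub>F n in sequentially. \<forall>u\<in>{a..T}. dist (y n u) (y0 u) < e"
    proof eventually_elim
      case (elim n)
      show ?case
      proof
        fix u assume u: "u \<in> {a..T}"
        have "norm (y n u - y0 u) \<le> K * d * (2 + (u - a))"
          by (rule path_integral_bound[OF path_integral_diff[OF xy xy0]])
             (use u K elim in \<open>auto simp: dist_norm less_imp_le\<close>)
        also have "\<dots> \<le> K * d * (2 + (T - a))" using K d u by (intro mult_left_mono) auto
        finally show "dist (y n u) (y0 u) < e" using d by (simp add: dist_norm)
      qed
    qed
  qed
qed (simp add: uniform_limit_iff)

text \<open>Up to sign, the error of one Riemann term is the integral of p' r (x v - x r) over the
  cell: adding p r x v, with \<open>x v\<close> frozen, to y - p x turns the derivative into this
  integrand. So the oscillation of \<open>x\<close> counts, not its variation.\<close>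

lemma path_integral_cell:
  assumes p: "C1_from a p p'" and xy: "path_integral a p p' x y" and c: "a \<le> c" "c \<le> v"
    and K: "\<And>r. c \<le> r \<Longrightarrow> r \<le> v \<Longrightarrow> \<bar>p' r\<bar> \<le> K"
    and e: "\<And>r. c \<le> r \<Longrightarrow> r \<le> v \<Longrightarrow> norm (x v - x r) \<le> e"
  shows "norm (p c *\<^sub>R (x v - x c) - (y v - y c)) \<le> K * e * (v - c)"
proof -
  let ?f = "\<lambda>r. (y r - p r *\<^sub>R x r) + p r *\<^sub>R x v"
  have K0: "0 \<le> K" using K[of c] c by auto
  have "norm (?f v - ?f c) \<le> (K * e) * (v - c)"
  proof (rule norm_diff_le_of_vector_derivative[where f'="\<lambda>r. - (p' r *\<^sub>R x r) + (p r *\<^sub>R 0 + p' r *\<^sub>R x v)"])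
    fix r assume r: "c \<le> r" "r \<le> v"
    show "(?f has_vector_derivative (- (p' r *\<^sub>R x r) + (p r *\<^sub>R 0 + p' r *\<^sub>R x v))) (at r within {c..v})"
      by (rule has_vector_derivative_within_subset[where S="{a..}"],
          intro has_vector_derivative_add has_vector_derivative_scaleR)
         (use xy r c C1_fromD[OF p, of r] in \<open>auto simp: path_integral_def\<close>)
    have "- (p' r *\<^sub>R x r) + (p r *\<^sub>R 0 + p' r *\<^sub>R x v) = p' r *\<^sub>R (x v - x r)"
      by (simp add: algebra_simps)
    then show "norm (- (p' r *\<^sub>R x r) + (p r *\<^sub>R 0 + p' r *\<^sub>R x v)) \<le> K * e"
      using K[OF r] e[OF r] K0 by (auto intro!: mult_mono)
  qed fact
  moreover have "?f v - ?f c = - (p c *\<^sub>R (x v - x c) - (y v - y c))" by (simp add: algebra_simps)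
  ultimately show ?thesis by (simp only: norm_minus_cancel)
qed

section \<open>Riemann sums on uniform grids\<close>

text \<open>For \<open>k = 0\<close> division by zero collapses all points to \<open>a\<close>,
  hence the condition \<open>0 < k\<close> in \<open>grid_end\<close>. Indices beyond
  \<open>k\<close> run past the end point, hence the condition in \<open>grid_le\<close>.\<close>

definition grid :: "real \<Rightarrow> real \<Rightarrow> nat \<Rightarrow> nat \<Rightarrow> real" where
  "grid a b k j = a + real j * (b - a) / real k"

lemma grid_0 [simp]: "grid a b k 0 = a" by (simp add: grid_def)
lemma grid_end [simp]: "0 < k \<Longrightarrow> grid a b k k = b" by (simp add: grid_def)
lemma grid_mono: "a \<le> b \<Longrightarrow> i \<le> j \<Longrightarrow> grid a b k i \<le> grid a b k j"
  by (auto simp: grid_def intro!: divide_right_mono mult_right_mono)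
lemma grid_ge: "a \<le> b \<Longrightarrow> a \<le> grid a b k j"
  by (auto simp: grid_def)
lemma grid_le: "a \<le> b \<Longrightarrow> j \<le> k \<Longrightarrow> grid a b k j \<le> b"
  using grid_mono[of a b j k k] by (cases "k = 0") auto
lemma grid_step: "grid a b k (Suc j) - grid a b k j = (b - a) / real k"
  by (simp add: grid_def add_divide_distrib distrib_right)

lemma grid_mesh:
  assumes "d > 0"
  shows "\<forall>\<^sub>F k in sequentially. 0 < k \<and> (\<forall>j. grid a b k (Suc j) - grid a b k j < d)"
proof -
  have "(\<lambda>k. (b - a) / real k) \<longlonglongrightarrow> 0" by (rule lim_const_over_n)
  from order_tendstoD(2)[OF this assms] eventually_gt_at_top[of 0]
  show ?thesis by eventually_elim (simp add: grid_step)
qed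

text \<open>The cell errors are at most K \<eta> times the length of the cell and add up to K \<eta>
  (\<beta> - \<alpha>). Stopping at \<open>u\<close> only shortens or empties cells, so the bound is
  uniform in \<open>u\<close>; elementary integrals with frozen weights have exactly this stopped
  form.\<close>

lemma path_integral_riemann_sums:
  assumes p: "C1_from a p p'" and xy: "path_integral a p p' x y" and x: "continuous_on {a..} x"
    and ab: "a \<le> \<alpha>" "\<alpha> \<le> \<beta>"
  shows "uniform_limit UNIV
     (\<lambda>k u. \<Sum>j<k. p (grid \<alpha> \<beta> k j) *\<^sub>R (x (min (grid \<alpha> \<beta> k (Suc j)) u) - x (min (grid \<alpha> \<beta> k j) u)))
     (\<lambda>u. y (min \<beta> u) - y (min \<alpha> u)) sequentially"
proof (rule uniform_limitI)
  fix e :: real assume e: "e > 0"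
  obtain K where K: "K > 0" "\<And>u. a \<le> u \<Longrightarrow> u \<le> \<beta> \<Longrightarrow> \<bar>p u\<bar> \<le> K" "\<And>u. a \<le> u \<Longrightarrow> u \<le> \<beta> \<Longrightarrow> \<bar>p' u\<bar> \<le> K"
    using C1_from_bound[OF p] by blast
  \<comment> \<open>The added 1 keeps the divisor in \<eta> positive when \<alpha> =
    \<beta>.\<close>
  define N where "N = 1 + (\<beta> - \<alpha>)"
  have N: "N > 0" "\<beta> - \<alpha> \<le> N" using ab by (auto simp: N_def)
  define \<eta> where "\<eta> = e / (K * N) / 2"
  have \<eta>: "\<eta> > 0" "K * \<eta> * (\<beta> - \<alpha>) < e" using e K(1) ab
  proof -
    show 0: "\<eta> > 0" using e K N by (auto simp: \<eta>_def)
    have "K * \<eta> * (\<beta> - \<alpha>) \<le> K * \<eta> * N"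
      using K 0 N by (intro mult_left_mono) auto
    also have "\<dots> = e / 2" using K N by (simp add: \<eta>_def)
    finally show "K * \<eta> * (\<beta> - \<alpha>) < e" using e by simp
  qed
  have "uniformly_continuous_on {\<alpha>..\<beta>} x"
    by (rule compact_uniformly_continuous) (use ab in \<open>auto intro: continuous_on_subset[OF x]\<close>)
  from uniformly_continuous_onE[OF this \<eta>(1)] obtain d where d: "d > 0"
    "\<And>r r'. r \<in> {\<alpha>..\<beta>} \<Longrightarrow> r' \<in> {\<alpha>..\<beta>} \<Longrightarrow> dist r' r < d \<Longrightarrow> dist (x r') (x r) < \<eta>" by metis
  from grid_mesh[OF d(1), of \<alpha> \<beta>]
  show "\<forall>\<^sub>F k in sequentially. \<forall>u\<in>UNIV.
     dist (\<Sum>j<k. p (grid \<alpha> \<beta> k j) *\<^sub>R (x (min (grid \<alpha> \<beta> k (Suc j)) u) - x (min (grid \<alpha> \<beta> k j) u)))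
     (y (min \<beta> u) - y (min \<alpha> u)) < e"
  proof eventually_elim
    case (elim k)
    show ?case
    proof
      fix u
      let ?c = "grid \<alpha> \<beta> k"
      have step: "norm (p (?c j) *\<^sub>R (x (min (?c (Suc j)) u) - x (min (?c j) u))
            - (y (min (?c (Suc j)) u) - y (min (?c j) u))) \<le> K * \<eta> * (?c (Suc j) - ?c j)"
        if j: "j < k" for j
      \<comment> \<open>If the cell starts after \<open>u\<close>, both stopped increments vanish;
        otherwise at most its right end moves.\<close>
      proof (cases "u \<le> ?c j")
        case True
        have "?c j \<le> ?c (Suc j)" by (rule grid_mono) (use ab in auto)
        then show ?thesis using True K \<eta> by (simp add: min_absorb2)
      next
        case False
        have m: "?c j \<le> ?c (Suc j)" "\<alpha> \<le> ?c j" "?c (Suc j) \<le> \<beta>"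
          using ab j by (auto intro!: grid_mono grid_ge grid_le)
        let ?v = "min (?c (Suc j)) u"
        have v: "?c j \<le> ?v" "?v \<le> ?c (Suc j)" using False m by auto
        have "norm (p (?c j) *\<^sub>R (x ?v - x (?c j)) - (y ?v - y (?c j))) \<le> K * \<eta> * (?v - ?c j)"
        proof (rule path_integral_cell[OF p xy])
          fix r assume r: "?c j \<le> r" "r \<le> ?v"
          show "\<bar>p' r\<bar> \<le> K" using K(3)[of r] r m v ab by linarith
          have "dist ?v r < d" using r v elim[THEN conjunct2, rule_format, of j] by (auto simp: dist_real_def)
          then have "dist (x ?v) (x r) < \<eta>" using r v m by (intro d(2)) auto
          then show "norm (x ?v - x r) \<le> \<eta>" by (simp add: dist_norm)
        qed (use m v ab in auto)
        also have "\<dots> \<le> K * \<eta> * (?c (Suc j) - ?c j)" using v K \<eta> by (intro mult_left_mono) auto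
        finally show ?thesis using False by (simp add: min_absorb1)
      qed
      have tel: "(\<Sum>j<k. y (min (?c (Suc j)) u) - y (min (?c j) u)) = y (min \<beta> u) - y (min \<alpha> u)"
        using elim by (subst sum_lessThan_telescope) simp
      have tel': "(\<Sum>j<k. K * \<eta> * (?c (Suc j) - ?c j)) = K * \<eta> * (\<beta> - \<alpha>)"
        using elim unfolding sum_distrib_left[symmetric] by (subst sum_lessThan_telescope) simp
      have "norm (\<Sum>j<k. p (?c j) *\<^sub>R (x (min (?c (Suc j)) u) - x (min (?c j) u))
            - (y (min (?c (Suc j)) u) - y (min (?c j) u))) \<le> K * \<eta> * (\<beta> - \<alpha>)"
        unfolding tel'[symmetric] by (rule sum_norm_le) (use step in auto)
      then show "dist (\<Sum>j<k. p (?c j) *\<^sub>R (x (min (?c (Suc j)) u) - x (min (?c j) u)))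
          (y (min \<beta> u) - y (min \<alpha> u)) < e"
        using \<eta>(2) unfolding dist_norm tel[symmetric] sum_subtractf by linarith
    qed
  qed
qed

corollary path_integral_riemann_sums_tendsto:
  assumes p: "C1_from a p p'" and xy: "path_integral a p p' x y" and x: "continuous_on {a..} x"
    and ab: "a \<le> \<alpha>" "\<alpha> \<le> \<beta>"
  shows "(\<lambda>k. \<Sum>j<k. p (grid \<alpha> \<beta> k j) *\<^sub>R (x (grid \<alpha> \<beta> k (Suc j)) - x (grid \<alpha> \<beta> k j)))
     \<longlonglongrightarrow> y \<beta> - y \<alpha>"
proof -
  have "(\<lambda>k. \<Sum>j<k. p (grid \<alpha> \<beta> k j) *\<^sub>R (x (min (grid \<alpha> \<beta> k (Suc j)) \<beta>) - x (min (grid \<alpha> \<beta> k j) \<beta>)))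
     \<longlonglongrightarrow> y (min \<beta> \<beta>) - y (min \<alpha> \<beta>)"
    by (rule tendsto_uniform_limitI[OF path_integral_riemann_sums[OF assms] UNIV_I])
  moreover have "(\<Sum>j<k. p (grid \<alpha> \<beta> k j) *\<^sub>R (x (min (grid \<alpha> \<beta> k (Suc j)) \<beta>) - x (min (grid \<alpha> \<beta> k j) \<beta>)))
     = (\<Sum>j<k. p (grid \<alpha> \<beta> k j) *\<^sub>R (x (grid \<alpha> \<beta> k (Suc j)) - x (grid \<alpha> \<beta> k j)))" for k
    by (rule sum.cong) (use ab in \<open>auto simp: min_absorb1 grid_le\<close>)
  ultimately show ?thesis using ab by (simp add: min_absorb1)
qed

section \<open>Hilbert--Schmidt norm\<close>

text \<open>Bessel's inequality: \<open>v\<close> is the orthogonal projection of \<open>h\<close>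
  onto the span of \<open>C\<close>, and expanding 0 \<le> |h - v|^2 gives the bound.\<close>

lemma sum_inner_sq_le_of_orthonormal:
  fixes h :: "'a::real_inner"
  assumes "finite C" "\<And>e. e \<in> C \<Longrightarrow> norm e = 1" "pairwise orthogonal C"
  shows "(\<Sum>e\<in>C. (h \<bullet> e)\<^sup>2) \<le> (norm h)\<^sup>2"
proof -
  define v where "v = (\<Sum>e\<in>C. (h \<bullet> e) *\<^sub>R e)"
  have "(norm v)\<^sup>2 = (\<Sum>e\<in>C. (norm ((h \<bullet> e) *\<^sub>R e))\<^sup>2)"
    unfolding v_def by (rule norm_sum_Pythagorean)
      (use assms in \<open>auto simp: pairwise_def orthogonal_clauses\<close>)
  then have v: "v \<bullet> v = (\<Sum>e\<in>C. (h \<bullet> e)\<^sup>2)"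
    using assms by (simp add: power2_norm_eq_inner[symmetric] power_mult_distrib)
  have hv: "h \<bullet> v = (\<Sum>e\<in>C. (h \<bullet> e)\<^sup>2)"
    by (simp add: v_def inner_sum_right power2_eq_square)
  have "0 \<le> (h - v) \<bullet> (h - v)" by simp
  also have "\<dots> = h \<bullet> h - (\<Sum>e\<in>C. (h \<bullet> e)\<^sup>2)"
    using v hv by (simp add: inner_diff inner_commute)
  finally show ?thesis by (simp add: power2_norm_eq_inner)
qed

text \<open>Distinct orthonormal vectors are sqrt 2 apart, so the balls of radius 1/2 around them
  are disjoint open sets, of which a second countable space has only countably many. The sum over a
  basis thereby becomes a series.\<close>

lemma countable_orthonormal:
  fixes B :: "'a::{real_inner, second_countable_topology} set"
  assumes "\<And>e. e \<in> B \<Longrightarrow> norm e = 1" "pairwise orthogonal B"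
  shows "countable B"
proof -
  let ?b = "\<lambda>e::'a. ball e (1/2)"
  have dist: "1 < dist e e'" if "e \<in> B" "e' \<in> B" "e \<noteq> e'" for e e'
  proof -
    have "(norm (e - e'))\<^sup>2 = 2"
      using that assms unfolding power2_norm_eq_inner
      by (auto simp: inner_diff pairwise_def orthogonal_def inner_commute norm_eq_1)
    then have "1\<^sup>2 < (norm (e - e'))\<^sup>2" by simp
    then show ?thesis unfolding dist_norm by (rule power_less_imp_less_base) simp
  qed
  have dj: "disjnt (?b e) (?b e')" if "e \<in> B" "e' \<in> B" "e \<noteq> e'" for e e'
    using dist[OF that] unfolding disjnt_def by (intro disjoint_ballI) simp
  have "countable (?b ` B)"
    by (rule countable_disjoint_open_subsets) (auto simp: pairwise_def intro!: dj)
  moreover have "inj_on ?b B"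
  proof (rule inj_onI)
    fix e e' assume e: "e \<in> B" "e' \<in> B" "?b e = ?b e'"
    show "e = e'"
    proof (rule ccontr)
      assume "e \<noteq> e'"
      from dj[OF e(1,2) this] e(3) show False by (auto simp: disjnt_def)
    qed
  qed
  ultimately show ?thesis by (simp add: countable_image_inj_eq)
qed

text \<open>One Gram-Schmidt step: \<open>u\<close> is the normalised remainder of \<open>x\<close>
  after subtracting its projection \<open>s\<close>; a zero remainder adds nothing.\<close>

lemma orthonormal_extend:
  fixes B :: "'a::real_inner set"
  assumes "finite B" "\<forall>e\<in>B. norm e = 1" "pairwise orthogonal B"
  shows "\<exists>B'. B \<subseteq> B' \<and> finite B' \<and> (\<forall>e\<in>B'. norm e = 1) \<and> pairwise orthogonal B' \<and> x \<in> span B'"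
proof -
  define s where "s = (\<Sum>e\<in>B. (x \<bullet> e) *\<^sub>R e)"
  have s: "s \<in> span B" unfolding s_def by (intro span_sum span_scale span_base)
  show ?thesis
  proof (cases "x = s")
    case True then show ?thesis using s assms by blast
  next
    case False
    define u where "u = (x - s) /\<^sub>R norm (x - s)"
    have orth: "(x - s) \<bullet> e = 0" if e: "e \<in> B" for e
    proof -
      have "s \<bullet> e = (\<Sum>e'\<in>B. (x \<bullet> e') * (e' \<bullet> e))" by (simp add: s_def inner_sum_left)
      also have "\<dots> = (\<Sum>e'\<in>B. if e' = e then x \<bullet> e else 0)"
        by (rule sum.cong) (use assms e in \<open>auto simp: pairwise_def orthogonal_def norm_eq_1\<close>)
      also have "\<dots> = x \<bullet> e" using assms e by simp
      finally show ?thesis by (simp add: inner_diff)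
    qed
    have ou: "u \<bullet> e = 0" "e \<bullet> u = 0" if "e \<in> B" for e
      using orth[OF that] by (simp_all add: u_def inner_commute)
    have "x = s + norm (x - s) *\<^sub>R u" using False by (simp add: u_def)
    moreover have "s + norm (x - s) *\<^sub>R u \<in> span (insert u B)"
      using s span_mono[of B "insert u B"] by (intro span_add span_scale) (auto intro: span_base)
    ultimately have "x \<in> span (insert u B)" by simp
    moreover have "norm u = 1" using False by (simp add: u_def)
    ultimately show ?thesis
      using assms ou by (intro exI[of _ "insert u B"]) (auto simp: pairwise_insert orthogonal_def)
  qed
qed

text \<open>Gram-Schmidt along a countable dense sequence, the nested finite stages being obtained
  by dependent choice. It guarantees that the choice operator in \<open>hs_norm_sq\<close> selects a
  genuine basis.\<close>

lemma orthonormal_basis_exists: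
  "\<exists>B :: 'a::{real_inner, second_countable_topology} set. orthonormal_basis B"
proof -
  obtain D :: "'a set" where D: "countable D" "\<And>X. open X \<Longrightarrow> X \<noteq> {} \<Longrightarrow> \<exists>d\<in>D. d \<in> X"
    using countable_dense_setE by metis
  have "D \<noteq> {}" using D(2)[of UNIV] by auto
  define d where "d = from_nat_into D"
  have dD: "range d = D" using D(1) \<open>D \<noteq> {}\<close> by (simp add: d_def range_from_nat_into)
  define P where "P n B \<longleftrightarrow> finite B \<and> (\<forall>e\<in>B. norm e = 1) \<and> pairwise orthogonal B \<and> d n \<in> span B"
    for n :: nat and B
  have "\<exists>f. \<forall>n. P n (f n) \<and> f n \<subseteq> f (Suc n)"
  proof (rule dependent_nat_choice)
    show "\<exists>B. P 0 B" using orthonormal_extend[of "{}" "d 0"] by (auto simp: P_def)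
    show "\<exists>B'. P (Suc n) B' \<and> B \<subseteq> B'" if "P n B" for B n
      using that orthonormal_extend[of B "d (Suc n)"] by (auto simp: P_def)
  qed
  then obtain f where f: "\<And>n. P n (f n)" "\<And>n. f n \<subseteq> f (Suc n)" by blast
  have mono: "f m \<subseteq> f n" if "m \<le> n" for m n
    using lift_Suc_mono_le[of f] f(2) that by blast
  define U where "U = (\<Union>n. f n)"
  have "pairwise orthogonal U"
  proof (rule pairwiseI)
    fix x y assume "x \<in> U" "y \<in> U" "x \<noteq> y"
    then obtain m n where "x \<in> f m" "y \<in> f n" by (auto simp: U_def)
    then have "x \<in> f (max m n)" "y \<in> f (max m n)" using mono by (meson max.cobounded1 max.cobounded2 subsetD)+
    then show "orthogonal x y" using f(1)[of "max m n"] \<open>x \<noteq> y\<close> by (auto simp: P_def pairwise_def)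
  qed
  moreover have "D \<subseteq> span U"
  proof -
    have "d n \<in> span U" for n
      using f(1)[of n] span_mono[of "f n" U] by (auto simp: P_def U_def)
    then show ?thesis using dD by auto
  qed
  moreover have "closure D = UNIV"
  proof -
    have "x \<in> closure D" for x
      unfolding closure_iff_nhds_not_empty
    proof (intro allI impI)
      fix A V assume "V \<subseteq> A" "open V" "x \<in> V"
      then show "D \<inter> A \<noteq> {}" using D(2)[of V] by blast
    qed
    then show ?thesis by auto
  qed
  ultimately have "orthonormal_basis U"
    using f(1) closure_mono[of D "span U"] by (auto simp: orthonormal_basis_def U_def P_def)
  then show ?thesis ..
qed

lemma hs_norm_sq_scaleR: "hs_norm_sq (c *\<^sub>R T) = ennreal (c\<^sup>2) * hs_norm_sq T"
  by (simp add: hs_norm_sq_def nn_integral_cmult[symmetric] blinfun.scaleR_left power_mult_distrib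
      ennreal_mult)

lemma hs_norm_sq_mono:
  "(\<And>x. norm (blinfun_apply S x) \<le> norm (blinfun_apply T x)) \<Longrightarrow> hs_norm_sq S \<le> hs_norm_sq T"
  unfolding hs_norm_sq_def by (intro nn_integral_mono ennreal_leI power_mono) auto

text \<open>Young's inequality 2 x y \<le> l x^2 + y^2 / l, summed over the basis. The parameter
  stays free because \<open>hs_open_ball\<close> wants the first factor close to 1;
  \<open>l = 1\<close> gives the crude version used for error estimates.\<close>

lemma hs_norm_sq_add_le:
  assumes l: "l > 0"
  shows "hs_norm_sq (A + B) \<le> ennreal (1 + l) * hs_norm_sq A + ennreal (1 + 1 / l) * hs_norm_sq B"
proof -
  have *: "(norm (a + b))\<^sup>2 \<le> (1 + l) * (norm a)\<^sup>2 + (1 + 1 / l) * (norm b)\<^sup>2" for a b :: 'b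
  proof -
    have "(norm (a + b))\<^sup>2 \<le> (norm a + norm b)\<^sup>2" by (intro power_mono norm_triangle_ineq) simp
    moreover have "2 * (norm a * norm b) \<le> l * (norm a)\<^sup>2 + (1 / l) * (norm b)\<^sup>2"
    proof -
      have "0 \<le> (l * norm a - norm b)\<^sup>2 / l" using l by simp
      then show ?thesis using l by (simp add: power2_eq_square field_simps)
    qed
    ultimately show ?thesis by (simp add: power2_sum algebra_simps)
  qed
  have "hs_norm_sq (A + B) \<le> (\<integral>\<^sup>+ e. ennreal (1 + l) * ennreal ((norm (A e))\<^sup>2) +
      ennreal (1 + 1 / l) * ennreal ((norm (B e))\<^sup>2) \<partial>count_space (SOME B. orthonormal_basis B))"
    unfolding hs_norm_sq_def
  proof (intro nn_integral_mono)
    fix e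
    have "ennreal ((norm (A e + B e))\<^sup>2) \<le> ennreal ((1 + l) * (norm (A e))\<^sup>2 + (1 + 1 / l) * (norm (B e))\<^sup>2)"
      by (intro ennreal_leI *)
    also have "\<dots> = ennreal (1 + l) * ennreal ((norm (A e))\<^sup>2) + ennreal (1 + 1 / l) * ennreal ((norm (B e))\<^sup>2)"
      using l by (subst ennreal_plus) (auto simp: ennreal_mult)
    finally show "ennreal ((norm ((A + B) e))\<^sup>2) \<le> ennreal (1 + l) * ennreal ((norm (A e))\<^sup>2) +
        ennreal (1 + 1 / l) * ennreal ((norm (B e))\<^sup>2)" by (simp only: blinfun.add_left)
  qed
  also have "\<dots> = ennreal (1 + l) * hs_norm_sq A + ennreal (1 + 1 / l) * hs_norm_sq B"
    by (simp add: hs_norm_sq_def nn_integral_add nn_integral_cmult)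
  finally show ?thesis .
qed

lemma hs_norm_sq_add_le2: "hs_norm_sq (A + B) \<le> 2 * hs_norm_sq A + 2 * hs_norm_sq B"
  using hs_norm_sq_add_le[of 1 A B] by simp

text \<open>Bessel's inequality bounds every finite partial sum, and the basis is countable.\<close>

lemma hs_norm_sq_rank_one_le:
  fixes h :: "'a::{real_inner, second_countable_topology}"
  shows "hs_norm_sq (rank_one h g) \<le> ennreal ((norm h)\<^sup>2 * (norm g)\<^sup>2)"
proof -
  define B where "B = (SOME B :: 'a set. orthonormal_basis B)"
  have "orthonormal_basis B" unfolding B_def using orthonormal_basis_exists by (rule someI_ex)
  then have B: "\<And>e. e \<in> B \<Longrightarrow> norm e = 1" "pairwise orthogonal B" by (auto simp: orthonormal_basis_def)
  have fin: "(\<Sum>e\<in>C. ennreal ((h \<bullet> e)\<^sup>2)) \<le> ennreal ((norm h)\<^sup>2)" if "finite C" "C \<subseteq> B" for C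
    using sum_inner_sq_le_of_orthonormal[of C h] that B
    by (auto simp: sum_ennreal intro!: ennreal_leI intro: pairwise_subset)
  have "(\<integral>\<^sup>+ e. ennreal ((h \<bullet> e)\<^sup>2) \<partial>count_space B) \<le> ennreal ((norm h)\<^sup>2)"
  proof (cases "finite B")
    case True then show ?thesis using fin[of B] by (simp add: nn_integral_count_space_finite)
  next
    case False
    have bij: "bij_betw (from_nat_into B) UNIV B"
      using countable_orthonormal[OF B] False by (rule bij_betw_from_nat_into)
    have "(\<integral>\<^sup>+ e. ennreal ((h \<bullet> e)\<^sup>2) \<partial>count_space B)
        = (\<Sum>n. ennreal ((h \<bullet> from_nat_into B n)\<^sup>2))"
      by (simp add: nn_integral_bij_count_space[OF bij, symmetric] nn_integral_count_space_nat)
    also have "\<dots> \<le> ennreal ((norm h)\<^sup>2)"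
      unfolding suminf_eq_SUP
    proof (rule SUP_least)
      fix n
      have "(\<Sum>i<n. ennreal ((h \<bullet> from_nat_into B i)\<^sup>2))
          = (\<Sum>e\<in>from_nat_into B ` {..<n}. ennreal ((h \<bullet> e)\<^sup>2))"
        by (rule sum.reindex_cong[symmetric])
           (use bij in \<open>auto simp: bij_betw_def intro: inj_on_subset\<close>)
      also have "\<dots> \<le> ennreal ((norm h)\<^sup>2)"
        by (rule fin) (use bij in \<open>auto simp: bij_betw_def\<close>)
      finally show "(\<Sum>i<n. ennreal ((h \<bullet> from_nat_into B i)\<^sup>2)) \<le> ennreal ((norm h)\<^sup>2)" .
    qed
    finally show ?thesis .
  qed
  then have "ennreal ((norm g)\<^sup>2) * (\<integral>\<^sup>+ e. ennreal ((h \<bullet> e)\<^sup>2) \<partial>count_space B)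
      \<le> ennreal ((norm g)\<^sup>2) * ennreal ((norm h)\<^sup>2)" by (rule mult_left_mono) simp
  moreover have "hs_norm_sq (rank_one h g)
      = (\<integral>\<^sup>+ e. ennreal ((norm g)\<^sup>2) * ennreal ((h \<bullet> e)\<^sup>2) \<partial>count_space B)"
    unfolding hs_norm_sq_def B_def[symmetric] rank_one.rep_eq norm_scaleR power_mult_distrib power2_abs
    by (intro nn_integral_cong) (simp add: ennreal_mult mult.commute)
  ultimately show ?thesis
    by (simp add: nn_integral_cmult ennreal_mult mult.commute)
qed

section \<open>Borel sets of the Hilbert-Schmidt norm\<close>

text \<open>The generators of \<open>hs_borel\<close>, named in order to exploit that arbitrary
  unions of them are again generators.\<close>

definition hs_open :: "('a::real_inner \<Rightarrow>\<^sub>L 'b::real_normed_vector) set \<Rightarrow> bool" where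
  "hs_open U \<longleftrightarrow> U \<subseteq> {T. hs_norm_sq T < \<infinity>} \<and>
     (\<forall>T\<in>U. \<exists>\<epsilon>>0. \<forall>S. hs_norm_sq (S - T) < ennreal (\<epsilon>\<^sup>2) \<longrightarrow> S \<in> U)"

lemma hs_borel_eq: "hs_borel = sigma {T. hs_norm_sq T < \<infinity>} {U. hs_open U}"
  by (simp add: hs_borel_def hs_open_def)

lemma space_hs_borel: "space hs_borel = {T. hs_norm_sq T < \<infinity>}"
  unfolding hs_borel_eq by (rule space_measure_of) (auto simp: hs_open_def)

lemma hs_open_sets: "hs_open U \<Longrightarrow> U \<in> sets hs_borel"
  unfolding hs_borel_eq by (subst sets_measure_of) (auto simp: hs_open_def)

lemma hs_open_Union:
  assumes "\<And>U. U \<in> \<U> \<Longrightarrow> hs_open U" shows "hs_open (\<Union>\<U>)"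
  unfolding hs_open_def
proof (intro conjI ballI)
  show "\<Union>\<U> \<subseteq> {T. hs_norm_sq T < \<infinity>}" using assms by (auto simp: hs_open_def)
  fix T assume "T \<in> \<Union>\<U>"
  then obtain U where U: "U \<in> \<U>" "T \<in> U" by auto
  then show "\<exists>\<epsilon>>0. \<forall>S. hs_norm_sq (S - T) < ennreal (\<epsilon>\<^sup>2) \<longrightarrow> S \<in> \<Union>\<U>"
    using assms[OF U(1)] unfolding hs_open_def by blast
qed

text \<open>Squared norms obey no triangle inequality. Instead, the gap \<delta>^2 - R left at
  \<open>S\<close> is shared between the two terms of \<open>hs_norm_sq_add_le\<close>.\<close>

lemma hs_open_ball:
  fixes T :: "'a::real_inner \<Rightarrow>\<^sub>L 'b::real_normed_vector"
  assumes T: "hs_norm_sq T < \<infinity>"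
  shows "hs_open {S. hs_norm_sq (S - T) < ennreal (\<delta>\<^sup>2)}"
  unfolding hs_open_def
proof (intro conjI ballI subsetI CollectI)
  fix S assume S: "S \<in> {S. hs_norm_sq (S - T) < ennreal (\<delta>\<^sup>2)}"
  have "hs_norm_sq ((S - T) + T) \<le> 2 * hs_norm_sq (S - T) + 2 * hs_norm_sq T" by (rule hs_norm_sq_add_le2)
  also have "\<dots> < \<infinity>" using S T by (auto simp: ennreal_mult_less_top intro: less_trans)
  finally show "hs_norm_sq S < \<infinity>" by simp
next
  fix S assume S: "S \<in> {S. hs_norm_sq (S - T) < ennreal (\<delta>\<^sup>2)}"
  then obtain R where R: "hs_norm_sq (S - T) = ennreal R" "0 \<le> R"
    by (cases "hs_norm_sq (S - T)") auto
  with S have RD: "R < \<delta>\<^sup>2" by (auto simp: ennreal_less_iff)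
  \<comment> \<open>With this weight the excess l R is at most half of the gap.\<close>
  define l where "l = (\<delta>\<^sup>2 - R) / (2 * \<delta>\<^sup>2)"
  have D: "\<delta>\<^sup>2 > 0" using RD R(2) by linarith
  have l: "l > 0" using RD D by (simp add: l_def)
  have lR: "l * R \<le> (\<delta>\<^sup>2 - R) / 2"
  proof -
    have "l * R \<le> l * \<delta>\<^sup>2" using l RD by (intro mult_left_mono) auto
    also have "\<dots> = (\<delta>\<^sup>2 - R) / 2" using D by (simp add: l_def)
    finally show ?thesis .
  qed
  \<comment> \<open>Chosen so that (1 + 1 / l) \<epsilon>^2 is exactly the other half of the
    gap.\<close>
  define \<epsilon> where "\<epsilon> = sqrt ((\<delta>\<^sup>2 - R) / (2 * (1 + 1 / l)))"
  have l1: "1 + 1 / l > 0" using l by (simp add: add_pos_pos)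
  have e: "\<epsilon> > 0" using l1 RD by (auto simp: \<epsilon>_def)
  have e2: "(1 + 1 / l) * \<epsilon>\<^sup>2 = (\<delta>\<^sup>2 - R) / 2"
  proof -
    have "\<epsilon>\<^sup>2 = (\<delta>\<^sup>2 - R) / (2 * (1 + 1 / l))"
      unfolding \<epsilon>_def by (rule real_sqrt_pow2) (use l1 RD in \<open>intro divide_nonneg_pos; simp\<close>)
    moreover have *: "c * (D / (2 * c)) = D / 2" if "c > 0" for c D :: real using that by simp
    ultimately show ?thesis by (simp only: *[OF l1])
  qed
  show "\<exists>\<epsilon>>0. \<forall>S'. hs_norm_sq (S' - S) < ennreal (\<epsilon>\<^sup>2) \<longrightarrow> S' \<in> {S. hs_norm_sq (S - T) < ennreal (\<delta>\<^sup>2)}"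
  proof (intro exI[of _ \<epsilon>] conjI allI impI e CollectI)
    fix S' assume S': "hs_norm_sq (S' - S) < ennreal (\<epsilon>\<^sup>2)"
    then obtain Q where Q: "hs_norm_sq (S' - S) = ennreal Q" "0 \<le> Q"
      by (cases "hs_norm_sq (S' - S)") auto
    with S' have QE: "Q < \<epsilon>\<^sup>2" by (auto simp: ennreal_less_iff)
    have "hs_norm_sq ((S - T) + (S' - S)) \<le> ennreal (1 + l) * ennreal R + ennreal (1 + 1 / l) * ennreal Q"
      using hs_norm_sq_add_le[OF l, of "S - T" "S' - S"] unfolding R Q .
    also have "\<dots> = ennreal ((1 + l) * R + (1 + 1 / l) * Q)"
      using l l1 R Q by (simp flip: ennreal_mult ennreal_plus)
    also have "\<dots> < ennreal (\<delta>\<^sup>2)"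
    proof (rule ennreal_lessI[OF D])
      have "(1 + 1 / l) * Q < (1 + 1 / l) * \<epsilon>\<^sup>2" using QE l1 by (rule mult_strict_left_mono)
      moreover have "(1 + l) * R = R + l * R" by (simp add: algebra_simps)
      moreover have "(\<delta>\<^sup>2 - R) / 2 + (\<delta>\<^sup>2 - R) / 2 = \<delta>\<^sup>2 - R" by simp
      ultimately show "(1 + l) * R + (1 + 1 / l) * Q < \<delta>\<^sup>2"
        using lR e2 by linarith
    qed
    finally show "hs_norm_sq (S' - T) < ennreal (\<delta>\<^sup>2)" by simp
  qed
qed

text \<open>Joint continuity of scaling, from c S - w T = c (S - T) + (c - w) T. Rational end points
  prepare a countable union.\<close>

lemma hs_open_scaleR_locally:
  fixes T :: "'a::real_inner \<Rightarrow>\<^sub>L 'b::real_normed_vector"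
  assumes U: "hs_open U" and wT: "w *\<^sub>R T \<in> U" and T: "hs_norm_sq T < \<infinity>"
  obtains p q O' where "p \<in> \<rat>" "q \<in> \<rat>" "p \<le> w" "w \<le> q" "hs_open O'" "T \<in> O'"
    "\<And>S c. S \<in> O' \<Longrightarrow> p \<le> c \<Longrightarrow> c \<le> q \<Longrightarrow> c *\<^sub>R S \<in> U"
proof -
  obtain e where e: "e > 0" "\<And>S. hs_norm_sq (S - w *\<^sub>R T) < ennreal (e\<^sup>2) \<Longrightarrow> S \<in> U"
    using U wT unfolding hs_open_def by blast
  obtain H where H: "hs_norm_sq T = ennreal H" "0 \<le> H" using T by (cases "hs_norm_sq T") auto
  \<comment> \<open>After doubling, each of the two terms may use half of e^2: \<eta> controls (c -
    w) T, and \<delta> controls c (S - T). The cap 1 gives |c| \<le> |w| + 1, and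
    \<open>H + 1\<close> avoids division by zero.\<close>
  define \<eta> where "\<eta> = min 1 (e / (2 * sqrt (H + 1)))"
  define \<delta> where "\<delta> = e / (2 * (\<bar>w\<bar> + 1))"
  have \<eta>: "\<eta> > 0" "\<eta> \<le> 1" using e H by (auto simp: \<eta>_def)
  have \<eta>2: "2 * \<eta>\<^sup>2 * H \<le> e\<^sup>2 / 2"
  proof -
    have "\<eta>\<^sup>2 \<le> (e / (2 * sqrt (H + 1)))\<^sup>2" using \<eta> by (intro power_mono) (auto simp: \<eta>_def)
    also have "\<dots> = e\<^sup>2 / (4 * (H + 1))" using H by (simp add: power_divide power_mult_distrib)
    finally have "\<eta>\<^sup>2 * (4 * (H + 1)) \<le> e\<^sup>2" using H by (simp add: pos_le_divide_eq)
    moreover have "\<eta>\<^sup>2 * (4 * (H + 1)) = 4 * (\<eta>\<^sup>2 * H) + 4 * \<eta>\<^sup>2" by (simp add: algebra_simps)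
    ultimately show ?thesis using zero_le_power2[of \<eta>] unfolding mult.assoc by linarith
  qed
  have w1: "\<bar>w\<bar> + 1 > 0" by simp
  have \<delta>: "\<delta> > 0" using e w1 unfolding \<delta>_def by (intro divide_pos_pos) auto
  have \<delta>2: "2 * (\<bar>w\<bar> + 1)\<^sup>2 * \<delta>\<^sup>2 = e\<^sup>2 / 2"
  proof -
    have *: "c * (e / (2 * c)) = e / 2" if "c > 0" for c :: real using that by simp
    have "((\<bar>w\<bar> + 1) * \<delta>)\<^sup>2 = (e / 2)\<^sup>2" unfolding \<delta>_def *[OF w1] ..
    then show ?thesis by (simp add: power_mult_distrib power_divide)
  qed
  obtain p where p: "p \<in> \<rat>" "w - \<eta> < p" "p < w" using Rats_dense_in_real[of "w - \<eta>" w] \<eta> by auto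
  obtain q where q: "q \<in> \<rat>" "w < q" "q < w + \<eta>" using Rats_dense_in_real[of w "w + \<eta>"] \<eta> by auto
  show thesis
  proof (rule that[of p q "{S. hs_norm_sq (S - T) < ennreal (\<delta>\<^sup>2)}"])
    show "hs_open {S. hs_norm_sq (S - T) < ennreal (\<delta>\<^sup>2)}" by (rule hs_open_ball[OF T])
    show "T \<in> {S. hs_norm_sq (S - T) < ennreal (\<delta>\<^sup>2)}"
      using \<delta> by (simp add: hs_norm_sq_def)
    fix S c assume S: "S \<in> {S. hs_norm_sq (S - T) < ennreal (\<delta>\<^sup>2)}" and c: "p \<le> c" "c \<le> q"
    obtain R where R: "hs_norm_sq (S - T) = ennreal R" "0 \<le> R"
      using S by (cases "hs_norm_sq (S - T)") auto
    with S have RD: "R < \<delta>\<^sup>2" by (auto simp: ennreal_less_iff)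
    have c1: "\<bar>c\<bar> \<le> \<bar>w\<bar> + 1" "\<bar>c - w\<bar> \<le> \<eta>" using c p q \<eta> by auto
    have c2: "c\<^sup>2 \<le> (\<bar>w\<bar> + 1)\<^sup>2" "(c - w)\<^sup>2 \<le> \<eta>\<^sup>2"
      using power_mono[OF c1(1), of 2] power_mono[OF c1(2), of 2] by auto
    have "hs_norm_sq (c *\<^sub>R S - w *\<^sub>R T) = hs_norm_sq (c *\<^sub>R (S - T) + (c - w) *\<^sub>R T)"
      by (simp add: algebra_simps)
    also have "\<dots> \<le> 2 * (ennreal (c\<^sup>2) * ennreal R) + 2 * (ennreal ((c - w)\<^sup>2) * ennreal H)"
      using hs_norm_sq_add_le2[of "c *\<^sub>R (S - T)" "(c - w) *\<^sub>R T"] unfolding hs_norm_sq_scaleR R H .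
    also have "\<dots> = ennreal (2 * (c\<^sup>2 * R) + 2 * ((c - w)\<^sup>2 * H))"
      using R(2) H(2) by (simp add: ennreal_mult ennreal_plus)
    also have "\<dots> < ennreal (e\<^sup>2)"
    proof (rule ennreal_lessI)
      have "c\<^sup>2 * R \<le> (\<bar>w\<bar> + 1)\<^sup>2 * R" using c2 R by (intro mult_right_mono)
      moreover have "(\<bar>w\<bar> + 1)\<^sup>2 * R < (\<bar>w\<bar> + 1)\<^sup>2 * \<delta>\<^sup>2" using RD w1 by (intro mult_strict_left_mono) auto
      moreover have "(c - w)\<^sup>2 * H \<le> \<eta>\<^sup>2 * H" using c2 H by (intro mult_right_mono)
      ultimately show "2 * (c\<^sup>2 * R) + 2 * ((c - w)\<^sup>2 * H) < e\<^sup>2"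
        using \<delta>2 \<eta>2 by (simp add: mult.assoc)
    qed (use e in auto)
    finally show "c *\<^sub>R S \<in> U" by (rule e(2))
  qed (use p q in auto)
qed

text \<open>For a rational interval, \<open>V p q\<close> gathers the open sets that every scalar of
  the interval maps into \<open>U\<close>. It is open as a union of open sets, so only the scalar
  factor has to be cut into countably many pieces.\<close>

lemma measurable_hs_borel_scaleR:
  fixes T :: "'s \<Rightarrow> 'a::real_inner \<Rightarrow>\<^sub>L 'b::real_normed_vector"
  assumes w[measurable]: "w \<in> borel_measurable N" and T[measurable]: "T \<in> N \<rightarrow>\<^sub>M hs_borel"
  shows "(\<lambda>s. w s *\<^sub>R T s) \<in> N \<rightarrow>\<^sub>M hs_borel"
proof -
  have TH: "hs_norm_sq (T s) < \<infinity>" if "s \<in> space N" for s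
    using measurable_space[OF T that] by (simp add: space_hs_borel)
  show ?thesis
    unfolding hs_borel_eq
  proof (rule measurable_measure_of)
    show "(\<lambda>s. w s *\<^sub>R T s) \<in> space N \<rightarrow> {T. hs_norm_sq T < \<infinity>}"
      using TH by (auto simp: hs_norm_sq_scaleR ennreal_mult_less_top)
  next
    fix U :: "('a \<Rightarrow>\<^sub>L 'b) set" assume "U \<in> {U. hs_open U}"
    then have U: "hs_open U" by simp
    define V where "V p q = \<Union>{O'. hs_open O' \<and> (\<forall>S\<in>O'. \<forall>c. p \<le> c \<and> c \<le> q \<longrightarrow> c *\<^sub>R S \<in> U)}" for p q
    have V: "V p q \<in> sets hs_borel" for p q
      unfolding V_def by (intro hs_open_sets hs_open_Union) auto
    have "(\<lambda>s. w s *\<^sub>R T s) -` U \<inter> space N =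
      (\<Union>p\<in>\<rat>. \<Union>q\<in>\<rat>. {s \<in> space N. p \<le> w s \<and> w s \<le> q} \<inter> (T -` V p q \<inter> space N))" (is "?L = ?R")
    proof (intro equalityI subsetI)
      fix s assume s: "s \<in> ?L"
      then have a: "w s *\<^sub>R T s \<in> U" and b: "s \<in> space N" by auto
      obtain p q O' where "p \<in> \<rat>" "q \<in> \<rat>" "p \<le> w s" "w s \<le> q" "hs_open O'" "T s \<in> O'"
        "\<And>S c. S \<in> O' \<Longrightarrow> p \<le> c \<Longrightarrow> c \<le> q \<Longrightarrow> c *\<^sub>R S \<in> U"
        by (rule hs_open_scaleR_locally[OF U a TH[OF b]]) blast
      then show "s \<in> ?R" using s unfolding V_def by blast
    next
      fix s assume "s \<in> ?R"
      then obtain p q O' where "p \<le> w s" "w s \<le> q" "T s \<in> O'" "s \<in> space N"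
        "\<forall>S\<in>O'. \<forall>c. p \<le> c \<and> c \<le> q \<longrightarrow> c *\<^sub>R S \<in> U"
        unfolding V_def by blast
      then show "s \<in> ?L" by auto
    qed
    also have "\<dots> \<in> sets N"
      by (intro sets.countable_UN'' countable_rat sets.Int measurable_sets[OF T V]) auto
    finally show "(\<lambda>s. w s *\<^sub>R T s) -` U \<inter> space N \<in> sets N" .
  qed (auto simp: hs_open_def)
qed

section \<open>Elementary processes\<close>

lemma filtration_from_measurable:
  assumes "filtration_from M t0 F" "t0 \<le> s" "s \<le> t" "f \<in> F s \<rightarrow>\<^sub>M N"
  shows "f \<in> F t \<rightarrow>\<^sub>M N"
proof -
  have "subalgebra M (F s)" "subalgebra M (F t)" "sets (F s) \<subseteq> sets (F t)"
    using assms order_trans[OF assms(2,3)] unfolding filtration_from_def by blast+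
  then have "subalgebra (F t) (F s)" by (simp add: subalgebra_def)
  then show ?thesis by (rule measurable_from_subalg) fact
qed

lemma filtration_from_measurable_M:
  assumes "filtration_from M t0 F" "t0 \<le> s" "f \<in> F s \<rightarrow>\<^sub>M N"
  shows "f \<in> M \<rightarrow>\<^sub>M N"
  using assms(1,2) measurable_from_subalg[OF _ assms(3)] unfolding filtration_from_def by blast

lemma elementary_integral_simps [simp]:
  "elementary_integral W [] t \<omega> = 0"
  "elementary_integral W ((a, b, \<xi>, h, g) # S) t \<omega> =
     (\<xi> \<omega> * (W (min b t) h \<omega> - W (min a t) h \<omega>)) *\<^sub>R g + elementary_integral W S t \<omega>"
  by (simp_all add: elementary_integral_def)

lemma elementary_integral_append:
  "elementary_integral W (S @ T) t \<omega> = elementary_integral W S t \<omega> + elementary_integral W T t \<omega>"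
  by (simp add: elementary_integral_def)

lemma elementary_value_simps [simp]:
  "elementary_value [] t \<omega> = 0"
  "elementary_value ((a, b, \<xi>, h, g) # S) t \<omega> =
     (if a < t \<and> t \<le> b then \<xi> \<omega> *\<^sub>R rank_one h g else 0) + elementary_value S t \<omega>"
  by (simp_all add: elementary_value_def)

lemma elementary_value_append:
  "elementary_value (S @ T) t \<omega> = elementary_value S t \<omega> + elementary_value T t \<omega>"
  by (simp add: elementary_value_def)

lemma elementary_process_simps [simp]:
  "elementary_process M t0 F []"
  "elementary_process M t0 F ((a, b, \<xi>, h, g) # S) \<longleftrightarrow>
     (t0 \<le> a \<and> a \<le> b \<and> \<xi> \<in> borel_measurable (F a) \<and> bounded (\<xi> ` space M)) \<and>
     elementary_process M t0 F S"
  by (simp_all add: elementary_process_def)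

lemma elementary_process_append [simp]:
  "elementary_process M t0 F (S @ T) \<longleftrightarrow> elementary_process M t0 F S \<and> elementary_process M t0 F T"
  by (simp only: elementary_process_def set_append ball_Un)

text \<open>Continuity in time holds almost surely for each direction separately. An elementary
  process has finitely many directions, so a sequence of such processes admits one common null
  set.\<close>

definition directions :: "('w, 'h, 'k) elementary \<Rightarrow> 'h set" where
  "directions S = (\<lambda>(a, b, \<xi>, h, g). h) ` set S"

lemma directions_simps [simp]:
  "directions [] = {}" "directions ((a, b, \<xi>, h, g) # S) = insert h (directions S)"
  "directions (S @ T) = directions S \<union> directions T"
  by (simp_all add: directions_def image_Un)

lemma finite_directions: "finite (directions S)"
  by (simp add: directions_def)

lemma elementary_integral_measurable:
  fixes S :: "('w, 'h, 'k::{real_normed_vector, second_countable_topology}) elementary"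
  assumes F: "filtration_from M t0 F" and W: "\<And>t h. t \<ge> t0 \<Longrightarrow> W t h \<in> borel_measurable (F t)"
    and S: "elementary_process M t0 F S" and t: "t0 \<le> t"
  shows "elementary_integral W S t \<in> borel_measurable M"
  using S
proof (induction S)
  case Nil
  then show ?case by (simp add: elementary_integral_def)
next
  case (Cons x S)
  obtain a b \<xi> h g where x: "x = (a, b, \<xi>, h, g)" by (cases x)
  have ab: "t0 \<le> a" "a \<le> b" and \<xi>: "\<xi> \<in> borel_measurable (F a)" using Cons.prems x by auto
  have [measurable]: "\<xi> \<in> borel_measurable M"
    by (rule filtration_from_measurable_M[OF F ab(1) \<xi>])
  have [measurable]: "W (min b t) h \<in> borel_measurable M" "W (min a t) h \<in> borel_measurable M"
    using ab t by (auto intro!: filtration_from_measurable_M[OF F _ W])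
  have [measurable]: "elementary_integral W S t \<in> borel_measurable M" using Cons x by auto
  have "(\<lambda>\<omega>. elementary_integral W (x # S) t \<omega>) \<in> borel_measurable M"
    unfolding x elementary_integral_simps by measurable
  then show ?case .
qed

lemma elementary_integral_continuous:
  assumes S: "elementary_process M t0 F S"
    and W: "\<And>h. h \<in> directions S \<Longrightarrow> continuous_on {t0..} (\<lambda>t. W t h \<omega>)"
  shows "continuous_on {t0..} (\<lambda>t. elementary_integral W S t \<omega>)"
  using assms
proof (induction S)
  case (Cons x S)
  obtain a b \<xi> h g where x: "x = (a, b, \<xi>, h, g)" by (cases x)
  have W: "continuous_on {t0..} (\<lambda>t. W t h \<omega>)" by (rule Cons.prems(2)[of h]) (simp add: x)
  have ab: "t0 \<le> a" "a \<le> b" using Cons.prems x by auto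
  have *: "continuous_on {t0..} (\<lambda>t. W (min c t) h \<omega>)" if "t0 \<le> c" for c
    by (rule continuous_on_compose2[OF W]) (use that in \<open>auto intro!: continuous_intros\<close>)
  have "continuous_on {t0..} (\<lambda>t. elementary_integral W S t \<omega>)"
    by (rule Cons.IH) (use Cons.prems x in auto)
  then show ?case unfolding x elementary_integral_simps
    using ab by (intro continuous_intros *) auto
qed simp

text \<open>For fixed \<omega>, the elementary integral is a combination of stopped paths with
  coefficients constant in time, and pathwise integration respects both stopping and linear
  maps.\<close>

lemma path_integral_elementary_integral:
  assumes p: "C1_from t0 p p'" and S: "elementary_process M t0 F S"
    and W: "\<And>h. h \<in> directions S \<Longrightarrow>
      path_integral t0 p p' (\<lambda>t. W t h \<omega>) (\<lambda>t. V t h \<omega>)"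
  shows "path_integral t0 p p' (\<lambda>t. elementary_integral W S t \<omega>) (\<lambda>t. elementary_integral V S t \<omega>)"
  using S W
proof (induction S)
  case Nil
  then show ?case by (simp add: path_integral_zero)
next
  case (Cons x S)
  obtain a b \<xi> h g where x: "x = (a, b, \<xi>, h, g)" by (cases x)
  have W: "path_integral t0 p p' (\<lambda>t. W t h \<omega>) (\<lambda>t. V t h \<omega>)"
    by (rule Cons.prems(2)[of h]) (simp add: x)
  have ab: "t0 \<le> a" "a \<le> b" using Cons.prems x by auto
  have L: "bounded_linear (\<lambda>r::real. (\<xi> \<omega> * r) *\<^sub>R g)"
    by (intro bounded_linear_scaleR_const bounded_linear_mult_right)
  have IH: "path_integral t0 p p' (\<lambda>t. elementary_integral W S t \<omega>) (\<lambda>t. elementary_integral V S t \<omega>)"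
    by (rule Cons.IH) (use Cons.prems x in auto)
  show ?case unfolding x elementary_integral_simps
    by (rule path_integral_add[OF path_integral_linear[OF L] IH], rule path_integral_diff)
       (use ab in \<open>auto intro!: path_integral_stop[OF p W, simplified] simp: \<close>)
qed

section \<open>Freezing a smooth weight on a grid\<close>

text \<open>The weight is frozen at the left end of each cell, as in the Riemann sums of
  \<open>path_integral_riemann_sums\<close>.\<close>

definition refine1 ::
  "(real \<Rightarrow> real) \<Rightarrow> nat \<Rightarrow> real \<times> real \<times> ('w \<Rightarrow> real) \<times> 'h \<times> 'k \<Rightarrow> ('w, 'h, 'k) elementary" where
  "refine1 p k = (\<lambda>(a, b, \<xi>, h, g).
     map (\<lambda>j. (grid a b k j, grid a b k (Suc j), \<lambda>\<omega>. p (grid a b k j) * \<xi> \<omega>, h, g)) [0..<k])"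

definition refine :: "(real \<Rightarrow> real) \<Rightarrow> nat \<Rightarrow> ('w, 'h, 'k) elementary \<Rightarrow> ('w, 'h, 'k) elementary" where
  "refine p k S = concat (map (refine1 p k) S)"

lemma refine_simps [simp]:
  "refine p k [] = []" "refine p k (x # S) = refine1 p k x @ refine p k S"
  by (simp_all add: refine_def)

text \<open>Only an inclusion, because \<open>k = 0\<close> leaves no entries.\<close>

lemma directions_refine: "directions (refine p k S) \<subseteq> directions S"
  by (force simp: refine_def refine1_def directions_def)

lemma elementary_process_refine:
  assumes F: "filtration_from M t0 F" and S: "elementary_process M t0 F S"
  shows "elementary_process M t0 F (refine p k S)"
  using S
proof (induction S)
  case (Cons x S)
  obtain a b \<xi> h g where x: "x = (a, b, \<xi>, h, g)" by (cases x)
  have ab: "t0 \<le> a" "a \<le> b" and \<xi>: "\<xi> \<in> borel_measurable (F a)" and bd: "bounded (\<xi> ` space M)"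
    using Cons.prems x by auto
  have bd: "bounded ((\<lambda>\<omega>. c * \<xi> \<omega>) ` space M)" for c
    using bounded_scaling[OF bd, of c] by (simp add: image_image)
  have m: "(\<lambda>\<omega>. c * \<xi> \<omega>) \<in> borel_measurable (F (grid a b k j))" for c j
    by (intro borel_measurable_times borel_measurable_const
        filtration_from_measurable[OF F ab(1) grid_ge[OF ab(2)] \<xi>])
  have "elementary_process M t0 F (refine1 p k x)"
    unfolding x refine1_def elementary_process_def
    using ab grid_ge[OF ab(2)] grid_mono[OF ab(2)] bd m by (auto intro: order_trans)
  then show ?case using Cons x by simp
qed simp

lemma refine1_integral:
  "elementary_integral W (refine1 p k (a, b, \<xi>, h, g)) t \<omega> =
    (\<xi> \<omega> * (\<Sum>j<k. p (grid a b k j) *\<^sub>R (W (min (grid a b k (Suc j)) t) h \<omega> - W (min (grid a b k j) t) h \<omega>))) *\<^sub>R g"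
  by (simp add: elementary_integral_def refine1_def o_def interv_sum_list_conv_sum_set_nat
      scaleR_sum_left[symmetric] sum_distrib_left lessThan_atLeast0 mult_ac)

lemma refine_integral_uniform_limit:
  assumes p: "C1_from t0 p p'" and S: "elementary_process M t0 F S"
    and W: "\<And>h. h \<in> directions S \<Longrightarrow> continuous_on {t0..} (\<lambda>t. W t h \<omega>)"
    and V: "\<And>h. h \<in> directions S \<Longrightarrow>
      path_integral t0 p p' (\<lambda>t. W t h \<omega>) (\<lambda>t. V t h \<omega>)"
  shows "uniform_limit UNIV (\<lambda>k t. elementary_integral W (refine p k S) t \<omega>)
    (\<lambda>t. elementary_integral V S t \<omega>) sequentially"
  using S W V
proof (induction S)
  case (Cons x S)
  obtain a b \<xi> h g where x: "x = (a, b, \<xi>, h, g)" by (cases x)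
  have W: "continuous_on {t0..} (\<lambda>t. W t h \<omega>)" by (rule Cons.prems(2)[of h]) (simp add: x)
  have V: "path_integral t0 p p' (\<lambda>t. W t h \<omega>) (\<lambda>t. V t h \<omega>)"
    by (rule Cons.prems(3)[of h]) (simp add: x)
  have ab: "t0 \<le> a" "a \<le> b" using Cons.prems x by auto
  have L: "bounded_linear (\<lambda>r::real. (\<xi> \<omega> * r) *\<^sub>R g)"
    by (intro bounded_linear_scaleR_const bounded_linear_mult_right)
  have IH: "uniform_limit UNIV (\<lambda>k t. elementary_integral W (refine p k S) t \<omega>)
    (\<lambda>t. elementary_integral V S t \<omega>) sequentially"
    by (rule Cons.IH) (use Cons.prems x in auto)
  show ?case
    unfolding x refine_simps elementary_integral_append refine1_integral elementary_integral_simps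
    by (intro uniform_limit_add IH bounded_linear.uniform_limit[OF L] path_integral_riemann_sums[OF p V W ab])
qed (simp add: uniform_limit_iff)

text \<open>The cells (c j, c (Suc j)] tile (c 0, c k], so at most one summand is active. Under weak
  monotonicity some cells may be empty, and these contain no \<open>t\<close>.\<close>

lemma step_sum:
  fixes f :: "nat \<Rightarrow> 'b::comm_monoid_add" and c :: "nat \<Rightarrow> real"
  assumes c: "\<And>i j. i \<le> j \<Longrightarrow> c i \<le> c j"
  shows "if c 0 < t \<and> t \<le> c k
     then \<exists>j<k. c j < t \<and> t \<le> c (Suc j) \<and> (\<Sum>j<k. if c j < t \<and> t \<le> c (Suc j) then f j else 0) = f j
     else (\<Sum>j<k. if c j < t \<and> t \<le> c (Suc j) then f j else 0) = 0"
proof (induction k)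
  case (Suc k)
  have 0: "c 0 \<le> c k" "c k \<le> c (Suc k)" using c by auto
  show ?case
  proof (cases "c k < t \<and> t \<le> c (Suc k)")
    case True
    have "\<not> (c j < t \<and> t \<le> c (Suc j))" if "j < k" for j
      using c[of "Suc j" k] that True by auto
    then have "(\<Sum>j<k. if c j < t \<and> t \<le> c (Suc j) then f j else 0) = 0" by (intro sum.neutral) auto
    then show ?thesis using True 0 by (auto intro!: exI[of _ k])
  next
    case False
    show ?thesis
    proof (cases "c 0 < t \<and> t \<le> c k")
      case True
      then show ?thesis using Suc False 0 by (auto intro: less_SucI)
    next
      case F: False
      then have "\<not> (c 0 < t \<and> t \<le> c (Suc k))" using False 0 by auto
      then show ?thesis using Suc False F by auto
    qed
  qed
qed simp

lemma refine1_value: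
  "elementary_value (refine1 p k (a, b, \<xi>, h, g)) t \<omega> =
    (\<Sum>j<k. if grid a b k j < t \<and> t \<le> grid a b k (Suc j)
       then (p (grid a b k j) * \<xi> \<omega>) *\<^sub>R rank_one h g else 0)"
  by (simp add: elementary_value_def refine1_def o_def interv_sum_list_conv_sum_set_nat lessThan_atLeast0)

text \<open>Uniform continuity of \<open>p\<close> and boundedness of \<xi> make the bound
  independent of time and of \<omega>, so the mesh can later be chosen deterministically.\<close>

lemma refine1_value_error:
  fixes h :: "'h::{real_inner, second_countable_topology}" and g :: "'k::real_normed_vector"
  assumes p: "C1_from t0 p p'" and ab: "t0 \<le> a" "a \<le> b" and bd: "bounded (\<xi> ` \<Omega>)" and e: "e > 0"
  shows "\<forall>\<^sub>F k in sequentially. \<forall>t. \<forall>\<omega>\<in>\<Omega>.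
    hs_norm_sq (elementary_value (refine1 p k (a, b, \<xi>, h, g)) t \<omega>
      - p t *\<^sub>R elementary_value [(a, b, \<xi>, h, g)] t \<omega>) \<le> ennreal e"
proof -
  obtain B where B: "\<And>\<omega>. \<omega> \<in> \<Omega> \<Longrightarrow> \<bar>\<xi> \<omega>\<bar> \<le> B" "B > 0"
    using bd unfolding bounded_pos by auto
  \<comment> \<open>Bounds the squared Hilbert-Schmidt norm of \<xi> times the rank one operator;
    the added 1 permits division, and \<eta> is the solution of \<eta>^2 H = e.\<close>
  define H where "H = B\<^sup>2 * ((norm h)\<^sup>2 * (norm g)\<^sup>2) + 1"
  have H: "H > 0" unfolding H_def by (simp add: add_nonneg_pos)
  define \<eta> where "\<eta> = sqrt (e / H)"
  have \<eta>: "\<eta> > 0" using e H by (simp add: \<eta>_def)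
  have \<eta>2: "\<eta>\<^sup>2 * H = e" using e H by (simp add: \<eta>_def)
  have "uniformly_continuous_on {a..b} p"
    by (rule compact_uniformly_continuous)
       (use ab in \<open>auto intro: continuous_on_subset[OF C1_from_continuous[OF p]]\<close>)
  from uniformly_continuous_onE[OF this \<eta>] obtain d where d: "d > 0"
    "\<And>r r'. r \<in> {a..b} \<Longrightarrow> r' \<in> {a..b} \<Longrightarrow> dist r' r < d \<Longrightarrow> dist (p r') (p r) < \<eta>" by metis
  from grid_mesh[OF d(1), of a b]
  show ?thesis
  proof eventually_elim
    case (elim k)
    show ?case
    proof (intro allI ballI)
      fix t \<omega> assume \<omega>: "\<omega> \<in> \<Omega>"
      let ?c = "grid a b k"
      let ?f = "\<lambda>j. (p (?c j) * \<xi> \<omega>) *\<^sub>R rank_one h g"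
      let ?v = "elementary_value (refine1 p k (a, b, \<xi>, h, g)) t \<omega>"
      have st: "if a < t \<and> t \<le> b then \<exists>j<k. ?c j < t \<and> t \<le> ?c (Suc j) \<and> ?v = ?f j else ?v = 0"
        using step_sum[of ?c t k ?f] grid_mono[OF ab(2)] elim unfolding refine1_value by simp
      show "hs_norm_sq (?v - p t *\<^sub>R elementary_value [(a, b, \<xi>, h, g)] t \<omega>) \<le> ennreal e"
      proof (cases "a < t \<and> t \<le> b")
        case True
        with st obtain j where j: "j < k" "?c j < t" "t \<le> ?c (Suc j)" "?v = ?f j" by auto
        have "dist (p (?c j)) (p t) < \<eta>"
          using True j elim[THEN conjunct2, rule_format, of j] ab
          by (intro d(2)) (auto simp: dist_real_def grid_ge intro: grid_le)
        then have pe: "(p (?c j) - p t)\<^sup>2 \<le> \<eta>\<^sup>2"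
          using power_mono[of "\<bar>p (?c j) - p t\<bar>" \<eta> 2] by (simp add: dist_real_def)
        have xe: "(\<xi> \<omega>)\<^sup>2 \<le> B\<^sup>2" using power_mono[OF B(1)[OF \<omega>], of 2] by simp
        have "?v - p t *\<^sub>R elementary_value [(a, b, \<xi>, h, g)] t \<omega>
            = ((p (?c j) - p t) * \<xi> \<omega>) *\<^sub>R rank_one h g"
          using True j by (simp add: algebra_simps)
        then have "hs_norm_sq (?v - p t *\<^sub>R elementary_value [(a, b, \<xi>, h, g)] t \<omega>)
           = ennreal (((p (?c j) - p t) * \<xi> \<omega>)\<^sup>2) * hs_norm_sq (rank_one h g)"
          by (simp only: hs_norm_sq_scaleR)
        also have "\<dots> \<le> ennreal (\<eta>\<^sup>2 * B\<^sup>2) * ennreal ((norm h)\<^sup>2 * (norm g)\<^sup>2)"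
          by (intro mult_mono hs_norm_sq_rank_one_le ennreal_leI)
             (use pe xe in \<open>auto simp: power_mult_distrib intro!: mult_mono\<close>)
        also have "\<dots> = ennreal (\<eta>\<^sup>2 * (B\<^sup>2 * ((norm h)\<^sup>2 * (norm g)\<^sup>2)))"
          by (simp add: ennreal_mult[symmetric] mult.assoc)
        also have "\<dots> \<le> ennreal (\<eta>\<^sup>2 * H)" by (intro ennreal_leI mult_left_mono) (auto simp: H_def)
        finally show ?thesis unfolding \<eta>2 .
      next
        case False
        then show ?thesis using st by (auto simp: hs_norm_sq_def)
      qed
    qed
  qed
qed

lemma refine_value_error:
  fixes S :: "('w, 'h::{real_inner, second_countable_topology}, 'k::real_normed_vector) elementary"
  assumes p: "C1_from t0 p p'" and S: "elementary_process M t0 F S" and e: "e > 0"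
  shows "\<forall>\<^sub>F k in sequentially. \<forall>t. \<forall>\<omega>\<in>space M.
    hs_norm_sq (elementary_value (refine p k S) t \<omega> - p t *\<^sub>R elementary_value S t \<omega>) \<le> ennreal e"
  using S e
proof (induction S arbitrary: e)
  case Nil
  then show ?case by (simp add: hs_norm_sq_def)
next
  case (Cons x S)
  obtain a b \<xi> h g where x: "x = (a, b, \<xi>, h, g)" by (cases x)
  have ab: "t0 \<le> a" "a \<le> b" and bd: "bounded (\<xi> ` space M)" using Cons.prems x by auto
  have S: "elementary_process M t0 F S" using Cons.prems x by auto
  \<comment> \<open>Adding two operators doubles both squared errors: 2 (e / 4) + 2 (e / 4) =
    e.\<close>
  have e4: "e / 4 > 0" using Cons.prems by simp
  show ?case
    using refine1_value_error[OF p ab bd e4, where h = h and g = g] Cons.IH[OF S e4]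
  proof eventually_elim
    case (elim k)
    show ?case
    proof (intro allI ballI)
      fix t \<omega> assume \<omega>: "\<omega> \<in> space M"
      let ?A = "elementary_value (refine1 p k (a, b, \<xi>, h, g)) t \<omega>
         - p t *\<^sub>R elementary_value [(a, b, \<xi>, h, g)] t \<omega>"
      let ?B = "elementary_value (refine p k S) t \<omega> - p t *\<^sub>R elementary_value S t \<omega>"
      have "elementary_value (refine p k (x # S)) t \<omega> - p t *\<^sub>R elementary_value (x # S) t \<omega> = ?A + ?B"
        by (simp add: x elementary_value_append algebra_simps)
      then have "hs_norm_sq (elementary_value (refine p k (x # S)) t \<omega> - p t *\<^sub>R elementary_value (x # S) t \<omega>)
          \<le> 2 * hs_norm_sq ?A + 2 * hs_norm_sq ?B"
        using hs_norm_sq_add_le2[of ?A ?B] by simp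
      also have "\<dots> \<le> 2 * ennreal (e / 4) + 2 * ennreal (e / 4)"
        using elim \<omega> by (intro add_mono mult_left_mono) auto
      also have "\<dots> = ennreal e"
        using Cons.prems by (simp add: ennreal_plus[symmetric] ennreal_numeral[symmetric] ennreal_mult[symmetric]
            del: ennreal_plus ennreal_numeral)
      finally show "hs_norm_sq (elementary_value (refine p k (x # S)) t \<omega> - p t *\<^sub>R elementary_value (x # S) t \<omega>)
          \<le> ennreal e" .
    qed
  qed
qed

section \<open>Elementary processes on the new clock\<close>

text \<open>The coefficient \<xi> stays the same since the new filtration at \<theta> a is the old
  one at \<open>a\<close>. The operator \<open>L\<close> serves to select a component of the
  target.\<close>

definition retime ::
  "(real \<Rightarrow> real) \<Rightarrow> ('k::real_normed_vector \<Rightarrow>\<^sub>L 'l::real_normed_vector) \<Rightarrow>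
     ('w, 'h, 'k) elementary \<Rightarrow> ('w, 'h, 'l) elementary" where
  "retime \<theta> L S = map (\<lambda>(a, b, \<xi>, h, g). (\<theta> a, \<theta> b, \<xi>, h, blinfun_apply L g)) S"

lemma retime_simps [simp]:
  "retime \<theta> L [] = []"
  "retime \<theta> L ((a, b, \<xi>, h, g) # S) = (\<theta> a, \<theta> b, \<xi>, h, blinfun_apply L g) # retime \<theta> L S"
  by (simp_all add: retime_def)

lemma directions_retime [simp]: "directions (retime \<theta> L S) = directions S"
  by (force simp: retime_def directions_def)

lemma elementary_process_retime:
  assumes S: "elementary_process M t0 F S"
    and mono: "\<And>u v. t0 \<le> u \<Longrightarrow> u \<le> v \<Longrightarrow> \<theta> u \<le> \<theta> v" and F': "\<And>u. t0 \<le> u \<Longrightarrow> F' (\<theta> u) = F u"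
  shows "elementary_process M (\<theta> t0) F' (retime \<theta> L S)"
  using S
proof (induction S)
  case (Cons x S)
  obtain a b \<xi> h g where x: "x = (a, b, \<xi>, h, g)" by (cases x)
  then show ?case using Cons mono F' by simp
qed simp

lemma elementary_integral_retime:
  assumes S: "elementary_process M t0 F S" and t: "t0 \<le> t"
    and mono: "\<And>u v. t0 \<le> u \<Longrightarrow> u \<le> v \<Longrightarrow> \<theta> u \<le> \<theta> v"
    and W: "\<And>h u. h \<in> directions S \<Longrightarrow> t0 \<le> u \<Longrightarrow> W' (\<theta> u) h \<omega> = W u h \<omega>"
  shows "elementary_integral W' (retime \<theta> L S) (\<theta> t) \<omega> = blinfun_apply L (elementary_integral W S t \<omega>)"
  using S W
proof (induction S)
  case (Cons x S)
  obtain a b \<xi> h g where x: "x = (a, b, \<xi>, h, g)" by (cases x)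
  have ab: "t0 \<le> a" "a \<le> b" using Cons.prems x by auto
  have min: "min (\<theta> c) (\<theta> t) = \<theta> (min c t)" if "t0 \<le> c" for c
    using mono[of c t] mono[of t c] that t by (cases "c \<le> t") (auto simp: min_def)
  have W: "W' (\<theta> u) h \<omega> = W u h \<omega>" if "t0 \<le> u" for u
    by (rule Cons.prems(2)[of h, OF _ that]) (simp add: x)
  have "elementary_integral W' (retime \<theta> L S) (\<theta> t) \<omega> = blinfun_apply L (elementary_integral W S t \<omega>)"
    by (rule Cons.IH) (use Cons.prems x in auto)
  then show ?case
    using ab t by (simp add: x min W blinfun.add_right blinfun.scaleR_right)
qed simp

lemma elementary_value_retime:
  assumes S: "elementary_process M t0 F S" and t: "t0 \<le> t"
    and mono: "\<And>u v. t0 \<le> u \<Longrightarrow> t0 \<le> v \<Longrightarrow> \<theta> u < \<theta> v \<longleftrightarrow> u < v"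
  shows "elementary_value (retime \<theta> L S) (\<theta> t) \<omega> = L o\<^sub>L elementary_value S t \<omega>"
  using S
proof (induction S)
  case Nil then show ?case by (auto intro!: blinfun_eqI)
next
  case (Cons x S)
  obtain a b \<xi> h g where x: "x = (a, b, \<xi>, h, g)" by (cases x)
  have ab: "t0 \<le> a" "t0 \<le> b" using Cons.prems x by auto
  have le: "\<theta> t \<le> \<theta> b \<longleftrightarrow> t \<le> b" using mono[of b t] ab t by auto
  have r: "rank_one h (blinfun_apply L g) = L o\<^sub>L rank_one h g"
    by (rule blinfun_eqI) (simp add: rank_one.rep_eq blinfun.scaleR_right)
  show ?case
    using Cons ab t mono[of a t] le r
    by (auto simp: x intro!: blinfun_eqI simp: blinfun.add_left blinfun.add_right blinfun.scaleR_left blinfun.scaleR_right)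
qed

section \<open>Lower integrals and almost sure limits\<close>

text \<open>The integral of a possibly non-measurable function is a supremum over simple functions
  below it. For such an \<open>s\<close> below f + g the difference s - f is measurable and lies
  below \<open>g\<close>; finiteness of \<open>f\<close> makes the subtraction legitimate.\<close>

lemma nn_integral_add_le:
  assumes f: "f \<in> borel_measurable M" "\<And>x. f x < \<infinity>"
  shows "(\<integral>\<^sup>+x. f x + g x \<partial>M) \<le> integral\<^sup>N M f + integral\<^sup>N M g"
  unfolding nn_integral_def[of M "\<lambda>x. f x + g x"]
proof (safe intro!: SUP_least)
  fix s assume s: "simple_function M s" "s \<le> (\<lambda>x. f x + g x)"
  have sm[measurable]: "s \<in> borel_measurable M" using s(1) by (rule borel_measurable_simple_function)
  note f(1)[measurable]
  have "integral\<^sup>S M s = integral\<^sup>N M s" by (rule nn_integral_eq_simple_integral[OF s(1), symmetric])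
  also have "\<dots> \<le> (\<integral>\<^sup>+x. f x + (s x - f x) \<partial>M)"
    by (intro nn_integral_mono) (metis ennreal_minus_le_iff order_refl)
  also have "\<dots> = integral\<^sup>N M f + (\<integral>\<^sup>+x. s x - f x \<partial>M)" by (rule nn_integral_add) auto
  also have "(\<integral>\<^sup>+x. s x - f x \<partial>M) \<le> integral\<^sup>N M g"
  proof (intro nn_integral_mono)
    fix x show "s x - f x \<le> g x"
      using s(2)[THEN le_funD, of x] f(2)[of x] by (auto simp: ennreal_minus_le_iff)
  qed
  finally show "integral\<^sup>S M s \<le> integral\<^sup>N M f + integral\<^sup>N M g" by (metis (no_types, lifting) add_left_mono order_trans)
qed

text \<open>No measurability of \<open>G\<close> is assumed: both sides are lower integrals.\<close>

lemma nn_integral_time_change_le: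
  fixes G :: "real \<Rightarrow> ennreal"
  assumes \<theta>: "\<And>u. u \<in> {a..b} \<Longrightarrow> (\<theta> has_real_derivative \<theta>' u) (at u)"
    and cont: "continuous_on {a..b} \<theta>'"
    and K: "\<And>u. u \<in> {a..b} \<Longrightarrow> 0 \<le> \<theta>' u" "\<And>u. u \<in> {a..b} \<Longrightarrow> \<theta>' u \<le> K"
    and inv: "\<And>u. u \<in> {a..b} \<Longrightarrow> \<phi> (\<theta> u) = u" and ab: "a \<le> b"
  shows "(\<integral>\<^sup>+s\<in>{\<theta> a..\<theta> b}. G (\<phi> s) \<partial>lborel) \<le> ennreal K * (\<integral>\<^sup>+u\<in>{a..b}. G u \<partial>lborel)"
proof (cases "a = b")
  case True
  have "(\<integral>\<^sup>+s\<in>{\<theta> a..\<theta> b}. G (\<phi> s) \<partial>lborel) = (\<integral>\<^sup>+s. 0 \<partial>(lborel :: real measure))"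
  proof (rule nn_integral_cong_AE)
    show "AE s in lborel. G (\<phi> s) * indicator {\<theta> a..\<theta> b} s = 0"
      using AE_lborel_singleton[of "\<theta> a"] by eventually_elim (auto simp: True indicator_def)
  qed
  then show ?thesis by simp
next
  case False
  then have ab': "a < b" using ab by simp
  have mono: "\<theta> u \<le> \<theta> v" if "a \<le> u" "u \<le> v" "v \<le> b" for u v
  proof (rule DERIV_nonneg_imp_nondecreasing[OF that(2)])
    fix x assume "u \<le> x" "x \<le> v"
    then show "\<exists>y. (\<theta> has_real_derivative y) (at x) \<and> 0 \<le> y"
      using \<theta>[of x] K(1)[of x] that by (intro exI[of _ "\<theta>' x"]) auto
  qed
  have "(\<integral>\<^sup>+s. G (\<phi> s) * indicator {\<theta> a..\<theta> b} s \<partial>lborel) \<le> ennreal K * (\<integral>\<^sup>+u\<in>{a..b}. G u \<partial>lborel)"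
    unfolding nn_integral_def[of lborel "\<lambda>s. G (\<phi> s) * indicator {\<theta> a..\<theta> b} s"]
  proof (safe intro!: SUP_least)
    fix s assume s: "simple_function lborel s" "s \<le> (\<lambda>s. G (\<phi> s) * indicator {\<theta> a..\<theta> b} s)"
    have sm: "s \<in> borel_measurable borel" using borel_measurable_simple_function[OF s(1)] by simp
    have "integral\<^sup>S lborel s = integral\<^sup>N lborel s" by (rule nn_integral_eq_simple_integral[OF s(1), symmetric])
    also have "\<dots> \<le> (\<integral>\<^sup>+x. s x * indicator {\<theta> a..\<theta> b} x \<partial>lborel)"
    proof (intro nn_integral_mono)
      fix x show "s x \<le> s x * indicator {\<theta> a..\<theta> b} x"
        using s(2)[THEN le_funD, of x] by (auto simp: indicator_def split: if_splits)
    qed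
    also have "\<dots> = (\<integral>\<^sup>+u. s (\<theta> u) * ennreal (\<theta>' u) * indicator {a..b} u \<partial>lborel)"
      by (rule nn_integral_substitution_aux[OF sm]) (use \<theta> cont K ab' in auto)
    also have "\<dots> \<le> (\<integral>\<^sup>+u. ennreal K * (s (\<theta> u) * indicator {a..b} u) \<partial>lborel)"
      by (intro nn_integral_mono)
         (use K in \<open>auto simp: indicator_def mult.commute intro!: mult_right_mono ennreal_leI\<close>)
    also have "\<dots> \<le> ennreal K * (\<integral>\<^sup>+u. G u * indicator {a..b} u \<partial>lborel)"
    proof -
      have c: "continuous_on {a..b} \<theta>"
        using \<theta> by (intro continuous_at_imp_continuous_on ballI DERIV_isCont)
      have m: "(\<lambda>u. s (\<theta> u) * indicator {a..b} u) \<in> borel_measurable borel"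
      proof -
        \<comment> \<open>Continuity of \<theta> is known only on the interval. Outside it the
          indicator vanishes, so the value 0 there is harmless and makes the composition
          measurable.\<close>
        define \<theta>0 where "\<theta>0 u = (if u \<in> {a..b} then \<theta> u else 0)" for u
        have [measurable]: "\<theta>0 \<in> borel_measurable borel"
          unfolding \<theta>0_def by (rule borel_measurable_continuous_on_if) (use c in auto)
        have [measurable]: "s \<in> borel_measurable borel" by (rule sm)
        have "(\<lambda>u. s (\<theta>0 u) * indicator {a..b} u) \<in> borel_measurable borel" by measurable
        also have "(\<lambda>u. s (\<theta>0 u) * indicator {a..b} u) = (\<lambda>u. s (\<theta> u) * indicator {a..b} u)"
          by (auto simp: \<theta>0_def indicator_def)
        finally show ?thesis .
      qed
      have "(\<integral>\<^sup>+u. ennreal K * (s (\<theta> u) * indicator {a..b} u) \<partial>lborel)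
          = ennreal K * (\<integral>\<^sup>+u. s (\<theta> u) * indicator {a..b} u \<partial>lborel)"
        using m by (intro nn_integral_cmult) simp
      also have "\<dots> \<le> ennreal K * (\<integral>\<^sup>+u. G u * indicator {a..b} u \<partial>lborel)"
      proof (intro mult_left_mono nn_integral_mono)
        fix u show "s (\<theta> u) * indicator {a..b} u \<le> G u * indicator {a..b} u"
          using s(2)[THEN le_funD, of "\<theta> u"] inv[of u] mono[of a u] mono[of u b]
          by (auto simp: indicator_def)
      qed simp
      finally show ?thesis .
    qed
    finally show "integral\<^sup>S lborel s \<le> ennreal K * (\<integral>\<^sup>+u\<in>{a..b}. G u \<partial>lborel)" .
  qed
  then show ?thesis .
qed

text \<open>The library identifies the two integrals only for Euclidean-space-valued functions; testing
  with inner products reduces the Hilbert space case to real functions.\<close>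

lemma LINT_eq_integral:
  fixes f :: "real \<Rightarrow> 'b::{real_inner, banach, second_countable_topology}"
  assumes f: "continuous_on {a..b} f"
  shows "(LINT s:{a..b}|lborel. f s) = integral {a..b} f"
proof -
  have "(LINT s:{a..b}|lborel. f s) \<bullet> h = integral {a..b} f \<bullet> h" for h
  proof -
    have "(LINT s:{a..b}|lborel. f s) \<bullet> h = (LINT s:{a..b}|lborel. f s \<bullet> h)"
      using borel_integrable_atLeastAtMost'[OF f]
      unfolding set_lebesgue_integral_def set_integrable_def
      by (subst integral_inner_left[symmetric]) auto
    also have "\<dots> = integral {a..b} (\<lambda>s. f s \<bullet> h)"
      by (intro set_borel_integral_eq_integral borel_integrable_atLeastAtMost' continuous_intros f)
    also have "\<dots> = integral {a..b} f \<bullet> h"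
      using integral_linear[OF integrable_continuous_interval[OF f] bounded_linear_inner_left[of h]]
      by (simp add: o_def)
    finally show ?thesis .
  qed
  then show ?thesis by (metis inner_commute vector_eq_rdot)
qed

lemma LINT_has_vector_derivative:
  fixes f :: "real \<Rightarrow> 'b::{real_inner, banach, second_countable_topology}"
  assumes f: "continuous_on {a..} f" and u: "a \<le> u"
  shows "((\<lambda>u. LINT s:{a..u}|lborel. f s) has_vector_derivative f u) (at u within {a..})"
proof -
  have "(LINT s:{a..u}|lborel. f s) = integral {a..u} f" for u
    by (rule LINT_eq_integral) (auto intro: continuous_on_subset[OF f])
  then show ?thesis using integral_has_vector_derivative_atLeast[OF f u] by simp
qed

lemma LINT_eq_of_has_vector_derivative:
  fixes f :: "real \<Rightarrow> 'b::{real_inner, banach, second_countable_topology}"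
  assumes f: "continuous_on {a..} f" and u: "a \<le> u"
    and D: "\<And>u. a \<le> u \<Longrightarrow> (D has_vector_derivative f u) (at u within {a..})"
  shows "(LINT s:{a..u}|lborel. f s) = D u - D a"
proof -
  let ?J = "\<lambda>u. LINT s:{a..u}|lborel. f s"
  have "((\<lambda>u. D u - ?J u) has_vector_derivative 0) (at u within {a..})" if "u \<in> {a..}" for u
    using has_vector_derivative_diff[OF D LINT_has_vector_derivative[OF f]] that by fastforce
  from has_vector_derivative_zero_constant[OF _ this]
  obtain c where "\<And>u. u \<in> {a..} \<Longrightarrow> D u - ?J u = c" by auto
  from this[of a] this[of u] u LINT_eq_integral[of a a f] f show ?thesis
    by (auto simp: algebra_simps dest: continuous_on_subset[where t="{a}"])
qed

section \<open>Almost sure statements at all times simultaneously\<close>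

lemma countable_dense_atLeast:
  obtains Q :: "real set" where "countable Q" "Q \<subseteq> {a..}" "closure Q = {a..}"
proof
  let ?Q = "{a<..} \<inter> \<rat> :: real set"
  show "countable ?Q" using countable_rat by blast
  show "?Q \<subseteq> {a..}" by auto
  have "{a<..} \<subseteq> closure ?Q"
    using open_Int_closure_subset[of "{a<..}" \<rat>] Rats_closure_real by simp
  from closure_mono[OF this] have "{a..} \<subseteq> closure ?Q" by simp
  moreover have "closure ?Q \<subseteq> {a..}" by (rule closure_minimal) auto
  ultimately show "closure ?Q = {a..}" by auto
qed

text \<open>A strong solution satisfies its equation off a null set that may depend on the time,
  whereas pathwise calculus needs all times for one \<omega>. A countable dense set of times and
  continuity close the gap.\<close>

lemma AE_eq_all_of_continuous:
  fixes x y :: "real \<Rightarrow> 'w \<Rightarrow> 'b::real_normed_vector"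
  assumes eq: "\<And>t. a \<le> t \<Longrightarrow> AE \<omega> in M. x t \<omega> = y t \<omega>"
    and x: "AE \<omega> in M. continuous_on {a..} (\<lambda>t. x t \<omega>)"
    and y: "AE \<omega> in M. continuous_on {a..} (\<lambda>t. y t \<omega>)"
  shows "AE \<omega> in M. \<forall>t\<ge>a. x t \<omega> = y t \<omega>"
proof -
  obtain Q where Q: "countable Q" "Q \<subseteq> {a..}" "closure Q = {a..}" using countable_dense_atLeast .
  have "AE \<omega> in M. \<forall>t\<in>Q. x t \<omega> = y t \<omega>"
    using Q eq by (subst AE_ball_countable) auto
  with x y show ?thesis
  proof eventually_elim
    case (elim \<omega>)
    show ?case
    proof (intro allI impI)
      fix t assume "a \<le> t"
      have "norm (x t \<omega> - y t \<omega>) \<le> 0"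
        by (rule continuous_le_on_closure[where S=Q])
           (use elim Q \<open>a \<le> t\<close> in \<open>auto intro!: continuous_intros\<close>)
      then show "x t \<omega> = y t \<omega>" by simp
    qed
  qed
qed

text \<open>Each \<open>\<nu> n\<close> makes the expectation of the truncated error smaller than \<open>2\<^sup>-\<^sup>n\<close>, so
  that the errors are almost surely summable.\<close>

lemma diagonal_uniform_limit:
  fixes A :: "nat \<Rightarrow> nat \<Rightarrow> real \<Rightarrow> 'w \<Rightarrow> 'b::{banach, second_countable_topology}"
  assumes M: "prob_space M"
    and meas: "\<And>n k s. a \<le> s \<Longrightarrow> A n k s \<in> borel_measurable M"
    and cont: "AE \<omega> in M. \<forall>n k. continuous_on {a..} (\<lambda>s. A n k s \<omega>)"
    and limA: "AE \<omega> in M. \<forall>n. uniform_limit {a..} (\<lambda>k s. A n k s \<omega>) (\<lambda>s. B n s \<omega>) sequentially"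
    and limB: "AE \<omega> in M. \<forall>T\<ge>a. uniform_limit {a..T} (\<lambda>n s. B n s \<omega>) (\<lambda>s. I s \<omega>) sequentially"
  shows "\<exists>\<nu>. (\<forall>n. K n \<le> \<nu> n) \<and>
    (AE \<omega> in M. \<forall>T\<ge>a. uniform_limit {a..T} (\<lambda>n s. A n (\<nu> n) s \<omega>) (\<lambda>s. I s \<omega>) sequentially)"
proof -
  interpret prob_space M by fact
  obtain Q where Q: "countable Q" "Q \<subseteq> {a..}" "closure Q = {a..}" using countable_dense_atLeast .
  \<comment> \<open>Three devices make the expectation usable: the supremum over the countable
    \<open>Q\<close> is measurable, \<open>lim\<close> stands in for \<open>B\<close>, whose
    measurability is not given, and the cap 1 supplies the dominating function.\<close>
  define err where "err n k \<omega> =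
    min 1 (SUP s\<in>Q. ennreal (norm (A n k s \<omega> - lim (\<lambda>k. A n k s \<omega>))))" for n k \<omega>
  have [measurable]: "err n k \<in> borel_measurable M" for n k
  proof -
    have "(\<lambda>\<omega>. SUP s\<in>Q. ennreal (norm (A n k s \<omega> - lim (\<lambda>k. A n k s \<omega>)))) \<in> borel_measurable M"
    proof (rule borel_measurable_SUP[OF Q(1)])
      fix s assume "s \<in> Q"
      then have "\<And>k. A n k s \<in> borel_measurable M" using meas Q(2) by auto
      note this[measurable]
      show "(\<lambda>\<omega>. ennreal (norm (A n k s \<omega> - lim (\<lambda>k. A n k s \<omega>)))) \<in> borel_measurable M" by measurable
    qed
    then show ?thesis unfolding err_def by measurable
  qed
  have le1: "err n k \<omega> \<le> 1" for n k \<omega> by (simp add: err_def)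
  have lim: "lim (\<lambda>k. A n k s \<omega>) = B n s \<omega>"
    if "uniform_limit {a..} (\<lambda>k s. A n k s \<omega>) (\<lambda>s. B n s \<omega>) sequentially" "s \<in> {a..}" for n s \<omega>
    using tendsto_uniform_limitI[OF that] by (rule limI)
  have err0: "AE \<omega> in M. (\<lambda>k. err n k \<omega>) \<longlonglongrightarrow> 0" for n
    using limA
  proof eventually_elim
    case (elim \<omega>)
    then have ul: "uniform_limit {a..} (\<lambda>k s. A n k s \<omega>) (\<lambda>s. B n s \<omega>) sequentially" by simp
    show ?case
    proof (rule tendsto_zero_ennreal)
      fix e :: real assume e: "0 < e"
      define r where "r = e / 2"
      have r: "0 < r" "ennreal r < ennreal e" using e by (auto simp: r_def ennreal_less_iff)
      from uniform_limitD[OF ul r(1)]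
      show "\<forall>\<^sub>F k in sequentially. err n k \<omega> < ennreal e"
      proof eventually_elim
        case (elim k)
        have "(SUP s\<in>Q. ennreal (norm (A n k s \<omega> - lim (\<lambda>k. A n k s \<omega>)))) \<le> ennreal r"
          by (rule SUP_least)
             (use elim Q(2) lim[OF ul] in \<open>auto simp: dist_norm ennreal_less_iff intro!: less_imp_le\<close>)
        then show ?case using r(2) by (auto simp: err_def min_less_iff_disj)
      qed
    qed
  qed
  have E0: "(\<lambda>k. \<integral>\<^sup>+\<omega>. err n k \<omega> \<partial>M) \<longlonglongrightarrow> 0" for n
  proof -
    have "(\<lambda>k. \<integral>\<^sup>+\<omega>. err n k \<omega> \<partial>M) \<longlonglongrightarrow> (\<integral>\<^sup>+\<omega>. 0 \<partial>M)"
      by (rule nn_integral_dominated_convergence[where w="\<lambda>_. 1"])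
         (use err0 le1 in \<open>auto simp: emeasure_space_1\<close>)
    then show ?thesis by simp
  qed
  have "\<exists>k\<ge>K n. (\<integral>\<^sup>+\<omega>. err n k \<omega> \<partial>M) < ennreal ((1/2)^n)" for n
  proof -
    have "\<forall>\<^sub>F k in sequentially. (\<integral>\<^sup>+\<omega>. err n k \<omega> \<partial>M) < ennreal ((1/2)^n)"
      by (rule order_tendstoD(2)[OF E0]) simp
    then have "\<forall>\<^sub>F k in sequentially. K n \<le> k \<and> (\<integral>\<^sup>+\<omega>. err n k \<omega> \<partial>M) < ennreal ((1/2)^n)"
      using eventually_ge_at_top by (rule eventually_conj[rotated])
    then show ?thesis unfolding eventually_sequentially by blast
  qed
  then obtain \<nu> where \<nu>: "\<And>n. K n \<le> \<nu> n" "\<And>n. (\<integral>\<^sup>+\<omega>. err n (\<nu> n) \<omega> \<partial>M) < ennreal ((1/2)^n)"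
    by metis
  have "(\<integral>\<^sup>+\<omega>. (\<Sum>n. err n (\<nu> n) \<omega>) \<partial>M) = (\<Sum>n. \<integral>\<^sup>+\<omega>. err n (\<nu> n) \<omega> \<partial>M)"
    by (rule nn_integral_suminf) simp
  also have "\<dots> \<le> (\<Sum>n. ennreal ((1/2)^n))"
    by (intro suminf_le) (use \<nu>(2) in \<open>auto intro: less_imp_le\<close>)
  also have "\<dots> = ennreal (\<Sum>n. (1/2)^n)"
    by (rule suminf_ennreal2) (auto intro: summable_geometric)
  finally have "(\<integral>\<^sup>+\<omega>. (\<Sum>n. err n (\<nu> n) \<omega>) \<partial>M) \<noteq> \<infinity>" by (auto simp: top_unique)
  then have "AE \<omega> in M. (\<Sum>n. err n (\<nu> n) \<omega>) \<noteq> \<infinity>"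
    by (intro nn_integral_PInf_AE) simp_all
  then have conv: "AE \<omega> in M. (\<lambda>n. err n (\<nu> n) \<omega>) \<longlonglongrightarrow> 0"
  proof eventually_elim
    case (elim \<omega>)
    define r where "r n = enn2real (err n (\<nu> n) \<omega>)" for n
    have e: "err n (\<nu> n) \<omega> = ennreal (r n)" for n
      unfolding r_def using le1[of n "\<nu> n" \<omega>] by (intro ennreal_enn2real[symmetric]) (auto intro: le_less_trans)
    have "summable r"
      by (rule summable_suminf_not_top) (use elim in \<open>auto simp: e[symmetric], simp add: r_def\<close>)
    then have "(\<lambda>n. ennreal (r n)) \<longlonglongrightarrow> ennreal 0"
      by (intro tendsto_ennrealI summable_LIMSEQ_zero)
    then show ?case by (simp add: e)
  qed
  have "AE \<omega> in M. \<forall>T\<ge>a. uniform_limit {a..T} (\<lambda>n s. A n (\<nu> n) s \<omega>) (\<lambda>s. I s \<omega>) sequentially"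
    using conv cont limA limB
  proof eventually_elim
    case (elim \<omega>)
    have ul: "uniform_limit {a..} (\<lambda>k s. A n k s \<omega>) (\<lambda>s. B n s \<omega>) sequentially" for n using elim by simp
    have cB: "continuous_on {a..} (\<lambda>s. B n s \<omega>)" for n
      by (rule uniform_limit_theorem[OF _ ul]) (use elim in auto)
    have "uniform_limit {a..} (\<lambda>n s. A n (\<nu> n) s \<omega> - B n s \<omega>) (\<lambda>_. 0) sequentially"
    proof (rule uniform_limitI)
      fix e :: real assume e: "e > 0"
      have "\<forall>\<^sub>F n in sequentially. err n (\<nu> n) \<omega> < ennreal (min 1 (e/2))"
        using e by (intro order_tendstoD(2)[OF elim(1)]) auto
      then show "\<forall>\<^sub>F n in sequentially. \<forall>s\<in>{a..}. dist (A n (\<nu> n) s \<omega> - B n s \<omega>) 0 < e"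
      proof eventually_elim
        case (elim n)
        \<comment> \<open>The threshold is at most 1, so it is the supremum and not the cap that
          lies below it.\<close>
        have "(SUP s\<in>Q. ennreal (norm (A n (\<nu> n) s \<omega> - lim (\<lambda>k. A n k s \<omega>)))) < ennreal (min 1 (e/2))"
        proof -
          have "ennreal (min 1 (e/2)) \<le> ennreal 1" by (intro ennreal_leI) simp
          then have "\<not> 1 < ennreal (min 1 (e/2))" by (simp add: not_less)
          then show ?thesis using elim unfolding err_def min_less_iff_disj by blast
        qed
        then have q: "norm (A n (\<nu> n) s \<omega> - B n s \<omega>) \<le> e / 2" if "s \<in> Q" for s
        proof -
          have "ennreal (norm (A n (\<nu> n) s \<omega> - lim (\<lambda>k. A n k s \<omega>))) < ennreal (min 1 (e/2))"
            by (rule SUP_lessD[OF \<open>(SUP s\<in>Q. _ s) < _\<close> that])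
          then show ?thesis using lim[OF ul, of s n] Q(2) that by (auto simp: ennreal_less_iff)
        qed
        show ?case
        proof
          fix s assume s: "s \<in> {a..}"
          have "norm (A n (\<nu> n) s \<omega> - B n s \<omega>) \<le> e / 2"
            by (rule continuous_le_on_closure[where S=Q])
               (use \<open>\<forall>n k. continuous_on {a..} (\<lambda>s. A n k s \<omega>)\<close> cB q Q s in \<open>auto intro!: continuous_intros\<close>)
          then show "dist (A n (\<nu> n) s \<omega> - B n s \<omega>) 0 < e" using e by simp
        qed
      qed
    qed
    then have u: "uniform_limit {a..T} (\<lambda>n s. A n (\<nu> n) s \<omega> - B n s \<omega>) (\<lambda>_. 0) sequentially" for T
      by (rule uniform_limit_on_subset) auto
    show ?case
    proof (intro allI impI)
      fix T assume "a \<le> T"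
      with elim have "uniform_limit {a..T} (\<lambda>n s. B n s \<omega>) (\<lambda>s. I s \<omega>) sequentially" by simp
      from uniform_limit_add[OF u[of T] this]
      show "uniform_limit {a..T} (\<lambda>n s. A n (\<nu> n) s \<omega>) (\<lambda>s. I s \<omega>) sequentially" by simp
    qed
  qed
  with \<nu>(1) show ?thesis by blast
qed

section \<open>Independent Gaussian increments\<close>

lemma real_distribution_centred_gaussian:
  assumes "0 \<le> v" shows "real_distribution (centred_gaussian v)"
proof -
  have "prob_space (centred_gaussian v)"
    using assms by (auto simp: centred_gaussian_def intro!: prob_space_return prob_space_normal_density)
  then show ?thesis
    by (intro real_distribution.intro real_distribution_axioms.intro) (auto simp: centred_gaussian_def)
qed

lemma char_centred_gaussian:
  assumes "0 \<le> v"
  shows "char (centred_gaussian v) t = complex_of_real (exp (- (v * t\<^sup>2) / 2))"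
proof (cases "v = 0")
  case True
  then show ?thesis by (simp add: centred_gaussian_def char_def integral_return)
next
  case False
  then have v: "v > 0" using assms by simp
  interpret N: prob_space std_normal_distribution by (rule prob_space_normal_density) simp
  have "distributed std_normal_distribution lborel (\<lambda>x. x) std_normal_density"
    by (auto simp: distributed_def distr_id2)
  from N.normal_density_affine[OF this, of "sqrt v" 0] v
  have "distributed std_normal_distribution lborel (\<lambda>x. sqrt v * x) (normal_density 0 (sqrt v))" by simp
  then have "distr std_normal_distribution lborel (\<lambda>x. sqrt v * x) = density lborel (normal_density 0 (sqrt v))"
    by (rule distributed_distr_eq_density)
  then have eq: "centred_gaussian v = distr std_normal_distribution lborel (\<lambda>x. sqrt v * x)"
    using v by (simp add: centred_gaussian_def)
  have "char (centred_gaussian v) t = char std_normal_distribution (t * sqrt v)"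
    unfolding eq char_def by (subst integral_distr) (auto simp: mult.assoc)
  also have "\<dots> = complex_of_real (exp (- (v * t\<^sup>2) / 2))"
    using v by (simp add: char_std_normal_distribution power_mult_distrib mult.commute)
  finally show ?thesis .
qed

context prob_space
begin

text \<open>The two factors generate \<sigma>-algebras inside the two independent families, so the
  expectation factors, and the second factor is a Gaussian characteristic function.\<close>

lemma integral_iexp_increment:
  fixes U :: "'a \<Rightarrow> complex" and D :: "'a \<Rightarrow> real"
  assumes G: "subalgebra M G" and U: "U \<in> borel_measurable G" "\<And>\<omega>. norm (U \<omega>) \<le> 1"
    and D[measurable]: "D \<in> borel_measurable M"
    and ind: "indep_set (sets G) {D -` B \<inter> space M | B. B \<in> sets borel}"
    and law: "distr M borel D = centred_gaussian v" and v: "0 \<le> v"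
  shows "(CLINT \<omega>|M. U \<omega> * iexp (t * D \<omega>)) = (CLINT \<omega>|M. U \<omega>) * exp (- (v * t\<^sup>2) / 2)"
proof -
  have UM[measurable]: "U \<in> borel_measurable M" by (rule measurable_from_subalg[OF G U(1)])
  have [measurable]: "(\<lambda>\<omega>. iexp (t * D \<omega>)) \<in> borel_measurable M" by measurable
  have "indep_var borel U borel (\<lambda>\<omega>. iexp (t * D \<omega>))"
    unfolding indep_var_eq
  proof (intro conjI)
    have 1: "sigma_sets (space M) {U -` A \<inter> space M |A. A \<in> sets borel} \<subseteq> sets G"
    proof -
      have "space G = space M" using G by (simp add: subalgebra_def)
      then show ?thesis
        using sets.sigma_sets_subset[of "{U -` A \<inter> space M |A. A \<in> sets borel}" G]
          measurable_sets[OF U(1)] by auto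
    qed
    have 2: "sigma_sets (space M) {(\<lambda>\<omega>. iexp (t * D \<omega>)) -` A \<inter> space M |A. A \<in> sets borel}
        \<subseteq> {D -` B \<inter> space M | B. B \<in> sets borel}"
    proof -
      \<comment> \<open>The preimages of Borel sets under \<open>D\<close> already form a
        \<sigma>-algebra, so they contain everything generated by a function of
        \<open>D\<close>.\<close>
      let ?V = "vimage_algebra (space M) D borel"
      have V: "sets ?V = {D -` B \<inter> space M | B. B \<in> sets borel}"
        by (rule sets_vimage_algebra2) simp
      have "{(\<lambda>\<omega>. iexp (t * D \<omega>)) -` A \<inter> space M |A. A \<in> sets borel} \<subseteq> sets ?V"
      proof safe
        fix A :: "complex set" assume A: "A \<in> sets borel"
        have "(\<lambda>x. iexp (t * x)) -` A \<in> sets (borel :: real measure)"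
          using measurable_sets[of "\<lambda>x. iexp (t * x)" borel borel A] A by simp
        then show "(\<lambda>\<omega>. iexp (t * D \<omega>)) -` A \<inter> space M \<in> sets ?V"
          unfolding V by (auto intro!: exI[of _ "(\<lambda>x. iexp (t * x)) -` A"])
      qed
      from sets.sigma_sets_subset[OF this] show ?thesis unfolding V by simp
    qed
    show "indep_set (sigma_sets (space M) {U -` A \<inter> space M |A. A \<in> sets borel})
       (sigma_sets (space M) {(\<lambda>\<omega>. iexp (t * D \<omega>)) -` A \<inter> space M |A. A \<in> sets borel})"
      unfolding indep_sets2_eq
    proof (intro conjI ballI)
      note i = ind[unfolded indep_sets2_eq]
      show "sigma_sets (space M) {U -` A \<inter> space M |A. A \<in> sets borel} \<subseteq> events"
        using order_trans[OF 1 conjunct1[OF i]] .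
      show "sigma_sets (space M) {(\<lambda>\<omega>. iexp (t * D \<omega>)) -` A \<inter> space M |A. A \<in> sets borel} \<subseteq> events"
        using order_trans[OF 2 conjunct1[OF conjunct2[OF i]]] .
      fix a b
      assume "a \<in> sigma_sets (space M) {U -` A \<inter> space M |A. A \<in> sets borel}"
        and "b \<in> sigma_sets (space M) {(\<lambda>\<omega>. iexp (t * D \<omega>)) -` A \<inter> space M |A. A \<in> sets borel}"
      then show "prob (a \<inter> b) = prob a * prob b"
        using conjunct2[OF conjunct2[OF i]] subsetD[OF 1] subsetD[OF 2] by (simp only:)
    qed
  qed simp_all
  moreover have "integrable M U"
    by (rule integrable_const_bound[where B=1]) (use U(2) in auto)
  moreover have "integrable M (\<lambda>\<omega>. iexp (t * D \<omega>))"
    by (rule integrable_const_bound[where B=1]) auto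
  ultimately have "(CLINT \<omega>|M. U \<omega> * iexp (t * D \<omega>)) = (CLINT \<omega>|M. U \<omega>) * (CLINT \<omega>|M. iexp (t * D \<omega>))"
    by (rule indep_var_lebesgue_integral)
  also have "(CLINT \<omega>|M. iexp (t * D \<omega>)) = char (distr M borel D) t"
    unfolding char_def by (subst integral_distr) auto
  also have "\<dots> = exp (- (v * t\<^sup>2) / 2)"
    unfolding law char_centred_gaussian[OF v] ..
  finally show ?thesis .
qed

text \<open>The last increment is peeled off: \<open>A\<close> and the earlier increments are known
  at time \<open>c k\<close>. Carrying \<open>A\<close> along lets one formula encode both the law
  and the independence of the past.\<close>

lemma integral_iexp_increments_sum:
  fixes x :: "real \<Rightarrow> 'a \<Rightarrow> real" and c a :: "nat \<Rightarrow> real"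
  assumes F: "filtration_from M t0 F" and x: "\<And>t. t0 \<le> t \<Longrightarrow> x t \<in> borel_measurable (F t)"
    and ind: "\<And>s t. t0 \<le> s \<Longrightarrow> s \<le> t \<Longrightarrow>
       indep_set (sets (F s)) {(\<lambda>\<omega>. x t \<omega> - x s \<omega>) -` B \<inter> space M | B. B \<in> sets borel}"
    and law: "\<And>s t. t0 \<le> s \<Longrightarrow> s \<le> t \<Longrightarrow>
       distr M borel (\<lambda>\<omega>. x t \<omega> - x s \<omega>) = centred_gaussian ((t - s) * q)"
    and q: "0 \<le> q" and c: "\<And>i j. i \<le> j \<Longrightarrow> c i \<le> c j" "t0 \<le> c 0"
    and A: "A \<in> sets (F (c 0))"
  shows "(CLINT \<omega>|M. indicator A \<omega> * iexp (t * (\<Sum>j<k. a j * (x (c (Suc j)) \<omega> - x (c j) \<omega>)))) =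
    prob A * exp (- ((\<Sum>j<k. (a j)\<^sup>2 * (c (Suc j) - c j)) * q * t\<^sup>2) / 2)"
proof (induction k)
  case 0
  have "A \<in> events" using A F c(2) unfolding filtration_from_def subalgebra_def by blast
  then have "(CLINT \<omega>|M. indicator A \<omega> *\<^sub>R 1) = prob A *\<^sub>R (1::complex)"
    by (intro has_bochner_integral_integral_eq has_bochner_integral_indicator) (auto simp: emeasure_eq_measure)
  moreover have "(CLINT \<omega>|M. indicator A \<omega>) = (CLINT \<omega>|M. indicator A \<omega> *\<^sub>R 1)"
    by (intro Bochner_Integration.integral_cong) (auto simp: indicator_def)
  ultimately show ?case by (simp add: scaleR_conv_of_real)
next
  case (Suc k)
  have ck: "t0 \<le> c j" for j using c(1)[of 0 j] c(2) by simp
  have sub: "subalgebra M (F (c j))" for j using F ck unfolding filtration_from_def by blast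
  let ?S = "\<lambda>\<omega>. \<Sum>j<k. a j * (x (c (Suc j)) \<omega> - x (c j) \<omega>)"
  let ?U = "\<lambda>\<omega>. indicator A \<omega> * iexp (t * ?S \<omega>) :: complex"
  let ?D = "\<lambda>\<omega>. x (c (Suc k)) \<omega> - x (c k) \<omega>"
  have xm: "x (c j) \<in> borel_measurable (F (c k))" if "j \<le> k" for j
    by (rule filtration_from_measurable[OF F ck c(1)[OF that] x[OF ck]])
  have Am: "A \<in> sets (F (c k))"
    using A F c(1)[of 0 k] c(2) unfolding filtration_from_def by blast
  have "?S \<in> borel_measurable (F (c k))"
    by (intro borel_measurable_sum borel_measurable_times borel_measurable_const borel_measurable_diff xm) auto
  then have U: "?U \<in> borel_measurable (F (c k))" using Am by measurable
  have xM: "x (c j) \<in> borel_measurable M" for j by (rule filtration_from_measurable_M[OF F ck x[OF ck]])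
  have "(CLINT \<omega>|M. indicator A \<omega> * iexp (t * (\<Sum>j<Suc k. a j * (x (c (Suc j)) \<omega> - x (c j) \<omega>))))
      = (CLINT \<omega>|M. ?U \<omega> * iexp ((t * a k) * ?D \<omega>))"
    by (intro Bochner_Integration.integral_cong)
       (auto simp: algebra_simps exp_add[symmetric])
  also have "\<dots> = (CLINT \<omega>|M. ?U \<omega>) * exp (- ((c (Suc k) - c k) * q * (t * a k)\<^sup>2) / 2)"
    by (rule integral_iexp_increment[OF sub U])
       (use xM ind law ck c(1)[of k "Suc k"] q in \<open>auto simp: norm_mult indicator_def\<close>)
  also have "\<dots> = prob A * (exp (- ((\<Sum>j<k. (a j)\<^sup>2 * (c (Suc j) - c j)) * q * t\<^sup>2) / 2)
      * exp (- ((c (Suc k) - c k) * q * (t * a k)\<^sup>2) / 2))"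
    unfolding Suc.IH by simp
  also have "exp (- ((\<Sum>j<k. (a j)\<^sup>2 * (c (Suc j) - c j)) * q * t\<^sup>2) / 2)
      * exp (- ((c (Suc k) - c k) * q * (t * a k)\<^sup>2) / 2)
      = exp (- ((\<Sum>j<Suc k. (a j)\<^sup>2 * (c (Suc j) - c j)) * q * t\<^sup>2) / 2)"
    unfolding exp_add[symmetric] by (simp add: field_simps power_mult_distrib)
  finally show ?case .
qed

text \<open>For \<open>A\<close> of positive probability the hypothesis says that \<open>D\<close>,
  under the measure conditioned on \<open>A\<close>, has a Gaussian characteristic function. By
  Levy's uniqueness theorem the conditional law does not depend on \<open>A\<close>, which is
  independence.\<close>

lemma indep_set_centred_gaussianI:
  fixes D :: "'a \<Rightarrow> real"
  assumes G: "subalgebra M G" and D[measurable]: "D \<in> borel_measurable M" and v: "0 \<le> v"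
    and char: "\<And>A t. A \<in> sets G \<Longrightarrow>
      (CLINT \<omega>|M. indicator A \<omega> * iexp (t * D \<omega>)) = prob A * exp (- (v * t\<^sup>2) / 2)"
  shows "indep_set (sets G) {D -` B \<inter> space M | B. B \<in> sets borel}"
    and "distr M borel D = centred_gaussian v"
proof -
  interpret gauss: real_distribution "centred_gaussian v" by (rule real_distribution_centred_gaussian[OF v])
  have GM: "sets G \<subseteq> events" "space G = space M" using G by (auto simp: subalgebra_def)
  have key: "prob (A \<inter> (D -` B \<inter> space M)) = prob A * measure (centred_gaussian v) B"
    if A: "A \<in> sets G" and B: "B \<in> sets borel" for A B
  proof (cases "prob A = 0")
    case True
    have [measurable]: "A \<in> events" using A GM by auto
    have "prob (A \<inter> (D -` B \<inter> space M)) \<le> prob A" using B by (intro finite_measure_mono) auto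
    then show ?thesis using True measure_nonneg[of M "A \<inter> (D -` B \<inter> space M)"] by simp
  next
    case False
    have A'[measurable]: "A \<in> events" using A GM by auto
    have pA: "prob A > 0" using False by (simp add: zero_less_measure_iff)
    define N where "N = uniform_measure M A"
    interpret N: prob_space N
      unfolding N_def by (rule prob_space_uniform_measure) (use pA in \<open>auto simp: emeasure_eq_measure\<close>)
    have Nd: "N = density M (\<lambda>\<omega>. ennreal (indicator A \<omega> / prob A))"
      unfolding N_def uniform_measure_def
      by (intro density_cong) (use pA in \<open>auto simp: emeasure_eq_measure indicator_def divide_ennreal ennreal_1[symmetric] simp del: ennreal_1\<close>)
    have sN[measurable_cong]: "sets N = sets M" by (simp add: N_def)
    have "real_distribution (distr N borel D)"
      by (intro real_distribution.intro real_distribution_axioms.intro N.prob_space_distr) auto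
    moreover have "char (distr N borel D) = char (centred_gaussian v)"
    proof
      fix t
      have "char (distr N borel D) t = (CLINT \<omega>|N. iexp (t * D \<omega>))"
        unfolding char_def by (subst integral_distr) auto
      also have "\<dots> = (CLINT \<omega>|M. (indicator A \<omega> / prob A) *\<^sub>R iexp (t * D \<omega>))"
        unfolding Nd by (rule integral_density) (use pA in auto)
      also have "\<dots> = (CLINT \<omega>|M. (1 / prob A) *\<^sub>R (indicator A \<omega> * iexp (t * D \<omega>)))"
        by (intro Bochner_Integration.integral_cong) (auto simp: indicator_def)
      also have "\<dots> = (1 / prob A) *\<^sub>R (CLINT \<omega>|M. indicator A \<omega> * iexp (t * D \<omega>))"
        by simp
      also have "\<dots> = exp (- (v * t\<^sup>2) / 2)"
        unfolding char[OF A] using pA by (simp add: scaleR_conv_of_real)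
      finally show "char (distr N borel D) t = char (centred_gaussian v) t"
        unfolding char_centred_gaussian[OF v] .
    qed
    ultimately have eq: "distr N borel D = centred_gaussian v"
      by (intro Levy_uniqueness real_distribution_centred_gaussian v)
    have "measure (centred_gaussian v) B = measure N (D -` B \<inter> space N)"
      unfolding eq[symmetric] using B by (subst measure_distr) auto
    also have "\<dots> = prob (A \<inter> (D -` B \<inter> space M)) / prob A"
      unfolding N_def using B by (subst measure_uniform_measure) (use pA in \<open>auto simp: emeasure_eq_measure\<close>)
    finally show ?thesis using pA by (simp add: field_simps)
  qed
  \<comment> \<open>Conditioning on the whole space yields the law of \<open>D\<close>
    itself.\<close>
  have top: "space M \<in> sets G" using sets.top[of G] GM by simp
  have law: "prob (D -` B \<inter> space M) = measure (centred_gaussian v) B" if "B \<in> sets borel" for B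
  proof -
    have "space M \<inter> (D -` B \<inter> space M) = D -` B \<inter> space M" by auto
    then show ?thesis using key[OF top that] prob_space by simp
  qed
  show "indep_set (sets G) {D -` B \<inter> space M | B. B \<in> sets borel}"
    unfolding indep_sets2_eq using GM key law D by (auto intro: measurable_sets)
  show "distr M borel D = centred_gaussian v"
  proof (rule measure_eqI)
    fix B assume "B \<in> sets (distr M borel D)"
    then have B: "B \<in> sets borel" by simp
    then show "emeasure (distr M borel D) B = emeasure (centred_gaussian v) B"
      using law[OF B] by (simp add: emeasure_distr emeasure_eq_measure gauss.emeasure_eq_measure)
  qed simp
qed

end

section \<open>The time-changed noise\<close>

lemma C1_from_mult:
  assumes "C1_from a p p'" "C1_from a q q'"
  shows "C1_from a (\<lambda>u. q u * p u) (\<lambda>u. q' u * p u + q u * p' u)"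
proof -
  have "((\<lambda>u. q u * p u) has_real_derivative q' u * p u + q u * p' u) (at u within {a..})" if "a \<le> u" for u
    using DERIV_mult[OF C1_fromD[OF assms(2) that] C1_fromD[OF assms(1) that]]
    by (simp add: mult.commute add.commute)
  then show ?thesis
    using assms[THEN C1_from_continuous] assms[THEN C1_from_continuous']
    by (auto simp: C1_from_def intro!: continuous_intros)
qed

lemma C1_from_inverse:
  assumes "C1_from a p p'" "\<And>u. a \<le> u \<Longrightarrow> p u \<noteq> 0"
  shows "C1_from a (\<lambda>u. 1 / p u) (\<lambda>u. - p' u / (p u)\<^sup>2)"
  using assms C1_from_continuous[OF assms(1)] C1_from_continuous'[OF assms(1)]
  by (auto simp: C1_from_def power2_eq_square intro!: continuous_intros derivative_eq_intros)

lemma C1_from_compose: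
  assumes "C1_from a' p p'" "C1_from a \<theta> \<theta>'" "\<And>u. a \<le> u \<Longrightarrow> a' \<le> \<theta> u"
  shows "C1_from a (\<lambda>u. p (\<theta> u)) (\<lambda>u. p' (\<theta> u) * \<theta>' u)"
proof -
  have "((\<lambda>u. p (\<theta> u)) has_real_derivative p' (\<theta> u) * \<theta>' u) (at u within {a..})" if "a \<le> u" for u
  proof -
    have "(p has_real_derivative p' (\<theta> u)) (at (\<theta> u) within \<theta> ` {a..})"
      by (rule DERIV_subset[OF C1_fromD[OF assms(1) assms(3)[OF that]]]) (use assms(3) in auto)
    from DERIV_image_chain[OF this C1_fromD[OF assms(2) that]] show ?thesis by (simp add: o_def)
  qed
  moreover have "continuous_on {a..} (\<lambda>u. p' (\<theta> u) * \<theta>' u)"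
    by (intro continuous_on_mult C1_from_continuous'[OF assms(2)]
        continuous_on_compose2[OF C1_from_continuous'[OF assms(1)] C1_from_continuous[OF assms(2)]])
       (use assms(3) in auto)
  ultimately show ?thesis by (auto simp: C1_from_def)
qed

text \<open>Derivatives within \<open>{a..}\<close> are unique, so it is enough to compare the
  weights.\<close>

lemma path_integral_cong_C1:
  assumes xy: "path_integral a p p' x y" and p: "C1_from a p p'" and q: "C1_from a q q'"
    and eq: "\<And>u. a \<le> u \<Longrightarrow> p u = q u"
  shows "path_integral a q q' x y"
proof (rule path_integral_cong[OF xy])
  fix u assume u: "a \<le> u"
  have "(p has_vector_derivative q' u) (at u within {a..})"
    using C1_fromD[OF q u] u eq unfolding has_real_derivative_iff_has_vector_derivative
    by (subst has_vector_derivative_cong_ev[where g=q]) auto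
  moreover have "(p has_vector_derivative p' u) (at u within {a..})"
    using C1_fromD[OF p u] unfolding has_real_derivative_iff_has_vector_derivative .
  moreover have "at u within {a..} \<noteq> bot"
  proof -
    have "at_right u \<le> at u within {a..}" by (rule at_le) (use u in auto)
    then show ?thesis using trivial_limit_at_right_real[of u] by (auto simp: bot_unique)
  qed
  ultimately show "q' u = p' u" by (metis vector_derivative_within)
qed (use eq in auto)

section \<open>The change of time and the new Brownian motion\<close>

text \<open>\<theta> leads from the old clock to the new one and \<phi> back. The derivatives are
  two-sided even at \<open>a\<close>, because \<open>time_changed_noise\<close> refers to
  \<open>deriv \<theta>\<close> and \<open>nn_integral_time_change_le\<close> to derivatives at the
  end points. The second derivative enters because sqrt(\<theta>') is integrated by parts.\<close>

locale time_change =
  fixes a a' :: real and \<theta> \<theta>' \<theta>'' \<phi> :: "real \<Rightarrow> real"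
  assumes deriv_at: "\<And>u. a \<le> u \<Longrightarrow> (\<theta> has_real_derivative \<theta>' u) (at u)"
    and deriv'_at: "\<And>u. a \<le> u \<Longrightarrow> (\<theta>' has_real_derivative \<theta>'' u) (at u)"
    and cont'': "continuous_on {a..} \<theta>''"
    and pos: "\<And>u. a \<le> u \<Longrightarrow> 0 < \<theta>' u"
    and start: "\<theta> a = a'"
    and \<phi>: "\<And>s. a' \<le> s \<Longrightarrow> a \<le> \<phi> s" "\<And>s. a' \<le> s \<Longrightarrow> \<theta> (\<phi> s) = s" "\<And>u. a \<le> u \<Longrightarrow> \<phi> (\<theta> u) = u"
    and \<phi>_deriv_at: "\<And>s. a' \<le> s \<Longrightarrow> (\<phi> has_real_derivative 1 / \<theta>' (\<phi> s)) (at s)"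
begin

definition "g u = sqrt (\<theta>' u)"
definition "g' u = \<theta>'' u / (2 * sqrt (\<theta>' u))"

lemma mono: "a \<le> u \<Longrightarrow> u \<le> v \<Longrightarrow> \<theta> u \<le> \<theta> v"
  by (rule DERIV_nonneg_imp_nondecreasing) (use deriv_at pos in \<open>meson less_imp_le order_trans\<close>)+

lemma range: "a \<le> u \<Longrightarrow> a' \<le> \<theta> u"
  using mono[of a u] start by simp

lemma strict_mono: "a \<le> u \<Longrightarrow> a \<le> v \<Longrightarrow> \<theta> u < \<theta> v \<longleftrightarrow> u < v"
  using mono[of u v] mono[of v u] \<phi>(3)[of u] \<phi>(3)[of v] by (metis linorder_not_less order_le_less)

lemma \<phi>_mono: "a' \<le> s \<Longrightarrow> s \<le> t \<Longrightarrow> \<phi> s \<le> \<phi> t"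
  using strict_mono[of "\<phi> t" "\<phi> s"] \<phi>(1,2) by (metis linorder_not_less order_trans)

lemma \<phi>_start: "\<phi> a' = a"
  using \<phi>(3)[of a] start by simp

lemma C1_\<theta>': "C1_from a \<theta>' \<theta>''"
  using deriv'_at cont'' by (auto simp: C1_from_def intro: DERIV_subset)

lemma C1_\<theta>: "C1_from a \<theta> \<theta>'"
  using deriv_at C1_from_continuous[OF C1_\<theta>'] by (auto simp: C1_from_def intro: DERIV_subset)

lemma C1_g: "C1_from a g g'"
proof -
  have "(g has_real_derivative g' u) (at u within {a..})" if "a \<le> u" for u
    using DERIV_real_sqrt[THEN DERIV_chain2, OF pos[OF that] C1_fromD[OF C1_\<theta>' that]] that
    by (simp add: g_def[abs_def] g'_def field_simps)
  moreover have "continuous_on {a..} g'"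
    unfolding g'_def[abs_def]
    by (intro continuous_intros cont'' C1_from_continuous[OF C1_\<theta>']) (use pos in force)
  ultimately show ?thesis by (auto simp: C1_from_def)
qed

lemma g_pos: "a \<le> u \<Longrightarrow> 0 < g u"
  using pos by (simp add: g_def)

lemma g_sq: "a \<le> u \<Longrightarrow> (g u)\<^sup>2 = \<theta>' u"
  using pos[of u] by (simp add: g_def)

lemma continuous_\<phi>: "continuous_on {a'..} \<phi>"
  using \<phi>_deriv_at by (intro continuous_at_imp_continuous_on ballI DERIV_isCont) auto

lemma C1_\<phi>: "C1_from a' \<phi> (\<lambda>s. 1 / \<theta>' (\<phi> s))"
proof -
  have "continuous_on {a'..} (\<lambda>s. 1 / \<theta>' (\<phi> s))"
  proof (intro continuous_on_divide continuous_on_const)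
    show "continuous_on {a'..} (\<lambda>s. \<theta>' (\<phi> s))"
      by (rule continuous_on_compose2[OF C1_from_continuous[OF C1_\<theta>'] continuous_\<phi>]) (use \<phi>(1) in auto)
  qed (use pos \<phi>(1) in force)
  then show ?thesis using \<phi>_deriv_at by (auto simp: C1_from_def intro: DERIV_subset)
qed

lemma filtration_from_time_change:
  assumes "filtration_from M a F" shows "filtration_from M a' (\<lambda>s. F (\<phi> s))"
proof -
  have "subalgebra M (F (\<phi> s))" if "a' \<le> s" for s
    using assms \<phi>(1)[OF that] unfolding filtration_from_def by blast
  moreover have "sets (F (\<phi> s)) \<subseteq> sets (F (\<phi> t))" if "a' \<le> s" "s \<le> t" for s t
    using assms \<phi>(1)[OF that(1)] \<phi>_mono[OF that] unfolding filtration_from_def by blast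
  ultimately show ?thesis unfolding filtration_from_def by blast
qed

lemma diffusion_coefficient_time_change:
  fixes \<sigma> :: "real \<Rightarrow> 'h::real_inner \<Rightarrow>\<^sub>L 'k::real_normed_vector"
  assumes \<sigma>: "diffusion_coefficient a \<sigma>" and w: "continuous_on {a'..} w"
  shows "diffusion_coefficient a' (\<lambda>s. w s *\<^sub>R \<sigma> (\<phi> s))"
  unfolding diffusion_coefficient_def
proof (rule measurable_hs_borel_scaleR)
  show "w \<in> borel_measurable (restrict_space borel {a'..})"
    by (rule borel_measurable_continuous_on_restrict[OF w])
  have "\<phi> \<in> restrict_space borel {a'..} \<rightarrow>\<^sub>M restrict_space borel {a..}"
    using borel_measurable_continuous_on_restrict[OF continuous_\<phi>] \<phi>(1)
    by (intro measurable_restrict_space2) (auto simp: space_restrict_space)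
  then show "(\<lambda>s. \<sigma> (\<phi> s)) \<in> restrict_space borel {a'..} \<rightarrow>\<^sub>M hs_borel"
    using \<sigma> unfolding diffusion_coefficient_def by (rule measurable_compose)
qed

text \<open>The stochastic integral of the smooth deterministic function \<open>g\<close> exists pathwise, as a
  Riemann--Stieltjes integral.  Taking the limit of the Riemann sums, rather than integrating by
  parts, makes it adapted although only almost all paths of \<open>W\<close> are continuous.\<close>

definition noise :: "(real \<Rightarrow> 'h \<Rightarrow> 'w \<Rightarrow> 'b::real_normed_vector) \<Rightarrow> real \<Rightarrow> 'h \<Rightarrow> 'w \<Rightarrow> 'b" where
  "noise W s h \<omega> = lim (\<lambda>k. \<Sum>j<k. g (grid a (\<phi> s) k j) *\<^sub>R
     (W (grid a (\<phi> s) k (Suc j)) h \<omega> - W (grid a (\<phi> s) k j) h \<omega>))"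

text \<open>On a continuous path the Riemann sums converge, so \<open>lim\<close> is a true limit
  and the calculus of path integrals applies; other paths form a null set in every use.\<close>

lemma path_integral_noise:
  fixes W :: "real \<Rightarrow> 'h \<Rightarrow> 'w \<Rightarrow> 'b::banach"
  assumes x: "continuous_on {a..} (\<lambda>u. W u h \<omega>)"
  shows "path_integral a g g' (\<lambda>u. W u h \<omega>) (\<lambda>u. noise W (\<theta> u) h \<omega>)"
proof -
  obtain y where y: "path_integral a g g' (\<lambda>u. W u h \<omega>) y"
    using path_integral_exists[OF C1_g x] by blast
  show ?thesis
  proof (rule path_integral_cong[OF y])
    fix u assume u: "a \<le> u"
    have y0: "y a = 0" using y by (simp add: path_integral_def)
    show "noise W (\<theta> u) h \<omega> = y u"
      unfolding noise_def \<phi>(3)[OF u]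
      using path_integral_riemann_sums_tendsto[OF C1_g y x order_refl u] by (intro limI) (simp add: y0)
  qed auto
qed

lemma noise_increment_tendsto:
  fixes W :: "real \<Rightarrow> 'h \<Rightarrow> 'w \<Rightarrow> 'b::banach"
  assumes x: "continuous_on {a..} (\<lambda>u. W u h \<omega>)" and uv: "a \<le> u" "u \<le> v"
  shows "(\<lambda>k. \<Sum>j<k. g (grid u v k j) *\<^sub>R (W (grid u v k (Suc j)) h \<omega> - W (grid u v k j) h \<omega>))
    \<longlonglongrightarrow> noise W (\<theta> v) h \<omega> - noise W (\<theta> u) h \<omega>"
  by (rule path_integral_riemann_sums_tendsto[OF C1_g path_integral_noise[of W h \<omega>, OF x] x uv])

lemma noise_start:
  fixes W :: "real \<Rightarrow> 'h \<Rightarrow> 'w \<Rightarrow> 'b::banach"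
  assumes x: "continuous_on {a..} (\<lambda>u. W u h \<omega>)" shows "noise W a' h \<omega> = 0"
  using path_integral_noise[of W h \<omega>, OF x] start by (simp add: path_integral_def)

lemma noise_tendsto:
  fixes W :: "real \<Rightarrow> 'h \<Rightarrow> 'w \<Rightarrow> 'b::banach"
  assumes x: "continuous_on {a..} (\<lambda>u. W u h \<omega>)" and s: "a' \<le> s"
  shows "(\<lambda>k. \<Sum>j<k. g (grid a (\<phi> s) k j) *\<^sub>R
      (W (grid a (\<phi> s) k (Suc j)) h \<omega> - W (grid a (\<phi> s) k j) h \<omega>)) \<longlonglongrightarrow> noise W s h \<omega>"
  using noise_increment_tendsto[of W h \<omega>, OF x order_refl \<phi>(1)[OF s]] noise_start[of W h \<omega>, OF x]
  by (simp add: \<phi>(2)[OF s] start)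

lemma noise_continuous:
  fixes W :: "real \<Rightarrow> 'h \<Rightarrow> 'w \<Rightarrow> 'b::banach"
  assumes x: "continuous_on {a..} (\<lambda>u. W u h \<omega>)"
  shows "continuous_on {a'..} (\<lambda>s. noise W s h \<omega>)"
proof -
  have "continuous_on {a..} (\<lambda>u. noise W (\<theta> u) h \<omega>)"
    by (rule path_integral_continuous[OF C1_g path_integral_noise[of W h \<omega>, OF x] x])
  then have "continuous_on {a'..} (\<lambda>s. noise W (\<theta> (\<phi> s)) h \<omega>)"
    by (rule continuous_on_compose2[OF _ continuous_\<phi>]) (use \<phi>(1) in auto)
  then show ?thesis by (rule continuous_on_eq) (simp add: \<phi>(2))
qed

text \<open>All grid points lie in [a, \<phi> s], and \<open>lim\<close> of a sequence of measurable
  functions is measurable even where the sequence diverges.\<close>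

lemma noise_measurable:
  fixes W :: "real \<Rightarrow> 'h \<Rightarrow> 'w \<Rightarrow> 'b::{banach, second_countable_topology}"
  assumes F: "filtration_from M a F" and W: "\<And>u. a \<le> u \<Longrightarrow> W u h \<in> borel_measurable (F u)"
    and s: "a' \<le> s"
  shows "noise W s h \<in> borel_measurable (F (\<phi> s))"
proof -
  have m: "W (grid a (\<phi> s) k j) h \<in> borel_measurable (F (\<phi> s))" if "j \<le> k" for j k
    using grid_ge[OF \<phi>(1)[OF s]] grid_le[OF \<phi>(1)[OF s] that]
    by (intro filtration_from_measurable[OF F _ _ W]) auto
  have "(\<lambda>\<omega>. lim (\<lambda>k. \<Sum>j<k. g (grid a (\<phi> s) k j) *\<^sub>R
     (W (grid a (\<phi> s) k (Suc j)) h \<omega> - W (grid a (\<phi> s) k j) h \<omega>))) \<in> borel_measurable (F (\<phi> s))"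
    by (intro borel_measurable_lim_metric borel_measurable_sum borel_measurable_scaleR
        borel_measurable_const borel_measurable_diff m) auto
  then show ?thesis unfolding noise_def[abs_def] .
qed

text \<open>The identity for Riemann sums over [u, v] passes to the limit: on the left by dominated
  convergence, on the right because the variances, sums of g^2 times the cell length, tend to the
  integral of \<theta>', which is r - s.\<close>

lemma noise_char:
  fixes W :: "real \<Rightarrow> 'h::real_inner \<Rightarrow> 'w \<Rightarrow> real"
  assumes M: "prob_space M" and F: "filtration_from M a F" and W: "brownian_motion_from M a F C W"
    and s: "a' \<le> s" "s \<le> r" and A: "A \<in> sets (F (\<phi> s))"
  shows "(CLINT \<omega>|M. indicator A \<omega> * iexp (t * (noise W r h \<omega> - noise W s h \<omega>)))
     = measure M A * exp (- ((r - s) * (blinfun_apply C h \<bullet> h) * t\<^sup>2) / 2)"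
proof -
  interpret prob_space M by fact
  let ?q = "blinfun_apply C h \<bullet> h"
  define u v where "u = \<phi> s" and "v = \<phi> r"
  have u: "a \<le> u" "u \<le> v" "\<theta> u = s" "\<theta> v = r" using s \<phi> \<phi>_mono by (auto simp: u_def v_def)
  let ?S = "\<lambda>k \<omega>. \<Sum>j<k. g (grid u v k j) * (W (grid u v k (Suc j)) h \<omega> - W (grid u v k j) h \<omega>)"
  have Wm: "W t h \<in> borel_measurable (F t)" if "a \<le> t" for t
    using W that unfolding brownian_motion_from_def by blast
  have q: "0 \<le> ?q" using W unfolding brownian_motion_from_def by blast
  have ind: "indep_set (sets (F s)) {(\<lambda>\<omega>. W t h \<omega> - W s h \<omega>) -` B \<inter> space M | B. B \<in> sets borel}"
    and law: "distr M borel (\<lambda>\<omega>. W t h \<omega> - W s h \<omega>) = centred_gaussian ((t - s) * ?q)"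
    if "a \<le> s" "s \<le> t" for s t
    using W that unfolding brownian_motion_from_def by blast+
  have eq: "(CLINT \<omega>|M. indicator A \<omega> * iexp (t * ?S k \<omega>)) =
    prob A * exp (- ((\<Sum>j<k. (g (grid u v k j))\<^sup>2 * (grid u v k (Suc j) - grid u v k j)) * ?q * t\<^sup>2) / 2)" for k
    by (rule integral_iexp_increments_sum[OF F Wm ind law q])
       (use u A in \<open>auto simp: u_def intro: grid_mono\<close>)
  have AE: "AE \<omega> in M. continuous_on {a..} (\<lambda>t. W t h \<omega>)" using W unfolding brownian_motion_from_def by blast
  have "(\<lambda>k. CLINT \<omega>|M. indicator A \<omega> * iexp (t * ?S k \<omega>))
     \<longlonglongrightarrow> (CLINT \<omega>|M. indicator A \<omega> * iexp (t * (noise W r h \<omega> - noise W s h \<omega>)))"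
  proof (rule integral_dominated_convergence[where w="\<lambda>_. 1"])
    have WM: "W t h \<in> borel_measurable M" if "a \<le> t" for t
      by (rule filtration_from_measurable_M[OF F that Wm[OF that]])
    have "sets (F (\<phi> s)) \<subseteq> events"
      using F \<phi>(1)[OF s(1)] unfolding filtration_from_def subalgebra_def by blast
    then have [measurable]: "A \<in> events" using A by blast
    have nM: "noise W s' h \<in> borel_measurable M" if "a' \<le> s'" for s'
      by (rule filtration_from_measurable_M[OF F \<phi>(1)[OF that] noise_measurable[of M F W h, OF F Wm that]])
    note [measurable] = nM[OF s(1)] nM[OF order_trans[OF s]]
    show "(\<lambda>\<omega>. indicator A \<omega> * iexp (t * (noise W r h \<omega> - noise W s h \<omega>))) \<in> borel_measurable M"
      by measurable
    fix k
    have "?S k \<in> borel_measurable M"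
      using u grid_ge[OF u(2)] by (intro borel_measurable_sum borel_measurable_times borel_measurable_const
          borel_measurable_diff WM) (auto intro: order_trans)
    note this[measurable]
    show "(\<lambda>\<omega>. indicator A \<omega> * iexp (t * ?S k \<omega>)) \<in> borel_measurable M" by measurable
    show "AE \<omega> in M. norm (indicator A \<omega> * iexp (t * ?S k \<omega>)) \<le> 1"
      by (auto simp: norm_mult indicator_def)
  next
    show "AE \<omega> in M. (\<lambda>k. indicator A \<omega> * iexp (t * ?S k \<omega>))
      \<longlonglongrightarrow> indicator A \<omega> * iexp (t * (noise W r h \<omega> - noise W s h \<omega>))"
      using AE
    proof eventually_elim
      case (elim \<omega>)
      have "(\<lambda>k. ?S k \<omega>) \<longlonglongrightarrow> noise W r h \<omega> - noise W s h \<omega>"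
        using noise_increment_tendsto[of W h \<omega>, OF elim u(1,2)] u by simp
      then show ?case by (intro tendsto_intros)
    qed
  qed simp
  moreover have "(\<lambda>k. \<Sum>j<k. (g (grid u v k j))\<^sup>2 * (grid u v k (Suc j) - grid u v k j)) \<longlonglongrightarrow> r - s"
  proof -
    \<comment> \<open>The variance is itself a Riemann sum, of \<theta>' against the identity path,
      so the limit theorem for path integrals computes it.\<close>
    have pi: "path_integral a \<theta>' \<theta>'' (\<lambda>u. u) (\<lambda>u. \<theta> u - \<theta> a)"
      unfolding path_integral_def
    proof (intro conjI allI impI)
      fix u assume u: "a \<le> u"
      have "((\<lambda>u. \<theta> u - \<theta> a - \<theta>' u * u) has_real_derivative (\<theta>' u - 0 - (\<theta>'' u * u + 1 * \<theta>' u))) (at u within {a..})"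
        by (intro DERIV_diff DERIV_mult DERIV_const DERIV_ident C1_fromD[OF C1_\<theta> u] C1_fromD[OF C1_\<theta>' u])
      then show "((\<lambda>u. \<theta> u - \<theta> a - \<theta>' u *\<^sub>R u) has_vector_derivative - (\<theta>'' u *\<^sub>R u)) (at u within {a..})"
        by (simp add: has_real_derivative_iff_has_vector_derivative[symmetric])
    qed simp
    have "(\<lambda>k. \<Sum>j<k. \<theta>' (grid u v k j) *\<^sub>R (grid u v k (Suc j) - grid u v k j)) \<longlonglongrightarrow> \<theta> v - \<theta> a - (\<theta> u - \<theta> a)"
      by (rule path_integral_riemann_sums_tendsto[OF C1_\<theta>' pi _ u(1,2)]) (intro continuous_intros)
    moreover have "(g (grid u v k j))\<^sup>2 = \<theta>' (grid u v k j)" for k j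
      using u grid_ge[OF u(2), of k j] by (intro g_sq) linarith
    ultimately show ?thesis using u by simp
  qed
  then have "(\<lambda>k. complex_of_real (prob A * exp (- ((\<Sum>j<k. (g (grid u v k j))\<^sup>2 * (grid u v k (Suc j) - grid u v k j)) * ?q * t\<^sup>2) / 2)))
     \<longlonglongrightarrow> complex_of_real (prob A * exp (- ((r - s) * ?q * t\<^sup>2) / 2))"
    by (intro tendsto_of_real tendsto_intros) simp_all
  ultimately show ?thesis unfolding eq by (intro LIMSEQ_unique) simp_all
qed

lemma brownian_motion_noise:
  fixes W :: "real \<Rightarrow> 'h::real_inner \<Rightarrow> 'w \<Rightarrow> real"
  assumes M: "prob_space M" and F: "filtration_from M a F" and W: "brownian_motion_from M a F C W"
  shows "brownian_motion_from M a' (\<lambda>s. F (\<phi> s)) C (noise W)"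
proof -
  interpret prob_space M by fact
  have Wm: "W t h \<in> borel_measurable (F t)" if "a \<le> t" for t h
    using W that unfolding brownian_motion_from_def by blast
  have AE: "AE \<omega> in M. continuous_on {a..} (\<lambda>t. W t h \<omega>)" for h
    using W unfolding brownian_motion_from_def by blast
  have q: "0 \<le> blinfun_apply C h \<bullet> h" for h using W unfolding brownian_motion_from_def by blast
  have m: "noise W s h \<in> borel_measurable (F (\<phi> s))" if "a' \<le> s" for s h
    by (rule noise_measurable[of M F W h, OF F Wm that])
  have lin: "AE \<omega> in M. noise W s (x *\<^sub>R h + y *\<^sub>R k) \<omega> = x * noise W s h \<omega> + y * noise W s k \<omega>"
    if s: "a' \<le> s" for s x y h k
  proof -
    \<comment> \<open>Linearity holds off a null set for each time; all grids together have only
      countably many points.\<close>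
    have "AE \<omega> in M. \<forall>n j. W (grid a (\<phi> s) n j) (x *\<^sub>R h + y *\<^sub>R k) \<omega>
       = x * W (grid a (\<phi> s) n j) h \<omega> + y * W (grid a (\<phi> s) n j) k \<omega>"
      unfolding AE_all_countable
      using W grid_ge[OF \<phi>(1)[OF s]] unfolding brownian_motion_from_def by blast
    with AE[of h] AE[of k] AE[of "x *\<^sub>R h + y *\<^sub>R k"] show ?thesis
    proof eventually_elim
      case (elim \<omega>)
      let ?S = "\<lambda>h n. \<Sum>j<n. g (grid a (\<phi> s) n j) *\<^sub>R
        (W (grid a (\<phi> s) n (Suc j)) h \<omega> - W (grid a (\<phi> s) n j) h \<omega>)"
      have "?S (x *\<^sub>R h + y *\<^sub>R k) = (\<lambda>n. x * ?S h n + y * ?S k n)"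
        using elim(4) by (auto simp: sum_distrib_left sum.distrib[symmetric] algebra_simps)
      moreover have "?S (x *\<^sub>R h + y *\<^sub>R k) \<longlonglongrightarrow> noise W s (x *\<^sub>R h + y *\<^sub>R k) \<omega>"
        by (rule noise_tendsto[of W "x *\<^sub>R h + y *\<^sub>R k" \<omega>, OF elim(3) s])
      moreover have "(\<lambda>n. x * ?S h n + y * ?S k n) \<longlonglongrightarrow> x * noise W s h \<omega> + y * noise W s k \<omega>"
        by (intro tendsto_add tendsto_mult_left noise_tendsto[of W h \<omega>, OF elim(1) s] noise_tendsto[of W k \<omega>, OF elim(2) s])
      ultimately show ?case by (simp add: LIMSEQ_unique)
    qed
  qed
  have cont: "AE \<omega> in M. continuous_on {a'..} (\<lambda>s. noise W s h \<omega>)" for h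
    using AE[of h] by eventually_elim (rule noise_continuous)
  have gauss: "indep_set (sets (F (\<phi> s))) {(\<lambda>\<omega>. noise W r h \<omega> - noise W s h \<omega>) -` B \<inter> space M |B. B \<in> sets borel}
      \<and> distr M borel (\<lambda>\<omega>. noise W r h \<omega> - noise W s h \<omega>) = centred_gaussian ((r - s) * (blinfun_apply C h \<bullet> h))"
    if s: "a' \<le> s" "s \<le> r" for s r h
  proof -
    have sub: "subalgebra M (F (\<phi> s))" using F \<phi>(1)[OF s(1)] unfolding filtration_from_def by blast
    have nM: "noise W s' h \<in> borel_measurable M" if "a' \<le> s'" for s'
      by (rule filtration_from_measurable_M[OF F \<phi>(1)[OF that] m[OF that]])
    have v: "0 \<le> (r - s) * (blinfun_apply C h \<bullet> h)" using s q by simp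
    have D: "(\<lambda>\<omega>. noise W r h \<omega> - noise W s h \<omega>) \<in> borel_measurable M"
      by (rule borel_measurable_diff[OF nM[OF order_trans[OF s]] nM[OF s(1)]])
    show ?thesis
      by (intro conjI indep_set_centred_gaussianI[OF sub D v noise_char[where h=h, OF M F W s]])
  qed
  have sym: "blinfun_apply C h \<bullet> k = h \<bullet> blinfun_apply C k" for h k
    using W unfolding brownian_motion_from_def by blast
  show ?thesis
    unfolding brownian_motion_from_def
    by (intro conjI allI impI sym q m lin cont conjunct1[OF gauss] conjunct2[OF gauss]; assumption)
qed

lemma takes_values_in_space_noise:
  fixes W :: "real \<Rightarrow> 'h::{real_inner, banach, second_countable_topology} \<Rightarrow> 'w \<Rightarrow> real"
  assumes F: "filtration_from M a F" and W: "takes_values_in_space M a F W"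
  shows "takes_values_in_space M a' (\<lambda>s. F (\<phi> s)) (noise W)"
proof -
  obtain V :: "real \<Rightarrow> 'w \<Rightarrow> 'h" where V: "\<And>t. a \<le> t \<Longrightarrow> V t \<in> borel_measurable (F t)"
    "AE \<omega> in M. continuous_on {a..} (\<lambda>t. V t \<omega>)"
    "\<And>t h. a \<le> t \<Longrightarrow> AE \<omega> in M. W t h \<omega> = V t \<omega> \<bullet> h"
    using W unfolding takes_values_in_space_def by blast
  \<comment> \<open>The construction of \<open>noise\<close> is reused for a vector-valued process;
    the one-element type fills the slot of the direction.\<close>
  let ?V = "\<lambda>t (_::unit). V t"
  have "noise ?V s () \<in> borel_measurable (F (\<phi> s))" if "a' \<le> s" for s
    by (rule noise_measurable[OF F _ that]) (rule V(1))
  moreover have "AE \<omega> in M. continuous_on {a'..} (\<lambda>s. noise ?V s () \<omega>)"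
    using V(2) by eventually_elim (rule noise_continuous)
  moreover have "AE \<omega> in M. noise W s h \<omega> = noise ?V s () \<omega> \<bullet> h" if s: "a' \<le> s" for s h
  proof -
    have "AE \<omega> in M. \<forall>n j. W (grid a (\<phi> s) n j) h \<omega> = V (grid a (\<phi> s) n j) \<omega> \<bullet> h"
      unfolding AE_all_countable using V(3) grid_ge[OF \<phi>(1)[OF s]] by blast
    with V(2) show ?thesis
    proof eventually_elim
      case (elim \<omega>)
      let ?S = "\<lambda>n. \<Sum>j<n. g (grid a (\<phi> s) n j) *\<^sub>R (V (grid a (\<phi> s) n (Suc j)) \<omega> - V (grid a (\<phi> s) n j) \<omega>)"
      have "?S \<longlonglongrightarrow> noise ?V s () \<omega>" by (rule noise_tendsto[of ?V "()" \<omega>, OF elim(1) s])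
      then have "(\<lambda>n. ?S n \<bullet> h) \<longlonglongrightarrow> noise ?V s () \<omega> \<bullet> h" by (intro tendsto_intros)
      then show ?case
        unfolding noise_def[of W] using elim(2) by (intro limI) (simp add: inner_sum_left inner_diff_left)
    qed
  qed
  ultimately show ?thesis
    unfolding takes_values_in_space_def by (intro exI[of _ "\<lambda>s. noise ?V s ()"]) simp
qed

end

section \<open>Estimates for the transformed integrands\<close>

text \<open>A simple function below c G is divided by \<open>c\<close>; measurability of
  \<open>G\<close> is not assumed.\<close>

lemma nn_integral_cmult_le:
  assumes c: "0 < c"
  shows "(\<integral>\<^sup>+x. ennreal c * G x \<partial>M) \<le> ennreal c * integral\<^sup>N M G"
  unfolding nn_integral_def[of M "\<lambda>x. ennreal c * G x"]
proof (safe intro!: SUP_least)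
  fix s assume s: "simple_function M s" "s \<le> (\<lambda>x. ennreal c * G x)"
  have [measurable]: "s \<in> borel_measurable M" using s(1) by (rule borel_measurable_simple_function)
  have one: "ennreal c * (ennreal (1 / c) * y) = y" "ennreal (1 / c) * (ennreal c * y) = y" for y
    using c by (simp_all add: mult.assoc[symmetric] ennreal_mult[symmetric])
  have "integral\<^sup>S M s = integral\<^sup>N M s" by (rule nn_integral_eq_simple_integral[OF s(1), symmetric])
  also have "\<dots> = (\<integral>\<^sup>+x. ennreal c * (ennreal (1 / c) * s x) \<partial>M)" by (simp only: one)
  also have "\<dots> = ennreal c * (\<integral>\<^sup>+x. ennreal (1 / c) * s x \<partial>M)" by (rule nn_integral_cmult) simp
  also have "\<dots> \<le> ennreal c * integral\<^sup>N M G"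
  proof (intro mult_left_mono nn_integral_mono)
    fix x
    have "ennreal (1 / c) * s x \<le> ennreal (1 / c) * (ennreal c * G x)"
      using s(2)[THEN le_funD, of x] by (rule mult_left_mono) simp
    then show "ennreal (1 / c) * s x \<le> G x" by (simp only: one)
  qed simp
  finally show "integral\<^sup>S M s \<le> ennreal c * integral\<^sup>N M G" .
qed

lemma continuous_on_atLeastI:
  fixes f :: "real \<Rightarrow> 'b::topological_space"
  assumes "\<And>T. a \<le> T \<Longrightarrow> continuous_on {a..T} f"
  shows "continuous_on {a..} f"
  unfolding continuous_on_eq_continuous_within
proof
  fix u assume u: "u \<in> {a..}"
  have "at u within {a..} = at u within {a..u+1}"
    by (rule at_within_nhd[of _ "{u - 1<..<u + 1}"]) auto
  then show "continuous (at u within {a..}) f"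
    using assms[of "u + 1"] u by (auto simp: continuous_on_eq_continuous_within)
qed

lemma ito_integral_cong:
  assumes "ito_integral M t0 F W \<Phi> I" and "\<And>t \<omega>. t0 \<le> t \<Longrightarrow> \<Psi> t \<omega> = \<Phi> t \<omega>"
  shows "ito_integral M t0 F W \<Psi> I"
proof -
  have "(\<integral>\<^sup>+ t\<in>{t0..T}. hs_norm_sq (E t - \<Psi> t \<omega>) \<partial>lborel)
      = (\<integral>\<^sup>+ t\<in>{t0..T}. hs_norm_sq (E t - \<Phi> t \<omega>) \<partial>lborel)" for T \<omega> E
    by (intro nn_integral_cong) (use assms(2) in \<open>auto simp: indicator_def\<close>)
  then show ?thesis using assms(1) unfolding ito_integral_def by simp
qed

lemma hs_norm_sq_compose_le:
  assumes "\<And>x. norm (blinfun_apply L x) \<le> norm x"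
  shows "hs_norm_sq (L o\<^sub>L T) \<le> hs_norm_sq T"
  by (rule hs_norm_sq_mono) (simp add: assms)

text \<open>One estimate for two tasks: if \<open>e\<close> is the error of frozen weights it gives
  convergence of the integrands, and if \<open>e\<close> bounds the new drift it gives
  integrability. \<open>K\<close> bounds the Jacobian of the clock.\<close>

lemma nn_integral_affine_time_change_le:
  fixes G :: "real \<Rightarrow> ennreal"
  assumes \<theta>: "\<And>u. u \<in> {a..b} \<Longrightarrow> (\<theta> has_real_derivative \<theta>' u) (at u)"
    and cont: "continuous_on {a..b} \<theta>'"
    and K: "\<And>u. u \<in> {a..b} \<Longrightarrow> 0 \<le> \<theta>' u" "\<And>u. u \<in> {a..b} \<Longrightarrow> \<theta>' u \<le> K" "0 \<le> K"
    and inv: "\<And>u. u \<in> {a..b} \<Longrightarrow> \<phi> (\<theta> u) = u" and ab: "a \<le> b" "\<theta> a \<le> \<theta> b"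
    and c: "0 \<le> e" "0 < c"
    and H: "\<And>s. s \<in> {\<theta> a..\<theta> b} \<Longrightarrow> H s \<le> ennreal e + ennreal c * G (\<phi> s)"
  shows "(\<integral>\<^sup>+s\<in>{\<theta> a..\<theta> b}. H s \<partial>lborel)
    \<le> ennreal (e * (\<theta> b - \<theta> a)) + ennreal (K * c) * (\<integral>\<^sup>+u\<in>{a..b}. G u \<partial>lborel)"
proof -
  let ?J = "{\<theta> a..\<theta> b}"
  have "(\<integral>\<^sup>+s\<in>?J. H s \<partial>lborel)
      \<le> (\<integral>\<^sup>+s. ennreal e * indicator ?J s + ennreal c * G (\<phi> s) * indicator ?J s \<partial>lborel)"
    by (intro nn_integral_mono) (use H in \<open>auto simp: indicator_def\<close>)
  also have "\<dots> \<le> (\<integral>\<^sup>+s. ennreal e * indicator ?J s \<partial>lborel) + (\<integral>\<^sup>+s\<in>?J. ennreal c * G (\<phi> s) \<partial>lborel)"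
    by (rule nn_integral_add_le) (auto simp: indicator_def)
  also have "(\<integral>\<^sup>+s. ennreal e * indicator ?J s \<partial>lborel) = ennreal (e * (\<theta> b - \<theta> a))"
    using ab c by (subst nn_integral_cmult_indicator) (auto simp: ennreal_mult)
  also have "(\<integral>\<^sup>+s\<in>?J. ennreal c * G (\<phi> s) \<partial>lborel)
      \<le> ennreal K * (\<integral>\<^sup>+u\<in>{a..b}. ennreal c * G u \<partial>lborel)"
    by (rule nn_integral_time_change_le[where G="\<lambda>u. ennreal c * G u", OF \<theta> cont K(1,2) inv ab(1)])
  also have "(\<integral>\<^sup>+u\<in>{a..b}. ennreal c * G u \<partial>lborel) \<le> ennreal c * (\<integral>\<^sup>+u\<in>{a..b}. G u \<partial>lborel)"
    using nn_integral_cmult_le[OF c(2), where G="\<lambda>u. G u * indicator {a..b} u" and M=lborel] by (simp add: mult.assoc)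
  finally show ?thesis
    using K(3) c by (simp add: ennreal_mult mult.assoc add_left_mono mult_left_mono)
qed

text \<open>Endomorphisms of the product rather than maps to its factors, so that they can serve as
  \<open>L1\<close> and \<open>L2\<close> in \<open>ito_integral_time_change\<close>.\<close>

lift_definition proj_first :: "('a::real_normed_vector \<times> 'b::real_normed_vector) \<Rightarrow>\<^sub>L ('a \<times> 'b)"
  is "\<lambda>x. (fst x, 0)"
  by (intro bounded_linear_Pair bounded_linear_zero bounded_linear_fst)

lift_definition proj_second :: "('a::real_normed_vector \<times> 'b::real_normed_vector) \<Rightarrow>\<^sub>L ('a \<times> 'b)"
  is "\<lambda>x. (0, snd x)"
  by (intro bounded_linear_Pair bounded_linear_zero bounded_linear_snd)

lemma norm_proj_le: "norm (blinfun_apply proj_first x) \<le> norm x" "norm (blinfun_apply proj_second x) \<le> norm x"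
  by (cases x; simp add: proj_first.rep_eq proj_second.rep_eq norm_Pair)+

lemma proj_in_second: "proj_first o\<^sub>L in_second T = 0" "proj_second o\<^sub>L in_second T = in_second T"
  by (auto intro!: blinfun_eqI simp: proj_first.rep_eq proj_second.rep_eq in_second.rep_eq zero_prod_def)

lemma in_second_scaleR: "in_second (c *\<^sub>R T) = c *\<^sub>R in_second T"
  by (auto intro!: blinfun_eqI simp: in_second.rep_eq blinfun.scaleR_left)

context time_change
begin

text \<open>The constant integrand \<open>h\<close>, refined with the weight \<open>g\<close>, has
  elementary integrals that converge to the noise on almost every path; a diagonal choice of the
  mesh turns this into one approximating sequence.\<close>

lemma time_changed_noise_noise:
  fixes W :: "real \<Rightarrow> 'h::{real_inner, banach, second_countable_topology} \<Rightarrow> 'w \<Rightarrow> real"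
  assumes M: "prob_space M" and F: "filtration_from M a F" and W: "brownian_motion_from M a F C W"
  shows "time_changed_noise M a F W \<theta> (noise W)"
  unfolding time_changed_noise_def
proof
  fix h :: 'h
  have Wm: "W t h \<in> borel_measurable (F t)" if "a \<le> t" for t h
    using W that unfolding brownian_motion_from_def by blast
  have AE: "AE \<omega> in M. continuous_on {a..} (\<lambda>t. W t h \<omega>)"
    using W unfolding brownian_motion_from_def by blast
  \<comment> \<open>An elementary process has bounded support, so the interval grows with
    \<open>n\<close>; on [a, T] it is long enough as soon as T - a \<le> n.\<close>
  define E :: "nat \<Rightarrow> ('w, 'h, real) elementary" where "E n = [(a, a + real n, \<lambda>_. 1, h, 1)]" for n
  have EP: "elementary_process M a F (E n)" for n by (simp add: E_def image_constant_conv)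
  have "\<exists>K. \<forall>k\<ge>K. \<forall>t. \<forall>\<omega>\<in>space M. hs_norm_sq (elementary_value (refine g k (E n)) t \<omega>
      - g t *\<^sub>R elementary_value (E n) t \<omega>) \<le> ennreal ((1/2)^n)" for n
    using refine_value_error[OF C1_g EP, of "(1/2)^n" n] by (simp add: eventually_sequentially)
  then obtain K where K: "\<And>n k t \<omega>. K n \<le> k \<Longrightarrow> \<omega> \<in> space M \<Longrightarrow>
      hs_norm_sq (elementary_value (refine g k (E n)) t \<omega> - g t *\<^sub>R elementary_value (E n) t \<omega>)
        \<le> ennreal ((1/2)^n)" by metis
  have RP: "elementary_process M a F (refine g k (E n))" for k n
    by (rule elementary_process_refine[OF F EP])
  have dirs: "directions (refine g k (E n)) \<subseteq> {h}" for k n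
    using directions_refine[of g k "E n"] by (simp add: E_def)
  let ?N = "\<lambda>u. noise W (\<theta> u)"
  have diag: "\<exists>\<nu>. (\<forall>n. K n \<le> \<nu> n) \<and> (AE \<omega> in M. \<forall>T\<ge>a.
     uniform_limit {a..T} (\<lambda>n s. elementary_integral W (refine g (\<nu> n) (E n)) s \<omega>) (\<lambda>s. ?N s h \<omega>) sequentially)"
  proof (rule diagonal_uniform_limit[OF M, where B = "\<lambda>n s \<omega>. elementary_integral ?N (E n) s \<omega>"])
    show "elementary_integral W (refine g k (E n)) s \<in> borel_measurable M" if "a \<le> s" for n k s
      by (rule elementary_integral_measurable[OF F Wm RP that])
    show "AE \<omega> in M. \<forall>n k. continuous_on {a..} (\<lambda>s. elementary_integral W (refine g k (E n)) s \<omega>)"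
      using AE by eventually_elim (intro allI elementary_integral_continuous[OF RP], use dirs in blast)
    show "AE \<omega> in M. \<forall>n. uniform_limit {a..} (\<lambda>k s. elementary_integral W (refine g k (E n)) s \<omega>)
        (\<lambda>s. elementary_integral ?N (E n) s \<omega>) sequentially"
      using AE
    proof eventually_elim
      case (elim \<omega>)
      show ?case
      proof
        fix n
        show "uniform_limit {a..} (\<lambda>k s. elementary_integral W (refine g k (E n)) s \<omega>)
          (\<lambda>s. elementary_integral ?N (E n) s \<omega>) sequentially"
          by (rule uniform_limit_on_subset[OF refine_integral_uniform_limit[OF C1_g EP]])
             (use elim path_integral_noise[of W h \<omega>, OF elim] in \<open>auto simp: E_def\<close>)
      qed
    qed
    show "AE \<omega> in M. \<forall>T\<ge>a. uniform_limit {a..T} (\<lambda>n s. elementary_integral ?N (E n) s \<omega>)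
        (\<lambda>s. ?N s h \<omega>) sequentially"
      using AE
    proof eventually_elim
      case (elim \<omega>)
      have 0: "noise W a' h \<omega> = 0" by (rule noise_start[of W h \<omega>, OF elim])
      show ?case
      proof (intro allI impI uniform_limitI)
        fix T e :: real assume T: "a \<le> T" and e: "e > 0"
        have "\<forall>\<^sub>F n in sequentially. T - a \<le> real n" by (rule eventually_at_top_linorderI[of "nat \<lceil>T - a\<rceil>"]) linarith
        then show "\<forall>\<^sub>F n in sequentially. \<forall>s\<in>{a..T}. dist (elementary_integral ?N (E n) s \<omega>) (?N s h \<omega>) < e"
          by eventually_elim (use e 0 start in \<open>auto simp: E_def min_absorb1 min_absorb2\<close>)
      qed
    qed
  qed
  then obtain \<nu> where \<nu>: "\<And>n. K n \<le> \<nu> n" "AE \<omega> in M. \<forall>T\<ge>a.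
     uniform_limit {a..T} (\<lambda>n s. elementary_integral W (refine g (\<nu> n) (E n)) s \<omega>) (\<lambda>s. ?N s h \<omega>) sequentially"
    by blast
  have r1: "rank_one h (1::real) = blinfun_inner_right h"
    by (rule blinfun_eqI) (simp add: rank_one.rep_eq)
  have L2: "(\<lambda>n. \<integral>\<^sup>+ t\<in>{a..T}. hs_norm_sq (elementary_value (refine g (\<nu> n) (E n)) t \<omega>
      - sqrt (deriv \<theta> t) *\<^sub>R blinfun_inner_right h) \<partial>lborel) \<longlonglongrightarrow> 0"
    if \<omega>: "\<omega> \<in> space M" and T: "a \<le> T" for \<omega> T
  proof (rule tendsto_sandwich[OF _ _ tendsto_const])
    show "(\<lambda>n. ennreal ((1/2)^n * (T - a))) \<longlonglongrightarrow> 0"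
    proof -
      have "(\<lambda>n. (1/2::real)^n * (T - a)) \<longlonglongrightarrow> 0 * (T - a)"
        by (intro tendsto_mult LIMSEQ_power_zero tendsto_const) simp
      then show ?thesis using tendsto_ennrealI by fastforce
    qed
    have "\<forall>\<^sub>F n in sequentially. T - a \<le> real n" by (rule eventually_at_top_linorderI[of "nat \<lceil>T - a\<rceil>"]) linarith
    then show "\<forall>\<^sub>F n in sequentially. (\<integral>\<^sup>+ t\<in>{a..T}. hs_norm_sq (elementary_value (refine g (\<nu> n) (E n)) t \<omega>
      - sqrt (deriv \<theta> t) *\<^sub>R blinfun_inner_right h) \<partial>lborel) \<le> ennreal ((1/2)^n * (T - a))"
    proof eventually_elim
      case (elim n)
      have "(\<integral>\<^sup>+ t\<in>{a..T}. hs_norm_sq (elementary_value (refine g (\<nu> n) (E n)) t \<omega>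
          - sqrt (deriv \<theta> t) *\<^sub>R blinfun_inner_right h) \<partial>lborel)
        \<le> (\<integral>\<^sup>+ t. ennreal ((1/2)^n) * indicator {a..T} t \<partial>lborel)"
      proof (rule nn_integral_mono_AE)
        \<comment> \<open>The interval of \<open>E n\<close> is open on the left, so the
          approximation vanishes at \<open>a\<close>; this single point is discarded as a null
          set.\<close>
        show "AE t in lborel. hs_norm_sq (elementary_value (refine g (\<nu> n) (E n)) t \<omega>
          - sqrt (deriv \<theta> t) *\<^sub>R blinfun_inner_right h) * indicator {a..T} t \<le> ennreal ((1/2)^n) * indicator {a..T} t"
          using AE_lborel_singleton[of a]
        proof eventually_elim
          case (elim t)
          show ?case
          proof (cases "t \<in> {a..T}")
            case True
            have "deriv \<theta> t = \<theta>' t" using True by (intro DERIV_imp_deriv deriv_at) auto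
            then have "sqrt (deriv \<theta> t) *\<^sub>R blinfun_inner_right h = g t *\<^sub>R elementary_value (E n) t \<omega>"
              using True elim \<open>T - a \<le> real n\<close> by (auto simp: E_def r1 g_def)
            then show ?thesis using K[OF \<nu>(1) \<omega>] True by simp
          qed simp
        qed
      qed
      also have "\<dots> = ennreal ((1/2)^n * (T - a))"
        using T by (subst nn_integral_cmult_indicator) (auto simp: ennreal_mult)
      finally show ?case .
    qed
  qed simp
  show "ito_integral M a F W (\<lambda>u \<omega>. sqrt (deriv \<theta> u) *\<^sub>R blinfun_inner_right h) (\<lambda>u. noise W (\<theta> u) h)"
    unfolding ito_integral_def
  proof (intro exI[of _ "\<lambda>n. refine g (\<nu> n) (E n)"] conjI allI RP \<nu>(2))
    show "AE \<omega> in M. \<forall>T\<ge>a. (\<lambda>n. \<integral>\<^sup>+ t\<in>{a..T}. hs_norm_sq (elementary_value (refine g (\<nu> n) (E n)) t \<omega>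
      - sqrt (deriv \<theta> t) *\<^sub>R blinfun_inner_right h) \<partial>lborel) \<longlonglongrightarrow> 0"
      using L2 by (intro AE_I2) simp
  qed
qed

end

section \<open>Time change of the stochastic integral\<close>

context time_change
begin

text \<open>Reading dW' = g dW backwards: the weight on the new clock that recovers dW from the new
  noise.\<close>

definition inv_g :: "real \<Rightarrow> real" where "inv_g s = 1 / g (\<phi> s)"
definition inv_g' :: "real \<Rightarrow> real" where "inv_g' s = - (g' (\<phi> s) * (1 / \<theta>' (\<phi> s))) / (g (\<phi> s))\<^sup>2"

lemma C1_inv_g: "C1_from a' inv_g inv_g'"
  unfolding inv_g_def[abs_def] inv_g'_def[abs_def]
  by (rule C1_from_inverse[OF C1_from_compose[OF C1_g C1_\<phi> \<phi>(1)]]) (use g_pos \<phi>(1) in force)+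

text \<open>The condition \<open>pm\<close> says that weighting the new noise by \<open>p1\<close>
  or \<open>p2\<close> amounts to weighting \<open>W\<close> by \<open>m1\<close> or
  \<open>m2\<close> on the old clock. An elementary integral against the weighted noise is therefore
  a pathwise integral of \<open>m1\<close> or \<open>m2\<close> against an elementary integral for
  \<open>W\<close>, and the latter converge to \<open>I\<close>. Two summands are carried so that
  the two components of the state can be weighted differently.\<close>

lemma ito_integral_time_change:
  fixes W :: "real \<Rightarrow> 'h::{real_inner, banach, second_countable_topology} \<Rightarrow> 'w \<Rightarrow> real"
    and \<Phi> :: "real \<Rightarrow> 'w \<Rightarrow> 'h \<Rightarrow>\<^sub>L 'k::{banach, second_countable_topology}"
    and L1 L2 :: "'k \<Rightarrow>\<^sub>L 'k"
  assumes M: "prob_space M" and F: "filtration_from M a F" and W: "brownian_motion_from M a F C W"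
    and I: "ito_integral M a F W \<Phi> I"
    and p1: "C1_from a' p1 p1'" and p2: "C1_from a' p2 p2'"
    and m1: "C1_from a m1 m1'" and m2: "C1_from a m2 m2'"
    and pm: "\<And>u. a \<le> u \<Longrightarrow> p1 (\<theta> u) * g u = m1 u" "\<And>u. a \<le> u \<Longrightarrow> p2 (\<theta> u) * g u = m2 u"
    and L: "\<And>x. norm (L1 x) \<le> norm x" "\<And>x. norm (L2 x) \<le> norm x"
  shows "\<exists>I'. ito_integral M a' (\<lambda>s. F (\<phi> s)) (noise W)
      (\<lambda>s \<omega>. p1 s *\<^sub>R (L1 o\<^sub>L \<Phi> (\<phi> s) \<omega>) + p2 s *\<^sub>R (L2 o\<^sub>L \<Phi> (\<phi> s) \<omega>)) I' \<and>
    (AE \<omega> in M. continuous_on {a..} (\<lambda>u. I u \<omega>) \<and>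
      (\<exists>y1 y2. path_integral a m1 m1' (\<lambda>u. L1 (I u \<omega>)) y1 \<and> path_integral a m2 m2' (\<lambda>u. L2 (I u \<omega>)) y2 \<and>
         (\<forall>u\<ge>a. I' (\<theta> u) \<omega> = y1 u + y2 u)))"
proof -
  have Wm: "W t h \<in> borel_measurable (F t)" if "a \<le> t" for t h
    using W that unfolding brownian_motion_from_def by blast
  have AEW: "AE \<omega> in M. continuous_on {a..} (\<lambda>t. W t h \<omega>)" for h
    using W unfolding brownian_motion_from_def by blast
  let ?F = "\<lambda>s. F (\<phi> s)" and ?N = "noise W"
  have F': "filtration_from M a' ?F" by (rule filtration_from_time_change[OF F])
  have Nm: "?N s h \<in> borel_measurable (?F s)" if "a' \<le> s" for s h
    by (rule noise_measurable[of M F W h, OF F Wm that])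
  obtain S where S: "\<And>n. elementary_process M a F (S n)"
    and SL: "AE \<omega> in M. \<forall>T\<ge>a. (\<lambda>n. \<integral>\<^sup>+ t\<in>{a..T}. hs_norm_sq (elementary_value (S n) t \<omega> - \<Phi> t \<omega>) \<partial>lborel) \<longlonglongrightarrow> 0"
    and SI: "AE \<omega> in M. \<forall>T\<ge>a. uniform_limit {a..T} (\<lambda>n t. elementary_integral W (S n) t \<omega>) (\<lambda>t. I t \<omega>) sequentially"
    using I unfolding ito_integral_def by blast
  \<comment> \<open>One null set for the directions of the whole approximating sequence.\<close>
  have AES: "AE \<omega> in M. \<forall>n. \<forall>h\<in>directions (S n). continuous_on {a..} (\<lambda>t. W t h \<omega>)"
    unfolding AE_all_countable
    by (intro allI AE_ball_countable[THEN iffD2] ballI AEW countable_finite finite_directions)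
  define R1 where "R1 n k = refine p1 k (retime \<theta> L1 (S n))" for n k
  define R2 where "R2 n k = refine p2 k (retime \<theta> L2 (S n))" for n k
  have retP: "elementary_process M a' ?F (retime \<theta> L (S n))" for L :: "'k \<Rightarrow>\<^sub>L 'k" and n
    using elementary_process_retime[where F'="?F" and L=L and \<theta>=\<theta>, OF S mono] \<phi>(3) start by simp
  have RP: "elementary_process M a' ?F (R1 n k @ R2 n k)" for n k
    unfolding R1_def R2_def by (simp add: elementary_process_refine[OF F' retP])
  have "\<exists>K. \<forall>k\<ge>K. \<forall>t. \<forall>\<omega>\<in>space M.
      hs_norm_sq (elementary_value (R1 n k) t \<omega> - p1 t *\<^sub>R elementary_value (retime \<theta> L1 (S n)) t \<omega>) \<le> ennreal ((1/2)^n) \<and>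
      hs_norm_sq (elementary_value (R2 n k) t \<omega> - p2 t *\<^sub>R elementary_value (retime \<theta> L2 (S n)) t \<omega>) \<le> ennreal ((1/2)^n)" for n
    using eventually_conj[OF refine_value_error[OF p1 retP[of L1 n], of "(1/2)^n"]
      refine_value_error[OF p2 retP[of L2 n], of "(1/2)^n"]]
    unfolding R1_def R2_def by (simp add: eventually_sequentially) blast
  then obtain K where K: "\<And>n k t \<omega>. K n \<le> k \<Longrightarrow> \<omega> \<in> space M \<Longrightarrow>
      hs_norm_sq (elementary_value (R1 n k) t \<omega> - p1 t *\<^sub>R elementary_value (retime \<theta> L1 (S n)) t \<omega>) \<le> ennreal ((1/2)^n)"
     "\<And>n k t \<omega>. K n \<le> k \<Longrightarrow> \<omega> \<in> space M \<Longrightarrow>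
      hs_norm_sq (elementary_value (R2 n k) t \<omega> - p2 t *\<^sub>R elementary_value (retime \<theta> L2 (S n)) t \<omega>) \<le> ennreal ((1/2)^n)"
    by metis
  \<comment> \<open>\<open>V\<close> and \<open>J\<close> are written by the integration by parts
    formula for every \<omega>. On continuous paths they are the path integrals of \<open>p\<close>
    against the noise and of \<open>m\<close> against the image of \<open>I\<close> under
    \<open>L\<close>.\<close>
  define V where "V p p' s h \<omega> = p s *\<^sub>R ?N s h \<omega> - p a' *\<^sub>R ?N a' h \<omega> - integral {a'..s} (\<lambda>r. p' r *\<^sub>R ?N r h \<omega>)"
    for p p' :: "real \<Rightarrow> real" and s h \<omega>
  define J where "J m m' L u \<omega> = m u *\<^sub>R blinfun_apply L (I u \<omega>) - m a *\<^sub>R blinfun_apply L (I a \<omega>)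
      - integral {a..u} (\<lambda>r. m' r *\<^sub>R blinfun_apply L (I r \<omega>))"
    for m m' :: "real \<Rightarrow> real" and L :: "'k \<Rightarrow>\<^sub>L 'k" and u \<omega>
  define I' where "I' s \<omega> = J m1 m1' L1 (\<phi> s) \<omega> + J m2 m2' L2 (\<phi> s) \<omega>" for s \<omega>
  have Vpath: "path_integral a' p p' (\<lambda>s. ?N s h \<omega>) (\<lambda>s. V p p' s h \<omega>)"
    if "C1_from a' p p'" "continuous_on {a..} (\<lambda>t. W t h \<omega>)" for p p' h \<omega>
    unfolding V_def by (rule path_integral_exists[OF that(1) noise_continuous[of W h \<omega>, OF that(2)]])
  \<comment> \<open>Substitution brings the integral of \<open>p\<close> back to the old clock, and
    associativity merges it with the weight \<open>g\<close> inside the noise.\<close>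
  have Vpath': "path_integral a m m' (\<lambda>u. W u h \<omega>) (\<lambda>u. V p p' (\<theta> u) h \<omega>)"
    if p: "C1_from a' p p'" and m: "C1_from a m m'" and c: "continuous_on {a..} (\<lambda>t. W t h \<omega>)"
      and pm: "\<And>u. a \<le> u \<Longrightarrow> p (\<theta> u) * g u = m u" for p p' m m' h \<omega>
  proof (rule path_integral_cong_C1[OF _ _ m pm])
    have C: "C1_from a (\<lambda>u. p (\<theta> u)) (\<lambda>u. p' (\<theta> u) * \<theta>' u)"
      by (rule C1_from_compose[OF p C1_\<theta> range])
    show "path_integral a (\<lambda>u. p (\<theta> u) * g u) (\<lambda>u. p' (\<theta> u) * \<theta>' u * g u + p (\<theta> u) * g' u)
      (\<lambda>u. W u h \<omega>) (\<lambda>u. V p p' (\<theta> u) h \<omega>)"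
      by (rule path_integral_chain[OF C path_integral_noise[of W h \<omega>, OF c]
           path_integral_subst[OF C1_\<theta> start range Vpath[OF p c]]])
    show "C1_from a (\<lambda>u. p (\<theta> u) * g u) (\<lambda>u. p' (\<theta> u) * \<theta>' u * g u + p (\<theta> u) * g' u)"
      by (rule C1_from_mult[OF C1_g C])
  qed
  have Icont: "AE \<omega> in M. continuous_on {a..} (\<lambda>u. I u \<omega>)"
    using AES SI
  proof eventually_elim
    case (elim \<omega>)
    show ?case
    proof (rule continuous_on_atLeastI)
      fix T assume T: "a \<le> T"
      show "continuous_on {a..T} (\<lambda>u. I u \<omega>)"
      proof (rule uniform_limit_theorem)
        show "uniform_limit {a..T} (\<lambda>n t. elementary_integral W (S n) t \<omega>) (\<lambda>t. I t \<omega>) sequentially"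
          using elim T by simp
        show "\<forall>\<^sub>F n in sequentially. continuous_on {a..T} (\<lambda>t. elementary_integral W (S n) t \<omega>)"
          by (intro always_eventually allI continuous_on_subset[OF elementary_integral_continuous[OF S]])
             (use elim in auto)
      qed simp
    qed
  qed
  have Jpath: "path_integral a m m' (\<lambda>u. blinfun_apply L (I u \<omega>)) (\<lambda>u. J m m' L u \<omega>)"
    if "C1_from a m m'" "continuous_on {a..} (\<lambda>u. I u \<omega>)" for m m' L \<omega>
    unfolding J_def
    by (rule path_integral_exists[OF that(1) bounded_linear.continuous_on[OF blinfun.bounded_linear_right that(2)]])
  have Jlim: "uniform_limit {a..T} (\<lambda>n u. blinfun_apply L (elementary_integral (\<lambda>u. V p p' (\<theta> u)) (S n) u \<omega>))
      (\<lambda>u. J m m' L u \<omega>) sequentially"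
    if p: "C1_from a' p p'" and m: "C1_from a m m'" and pm: "\<And>u. a \<le> u \<Longrightarrow> p (\<theta> u) * g u = m u"
      and c: "\<forall>n. \<forall>h\<in>directions (S n). continuous_on {a..} (\<lambda>t. W t h \<omega>)" "continuous_on {a..} (\<lambda>u. I u \<omega>)"
      and u: "uniform_limit {a..T} (\<lambda>n t. elementary_integral W (S n) t \<omega>) (\<lambda>t. I t \<omega>) sequentially"
    for p p' m m' L T \<omega>
    by (rule path_integral_uniform_limit[OF m _ Jpath[OF m c(2)]
          bounded_linear.uniform_limit[OF blinfun.bounded_linear_right u]],
        rule path_integral_linear[OF blinfun.bounded_linear_right],
        rule path_integral_elementary_integral[OF m S], rule Vpath'[OF p m _ pm])
       (use c(1) in auto)
  \<comment> \<open>The inner limit in the mesh replaces frozen weights by \<open>V\<close>, the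
    outer limit in \<open>n\<close> replaces \<open>S n\<close> by \<Phi>.\<close>
  have "\<exists>\<nu>. (\<forall>n. K n \<le> \<nu> n) \<and> (AE \<omega> in M. \<forall>T\<ge>a'.
     uniform_limit {a'..T} (\<lambda>n s. elementary_integral ?N (R1 n (\<nu> n) @ R2 n (\<nu> n)) s \<omega>) (\<lambda>s. I' s \<omega>) sequentially)"
  proof (rule diagonal_uniform_limit[OF M, where
        B = "\<lambda>n s \<omega>. elementary_integral (V p1 p1') (retime \<theta> L1 (S n)) s \<omega>
           + elementary_integral (V p2 p2') (retime \<theta> L2 (S n)) s \<omega>"])
    show "elementary_integral ?N (R1 n k @ R2 n k) s \<in> borel_measurable M" if "a' \<le> s" for n k s
      by (rule elementary_integral_measurable[OF F' Nm RP that])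
    have dirs: "directions (R1 n k @ R2 n k) \<subseteq> directions (S n)" for n k
      using directions_refine[of p1 k "retime \<theta> L1 (S n)"] directions_refine[of p2 k "retime \<theta> L2 (S n)"]
      by (simp add: R1_def R2_def)
    show "AE \<omega> in M. \<forall>n k. continuous_on {a'..} (\<lambda>s. elementary_integral ?N (R1 n k @ R2 n k) s \<omega>)"
      using AES
    proof eventually_elim
      case (elim \<omega>)
      show ?case
      proof (intro allI elementary_integral_continuous[OF RP])
        fix n k h assume "h \<in> directions (R1 n k @ R2 n k)"
        then have c: "continuous_on {a..} (\<lambda>t. W t h \<omega>)" using dirs elim by blast
        show "continuous_on {a'..} (\<lambda>s. ?N s h \<omega>)" by (rule noise_continuous[of W h \<omega>, OF c])
      qed
    qed
    show "AE \<omega> in M. \<forall>n. uniform_limit {a'..} (\<lambda>k s. elementary_integral ?N (R1 n k @ R2 n k) s \<omega>)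
      (\<lambda>s. elementary_integral (V p1 p1') (retime \<theta> L1 (S n)) s \<omega>
           + elementary_integral (V p2 p2') (retime \<theta> L2 (S n)) s \<omega>) sequentially"
      using AES
    proof eventually_elim
      case (elim \<omega>)
      have "uniform_limit UNIV (\<lambda>k s. elementary_integral ?N (refine p k (retime \<theta> L (S n))) s \<omega>)
         (\<lambda>s. elementary_integral (V p p') (retime \<theta> L (S n)) s \<omega>) sequentially"
        if p: "C1_from a' p p'" for p p' n and L :: "'k \<Rightarrow>\<^sub>L 'k"
      proof (rule refine_integral_uniform_limit[OF p retP])
        fix h assume "h \<in> directions (retime \<theta> L (S n))"
        then have c: "continuous_on {a..} (\<lambda>t. W t h \<omega>)" using elim by simp
        show "continuous_on {a'..} (\<lambda>s. ?N s h \<omega>)" by (rule noise_continuous[of W h \<omega>, OF c])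
        show "path_integral a' p p' (\<lambda>s. ?N s h \<omega>) (\<lambda>s. V p p' s h \<omega>)" by (rule Vpath[OF p c])
      qed
      note lims = uniform_limit_on_subset[OF this[OF p1] subset_UNIV] uniform_limit_on_subset[OF this[OF p2] subset_UNIV]
      show ?case
        unfolding elementary_integral_append R1_def R2_def
        by (intro allI uniform_limit_add lims)
    qed
    show "AE \<omega> in M. \<forall>T\<ge>a'. uniform_limit {a'..T} (\<lambda>n s. elementary_integral (V p1 p1') (retime \<theta> L1 (S n)) s \<omega>
           + elementary_integral (V p2 p2') (retime \<theta> L2 (S n)) s \<omega>) (\<lambda>s. I' s \<omega>) sequentially"
      using AES SI Icont
    proof eventually_elim
      case (elim \<omega>)
      show ?case
      proof (intro allI impI)
        fix T assume T: "a' \<le> T"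
        let ?U = "\<phi> T"
        have U: "a \<le> ?U" using \<phi>(1)[OF T] .
        have u: "uniform_limit {a..?U} (\<lambda>n t. elementary_integral W (S n) t \<omega>) (\<lambda>t. I t \<omega>) sequentially"
          using elim(2) U by simp
        have lim: "uniform_limit {a..?U}
           (\<lambda>n u. blinfun_apply L1 (elementary_integral (\<lambda>u. V p1 p1' (\<theta> u)) (S n) u \<omega>)
             + blinfun_apply L2 (elementary_integral (\<lambda>u. V p2 p2' (\<theta> u)) (S n) u \<omega>))
           (\<lambda>u. J m1 m1' L1 u \<omega> + J m2 m2' L2 u \<omega>) sequentially"
          by (intro uniform_limit_add Jlim[OF p1 m1 pm(1) elim(1,3) u] Jlim[OF p2 m2 pm(2) elim(1,3) u])
        show "uniform_limit {a'..T} (\<lambda>n s. elementary_integral (V p1 p1') (retime \<theta> L1 (S n)) s \<omega>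
           + elementary_integral (V p2 p2') (retime \<theta> L2 (S n)) s \<omega>) (\<lambda>s. I' s \<omega>) sequentially"
        proof (rule uniform_limitI)
          fix e :: real assume "e > 0"
          from uniform_limitD[OF lim this]
          show "\<forall>\<^sub>F n in sequentially. \<forall>s\<in>{a'..T}. dist (elementary_integral (V p1 p1') (retime \<theta> L1 (S n)) s \<omega>
             + elementary_integral (V p2 p2') (retime \<theta> L2 (S n)) s \<omega>) (I' s \<omega>) < e"
          proof eventually_elim
            case (elim n)
            show ?case
            proof
              fix s assume s: "s \<in> {a'..T}"
              then have u: "\<phi> s \<in> {a..?U}" "\<theta> (\<phi> s) = s" using \<phi>(1,2) \<phi>_mono by auto
              have "elementary_integral (V p p') (retime \<theta> L (S n)) s \<omega>
                 = blinfun_apply L (elementary_integral (\<lambda>u. V p p' (\<theta> u)) (S n) (\<phi> s) \<omega>)" for p p' and L :: "'k \<Rightarrow>\<^sub>L 'k"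
              proof -
                have "elementary_integral (V p p') (retime \<theta> L (S n)) (\<theta> (\<phi> s)) \<omega>
                   = blinfun_apply L (elementary_integral (\<lambda>u. V p p' (\<theta> u)) (S n) (\<phi> s) \<omega>)"
                  by (rule elementary_integral_retime[OF S _ mono]) (use u in auto)
                then show ?thesis unfolding u(2) .
              qed
              then show "dist (elementary_integral (V p1 p1') (retime \<theta> L1 (S n)) s \<omega>
                 + elementary_integral (V p2 p2') (retime \<theta> L2 (S n)) s \<omega>) (I' s \<omega>) < e"
                using bspec[OF elim u(1)] by (simp only: I'_def)
            qed
          qed
        qed
      qed
    qed
  qed
  then obtain \<nu> where \<nu>: "\<And>n. K n \<le> \<nu> n" and \<nu>I: "AE \<omega> in M. \<forall>T\<ge>a'.
     uniform_limit {a'..T} (\<lambda>n s. elementary_integral ?N (R1 n (\<nu> n) @ R2 n (\<nu> n)) s \<omega>) (\<lambda>s. I' s \<omega>) sequentially"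
    by blast
  let ?\<Phi> = "\<lambda>s \<omega>. p1 s *\<^sub>R (L1 o\<^sub>L \<Phi> (\<phi> s) \<omega>) + p2 s *\<^sub>R (L2 o\<^sub>L \<Phi> (\<phi> s) \<omega>)"
  let ?v = "\<lambda>n s \<omega>. elementary_value (R1 n (\<nu> n) @ R2 n (\<nu> n)) s \<omega>"
  have L2: "(\<lambda>n. \<integral>\<^sup>+ s\<in>{a'..T}. hs_norm_sq (?v n s \<omega> - ?\<Phi> s \<omega>) \<partial>lborel) \<longlonglongrightarrow> 0"
    if \<omega>: "\<omega> \<in> space M" and T: "a' \<le> T"
      and lim: "\<forall>T\<ge>a. (\<lambda>n. \<integral>\<^sup>+ t\<in>{a..T}. hs_norm_sq (elementary_value (S n) t \<omega> - \<Phi> t \<omega>) \<partial>lborel) \<longlonglongrightarrow> 0"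
    for \<omega> T
  proof -
    obtain P1 where P1: "P1 > 0" "\<And>s. a' \<le> s \<Longrightarrow> s \<le> T \<Longrightarrow> \<bar>p1 s\<bar> \<le> P1" using C1_from_bound[OF p1] by metis
    obtain P2 where P2: "P2 > 0" "\<And>s. a' \<le> s \<Longrightarrow> s \<le> T \<Longrightarrow> \<bar>p2 s\<bar> \<le> P2" using C1_from_bound[OF p2] by metis
    \<comment> \<open>Each weighted component contributes P^2, doubled when the two are added and
      once more when the freezing error is added. The same doublings turn the two errors (1/2)^n
      into 8 (1/2)^n.\<close>
    define c where "c = 4 * P1\<^sup>2 + 4 * P2\<^sup>2"
    have c: "c > 0" using P1 P2 by (simp add: c_def add_pos_pos)
    let ?U = "\<phi> T"
    have U: "a \<le> ?U" "\<theta> ?U = T" using \<phi> T by auto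
    obtain Q where Q: "Q > 0" "\<And>u. a \<le> u \<Longrightarrow> u \<le> ?U \<Longrightarrow> \<bar>\<theta>' u\<bar> \<le> Q" using C1_from_bound[OF C1_\<theta>'] by metis
    let ?G = "\<lambda>n u. hs_norm_sq (elementary_value (S n) u \<omega> - \<Phi> u \<omega>)"
    have pt: "hs_norm_sq (?v n s \<omega> - ?\<Phi> s \<omega>) \<le> ennreal (8 * (1/2)^n) + ennreal c * ?G n (\<phi> s)"
      if s: "s \<in> {a'..T}" for n s
    proof -
      let ?e = "(1/2::real)^n"
      have two: "2 * ennreal x = ennreal (2 * x)" for x by (subst ennreal_mult') simp_all
      have u: "a \<le> \<phi> s" "\<theta> (\<phi> s) = s" using s \<phi> by auto
      have val: "elementary_value (retime \<theta> L (S n)) s \<omega> = L o\<^sub>L elementary_value (S n) (\<phi> s) \<omega>" for L :: "'k \<Rightarrow>\<^sub>L 'k"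
      proof -
        have "elementary_value (retime \<theta> L (S n)) (\<theta> (\<phi> s)) \<omega> = L o\<^sub>L elementary_value (S n) (\<phi> s) \<omega>"
          by (rule elementary_value_retime[OF S u(1) strict_mono])
        then show ?thesis unfolding u(2) .
      qed
      let ?D = "elementary_value (S n) (\<phi> s) \<omega> - \<Phi> (\<phi> s) \<omega>"
      let ?e1 = "elementary_value (R1 n (\<nu> n)) s \<omega> - p1 s *\<^sub>R elementary_value (retime \<theta> L1 (S n)) s \<omega>"
      let ?e2 = "elementary_value (R2 n (\<nu> n)) s \<omega> - p2 s *\<^sub>R elementary_value (retime \<theta> L2 (S n)) s \<omega>"
      \<comment> \<open>The freezing errors of the two weights, followed by the error of
        \<open>S n\<close> carried to the new clock.\<close>
      have dec: "?v n s \<omega> - ?\<Phi> s \<omega> = (?e1 + ?e2) + (p1 s *\<^sub>R (L1 o\<^sub>L ?D) + p2 s *\<^sub>R (L2 o\<^sub>L ?D))"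
        unfolding val elementary_value_append
        by (auto intro!: blinfun_eqI simp: blinfun.add_left blinfun.diff_left blinfun.scaleR_left
            blinfun.diff_right algebra_simps)
      have e: "hs_norm_sq (?e1 + ?e2) \<le> ennreal (4 * ?e)"
      proof -
        have "hs_norm_sq (?e1 + ?e2) \<le> 2 * hs_norm_sq ?e1 + 2 * hs_norm_sq ?e2" by (rule hs_norm_sq_add_le2)
        also have "\<dots> \<le> 2 * ennreal ?e + 2 * ennreal ?e"
          by (intro add_mono mult_left_mono K \<nu> \<omega>) auto
        also have "\<dots> = ennreal (2 * ?e + 2 * ?e)"
          unfolding two by (rule ennreal_plus[symmetric]) auto
        also have "2 * ?e + 2 * ?e = 4 * ?e" by simp
        finally show ?thesis .
      qed
      have d1: "hs_norm_sq (p *\<^sub>R (L o\<^sub>L ?D)) \<le> ennreal (P\<^sup>2) * ?G n (\<phi> s)"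
        if "\<bar>p\<bar> \<le> P" "\<And>x. norm (blinfun_apply L x) \<le> norm x" for p P and L :: "'k \<Rightarrow>\<^sub>L 'k"
        unfolding hs_norm_sq_scaleR using power_mono[OF that(1), of 2]
        by (intro mult_mono hs_norm_sq_compose_le that(2) ennreal_leI) auto
      have d: "hs_norm_sq (p1 s *\<^sub>R (L1 o\<^sub>L ?D) + p2 s *\<^sub>R (L2 o\<^sub>L ?D)) \<le> ennreal (2 * P1\<^sup>2 + 2 * P2\<^sup>2) * ?G n (\<phi> s)"
      proof -
        have "hs_norm_sq (p1 s *\<^sub>R (L1 o\<^sub>L ?D) + p2 s *\<^sub>R (L2 o\<^sub>L ?D))
            \<le> 2 * hs_norm_sq (p1 s *\<^sub>R (L1 o\<^sub>L ?D)) + 2 * hs_norm_sq (p2 s *\<^sub>R (L2 o\<^sub>L ?D))"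
          by (rule hs_norm_sq_add_le2)
        also have "\<dots> \<le> 2 * (ennreal (P1\<^sup>2) * ?G n (\<phi> s)) + 2 * (ennreal (P2\<^sup>2) * ?G n (\<phi> s))"
          by (intro add_mono mult_left_mono d1 L P1 P2) (use s in auto)
        also have "\<dots> = ennreal (2 * P1\<^sup>2 + 2 * P2\<^sup>2) * ?G n (\<phi> s)"
          unfolding mult.assoc[symmetric] two distrib_right[symmetric]
          by (subst ennreal_plus[symmetric]) auto
        finally show ?thesis .
      qed
      have "hs_norm_sq (?v n s \<omega> - ?\<Phi> s \<omega>) \<le> 2 * hs_norm_sq (?e1 + ?e2)
         + 2 * hs_norm_sq (p1 s *\<^sub>R (L1 o\<^sub>L ?D) + p2 s *\<^sub>R (L2 o\<^sub>L ?D))"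
        unfolding dec by (rule hs_norm_sq_add_le2)
      also have "\<dots> \<le> 2 * ennreal (4 * ?e) + 2 * (ennreal (2 * P1\<^sup>2 + 2 * P2\<^sup>2) * ?G n (\<phi> s))"
        by (intro add_mono mult_left_mono e d) auto
      also have "2 * ennreal (4 * ?e) = ennreal (8 * ?e)"
        unfolding two by simp
      also have "2 * (ennreal (2 * P1\<^sup>2 + 2 * P2\<^sup>2) * ?G n (\<phi> s)) = ennreal c * ?G n (\<phi> s)"
        unfolding mult.assoc[symmetric] two by (simp add: c_def)
      finally show ?thesis .
    qed
    have le: "(\<integral>\<^sup>+ s\<in>{a'..T}. hs_norm_sq (?v n s \<omega> - ?\<Phi> s \<omega>) \<partial>lborel)
        \<le> ennreal (8 * (1/2)^n * (T - a')) + ennreal (Q * c) * (\<integral>\<^sup>+u\<in>{a..?U}. ?G n u \<partial>lborel)" for n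
    proof -
      have "(\<integral>\<^sup>+ s\<in>{\<theta> a..\<theta> ?U}. hs_norm_sq (?v n s \<omega> - ?\<Phi> s \<omega>) \<partial>lborel)
        \<le> ennreal (8 * (1/2)^n * (\<theta> ?U - \<theta> a)) + ennreal (Q * c) * (\<integral>\<^sup>+u\<in>{a..?U}. ?G n u \<partial>lborel)"
      proof (rule nn_integral_affine_time_change_le[where \<theta>=\<theta> and \<theta>'=\<theta>' and \<phi>=\<phi>])
        show "continuous_on {a..?U} \<theta>'" by (rule continuous_on_subset[OF C1_from_continuous[OF C1_\<theta>']]) auto
        show "\<theta>' u \<le> Q" if "u \<in> {a..?U}" for u using Q(2)[of u] that by auto
        show "0 \<le> \<theta>' u" if "u \<in> {a..?U}" for u using pos[of u] that by auto
      qed (use deriv_at \<phi>(3) U Q(1) c pt start T in auto)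
      then show ?thesis unfolding start U(2) .
    qed
    have "(\<lambda>n. ennreal (8 * (1/2)^n * (T - a')) + ennreal (Q * c) * (\<integral>\<^sup>+u\<in>{a..?U}. ?G n u \<partial>lborel))
       \<longlonglongrightarrow> ennreal 0 + ennreal (Q * c) * 0"
    proof (intro tendsto_add ennreal_tendsto_cmult tendsto_ennrealI)
      have "(\<lambda>n. 8 * (1/2::real)^n * (T - a')) \<longlonglongrightarrow> 8 * 0 * (T - a')"
        by (intro tendsto_mult LIMSEQ_power_zero tendsto_const) simp
      then show "(\<lambda>n. 8 * (1/2::real)^n * (T - a')) \<longlonglongrightarrow> 0" by simp
      show "(\<lambda>n. \<integral>\<^sup>+u\<in>{a..?U}. ?G n u \<partial>lborel) \<longlonglongrightarrow> 0" using lim U(1) by simp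
    qed simp
    then have lim0: "(\<lambda>n. ennreal (8 * (1/2)^n * (T - a')) + ennreal (Q * c) * (\<integral>\<^sup>+u\<in>{a..?U}. ?G n u \<partial>lborel)) \<longlonglongrightarrow> 0"
      by simp
    show ?thesis
      by (rule tendsto_sandwich[OF _ _ tendsto_const lim0]) (auto intro!: always_eventually le)
  qed
  have "ito_integral M a' ?F ?N ?\<Phi> I'"
    unfolding ito_integral_def
  proof (intro exI[of _ "\<lambda>n. R1 n (\<nu> n) @ R2 n (\<nu> n)"] conjI allI RP \<nu>I)
    show "AE \<omega> in M. \<forall>T\<ge>a'. (\<lambda>n. \<integral>\<^sup>+ s\<in>{a'..T}. hs_norm_sq (?v n s \<omega> - ?\<Phi> s \<omega>) \<partial>lborel) \<longlonglongrightarrow> 0"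
      using SL AE_space by eventually_elim (use L2 in blast)
  qed
  moreover have "AE \<omega> in M. continuous_on {a..} (\<lambda>u. I u \<omega>) \<and>
      (\<exists>y1 y2. path_integral a m1 m1' (\<lambda>u. L1 (I u \<omega>)) y1 \<and> path_integral a m2 m2' (\<lambda>u. L2 (I u \<omega>)) y2 \<and>
         (\<forall>u\<ge>a. I' (\<theta> u) \<omega> = y1 u + y2 u))"
    using Icont
  proof eventually_elim
    case (elim \<omega>)
    show ?case
      using elim Jpath[OF m1 elim, of L1] Jpath[OF m2 elim, of L2] \<phi>(3)
      by (intro conjI exI[of _ "\<lambda>u. J m1 m1' L1 u \<omega>"] exI[of _ "\<lambda>u. J m2 m2' L2 u \<omega>"]) (auto simp: I'_def)
  qed
  ultimately show ?thesis by blast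
qed

end

section \<open>Time change of strong solutions\<close>

lemma pair_eq_proj: "(fst z, c *\<^sub>R snd z) = blinfun_apply proj_first z + c *\<^sub>R blinfun_apply proj_second z"
  by (cases z) (simp add: proj_first.rep_eq proj_second.rep_eq)

lemma scaled_velocity_continuous:
  fixes z :: "real \<Rightarrow> 'a::real_normed_vector \<times> 'b::real_normed_vector"
  assumes "continuous_on S z" "continuous_on S c"
  shows "continuous_on S (\<lambda>s. (fst (z s), c s *\<^sub>R snd (z s)))"
  by (intro continuous_intros assms)

context time_change
begin

lemma inv_\<theta>'_eq: "a \<le> u \<Longrightarrow> 1 / \<theta>' u = (1 / g u)\<^sup>2"
  by (simp add: power_divide g_sq)

lemma inv_g_cube:
  assumes "a' \<le> s"
  shows "inv_g s * (inv_g s * inv_g s) = (1 / \<theta>' (\<phi> s)) powr (3/2)"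
proof -
  have p: "0 < \<theta>' (\<phi> s)" using pos \<phi>(1)[OF assms] by simp
  have "inv_g s = (1 / \<theta>' (\<phi> s)) powr (1/2)"
    using p by (simp add: inv_g_def g_def powr_half_sqrt real_sqrt_divide)
  moreover have "x powr (1/2) * (x powr (1/2) * x powr (1/2)) = x powr (3/2)" for x :: real
    unfolding powr_add[symmetric] by simp
  ultimately show ?thesis by simp
qed

text \<open>It is not known beforehand that the first component of the stochastic integral vanishes, so
  its integrand is weighted differently from the second one's, making it exactly invariant under
  the change of time.\<close>

lemma strong_solution_time_change:
  fixes W :: "real \<Rightarrow> 'h::{real_inner, banach, second_countable_topology} \<Rightarrow> 'w \<Rightarrow> real"
    and \<sigma> :: "real \<Rightarrow> 'h \<Rightarrow>\<^sub>L 'h" and X X' :: "real \<Rightarrow> 'w \<Rightarrow> 'h \<times> 'h"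
  assumes M: "prob_space M" and F: "filtration_from M a F" and W: "brownian_motion_from M a F C W"
    and sol: "strong_solution M a F W b (\<lambda>t _. in_second (\<sigma> t)) X0 X"
    and b: "continuous_on ({a..} \<times> UNIV) (\<lambda>(t, z). b t z)"
    and b': "continuous_on ({a'..} \<times> UNIV) (\<lambda>(s, z). b' s z)"
    and drift: "\<And>u z. a \<le> u \<Longrightarrow> \<theta>' u *\<^sub>R b' (\<theta> u) (fst z, (1 / \<theta>' u) *\<^sub>R snd z)
      = (fst (b u z), (- \<theta>'' u / (\<theta>' u)\<^sup>2) *\<^sub>R snd z + (1 / \<theta>' u) *\<^sub>R snd (b u z))"
    and X': "\<And>s \<omega>. a' \<le> s \<Longrightarrow> X' s \<omega> = (fst (X (\<phi> s) \<omega>), (1 / \<theta>' (\<phi> s)) *\<^sub>R snd (X (\<phi> s) \<omega>))"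
    and X0': "\<And>\<omega>. X0' \<omega> = (fst (X0 \<omega>), (1 / \<theta>' a) *\<^sub>R snd (X0 \<omega>))"
    and \<sigma>': "\<And>s. a' \<le> s \<Longrightarrow> \<sigma>' s = (1 / \<theta>' (\<phi> s)) powr (3/2) *\<^sub>R \<sigma> (\<phi> s)"
  shows "strong_solution M a' (\<lambda>s. F (\<phi> s)) (noise W) b' (\<lambda>s _. in_second (\<sigma>' s)) X0' X'"
proof -
  interpret prob_space M by fact
  let ?m = "\<lambda>u. 1 / \<theta>' u" and ?m' = "\<lambda>u. - \<theta>'' u / (\<theta>' u)\<^sup>2"
  have m: "C1_from a ?m ?m'" by (rule C1_from_inverse[OF C1_\<theta>']) (use pos in force)
  have one: "C1_from a (\<lambda>_. 1) (\<lambda>_. 0)" by (auto simp: C1_from_def)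
  obtain I where Xm: "\<And>t. a \<le> t \<Longrightarrow> X t \<in> borel_measurable M"
    and Xinit: "AE \<omega> in M. X a \<omega> = X0 \<omega>"
    and Xc: "AE \<omega> in M. continuous_on {a..} (\<lambda>t. X t \<omega>)"
    and Xfin: "\<And>t. a \<le> t \<Longrightarrow> AE \<omega> in M.
        (\<integral>\<^sup>+ s\<in>{a..t}. (ennreal (norm (b s (X s \<omega>))) + hs_norm_sq (in_second (\<sigma> s) :: 'h \<Rightarrow>\<^sub>L ('h \<times> 'h))) \<partial>lborel) < \<infinity>"
    and I: "ito_integral M a F W (\<lambda>s \<omega>. in_second (\<sigma> s)) I"
    and Xeq: "\<And>t. a \<le> t \<Longrightarrow> AE \<omega> in M. X t \<omega> = X a \<omega> + (LINT s:{a..t}|lborel. b s (X s \<omega>)) + I t \<omega>"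
    using sol unfolding strong_solution_def by blast
  \<comment> \<open>In the second component one factor undoes the weight \<open>g\<close> of the
    noise and the other two make up the velocity factor 1 / \<theta>', whence the exponent 3/2. The
    first component takes a single factor, so its weight on the old clock is 1.\<close>
  have p2: "C1_from a' (\<lambda>s. inv_g s * (inv_g s * inv_g s))
      (\<lambda>s. inv_g' s * (inv_g s * inv_g s) + inv_g s * (inv_g' s * inv_g s + inv_g s * inv_g' s))"
    by (intro C1_from_mult C1_inv_g)
  obtain I' where I'0: "ito_integral M a' (\<lambda>s. F (\<phi> s)) (noise W)
      (\<lambda>s \<omega>. inv_g s *\<^sub>R (proj_first o\<^sub>L in_second (\<sigma> (\<phi> s))) +
         (inv_g s * (inv_g s * inv_g s)) *\<^sub>R (proj_second o\<^sub>L in_second (\<sigma> (\<phi> s)))) I'"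
    and II': "AE \<omega> in M. continuous_on {a..} (\<lambda>u. I u \<omega>) \<and>
      (\<exists>y1 y2. path_integral a (\<lambda>_. 1) (\<lambda>_. 0) (\<lambda>u. proj_first (I u \<omega>)) y1
         \<and> path_integral a ?m ?m' (\<lambda>u. proj_second (I u \<omega>)) y2
         \<and> (\<forall>u\<ge>a. I' (\<theta> u) \<omega> = y1 u + y2 u))"
    using ito_integral_time_change[OF M F W I C1_inv_g p2 one m _ _ norm_proj_le] g_pos \<phi>(3)
    by (force simp: inv_g_def inv_\<theta>'_eq power2_eq_square)
  have I': "ito_integral M a' (\<lambda>s. F (\<phi> s)) (noise W) (\<lambda>s \<omega>. in_second (\<sigma>' s)) I'"
    by (rule ito_integral_cong[OF I'0])
       (simp add: proj_in_second \<sigma>' in_second_scaleR inv_g_cube)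
  have mc: "continuous_on {a'..} (\<lambda>s. ?m (\<phi> s))"
    by (rule continuous_on_compose2[OF C1_from_continuous[OF m] continuous_\<phi>]) (use \<phi>(1) in auto)
  have X'c: "continuous_on {a'..} (\<lambda>s. X' s \<omega>)" if "continuous_on {a..} (\<lambda>t. X t \<omega>)" for \<omega>
  proof -
    have "continuous_on {a'..} (\<lambda>s. X (\<phi> s) \<omega>)"
      by (rule continuous_on_compose2[OF that continuous_\<phi>]) (use \<phi>(1) in auto)
    from scaled_velocity_continuous[OF this mc] show ?thesis
      by (rule continuous_on_eq) (simp add: X')
  qed
  have bc: "continuous_on {a..} (\<lambda>t. b t (X t \<omega>))" if "continuous_on {a..} (\<lambda>t. X t \<omega>)" for \<omega>
    using continuous_on_compose2[OF b continuous_on_Pair[OF continuous_on_id that]] by auto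
  have b'c: "continuous_on {a'..} (\<lambda>s. b' s (X' s \<omega>))" if "continuous_on {a..} (\<lambda>t. X t \<omega>)" for \<omega>
    using continuous_on_compose2[OF b' continuous_on_Pair[OF continuous_on_id X'c[OF that]]] by auto
  show ?thesis
    unfolding strong_solution_def
  proof (intro conjI allI impI exI[of _ I'] I')
    fix s assume s: "a' \<le> s"
    have "continuous_on UNIV (\<lambda>z::'h \<times> 'h. (fst z, (1 / \<theta>' (\<phi> s)) *\<^sub>R snd z))"
      by (intro continuous_intros)
    from measurable_compose[OF Xm[OF \<phi>(1)[OF s]] borel_measurable_continuous_onI[OF this]]
    have "(\<lambda>\<omega>. (fst (X (\<phi> s) \<omega>), (1 / \<theta>' (\<phi> s)) *\<^sub>R snd (X (\<phi> s) \<omega>))) \<in> borel_measurable M" .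
    then show "X' s \<in> borel_measurable M" using X'[OF s] by (subst measurable_cong) auto
  next
    show "AE \<omega> in M. X' a' \<omega> = X0' \<omega>"
      using Xinit by eventually_elim (simp add: X' X0' \<phi>_start)
    show "AE \<omega> in M. continuous_on {a'..} (\<lambda>t. X' t \<omega>)"
      using Xc by eventually_elim (rule X'c)
  next
    fix T assume T: "a' \<le> T"
    let ?U = "\<phi> T"
    have U: "a \<le> ?U" "\<theta> ?U = T" using \<phi> T by auto
    have "AE \<omega> in M. (\<integral>\<^sup>+ s\<in>{a'..T}. (ennreal (norm (b' s (X' s \<omega>))) + hs_norm_sq (in_second (\<sigma>' s) :: 'h \<Rightarrow>\<^sub>L ('h \<times> 'h))) \<partial>lborel) < \<infinity>"
      using Xfin[OF U(1)] Xc
    proof eventually_elim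
      case (elim \<omega>)
      let ?G = "\<lambda>u. hs_norm_sq (in_second (\<sigma> u) :: 'h \<Rightarrow>\<^sub>L ('h \<times> 'h))"
      \<comment> \<open>The new drift is integrable because it is continuous along the path; only
        the diffusion part is transported from the old integrability condition.\<close>
      have "bounded ((\<lambda>s. b' s (X' s \<omega>)) ` {a'..T})"
        by (intro compact_imp_bounded compact_continuous_image
            continuous_on_subset[OF b'c[OF elim(2)]]) auto
      then obtain N where N: "N > 0" "\<And>s. s \<in> {a'..T} \<Longrightarrow> norm (b' s (X' s \<omega>)) \<le> N"
        unfolding bounded_pos by auto
      obtain P where P: "P > 0" "\<And>s. a' \<le> s \<Longrightarrow> s \<le> T \<Longrightarrow> \<bar>inv_g s * (inv_g s * inv_g s)\<bar> \<le> P"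
        using C1_from_bound[OF p2] by metis
      obtain Q where Q: "Q > 0" "\<And>u. a \<le> u \<Longrightarrow> u \<le> ?U \<Longrightarrow> \<bar>\<theta>' u\<bar> \<le> Q" using C1_from_bound[OF C1_\<theta>'] by metis
      have pt: "ennreal (norm (b' s (X' s \<omega>))) + hs_norm_sq (in_second (\<sigma>' s) :: 'h \<Rightarrow>\<^sub>L ('h \<times> 'h))
          \<le> ennreal N + ennreal (P\<^sup>2) * ?G (\<phi> s)" if s: "s \<in> {a'..T}" for s
      proof (rule add_mono)
        show "ennreal (norm (b' s (X' s \<omega>))) \<le> ennreal N" using N(2)[OF s] by (rule ennreal_leI)
        have "in_second (\<sigma>' s) = (inv_g s * (inv_g s * inv_g s)) *\<^sub>R (in_second (\<sigma> (\<phi> s)) :: 'h \<Rightarrow>\<^sub>L ('h \<times> 'h))"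
          using s by (simp add: \<sigma>' in_second_scaleR inv_g_cube)
        moreover have "(inv_g s * (inv_g s * inv_g s))\<^sup>2 \<le> P\<^sup>2"
          using power_mono[OF P(2)[of s], of 2] s by simp
        ultimately show "hs_norm_sq (in_second (\<sigma>' s) :: 'h \<Rightarrow>\<^sub>L ('h \<times> 'h)) \<le> ennreal (P\<^sup>2) * ?G (\<phi> s)"
          by (simp only: hs_norm_sq_scaleR) (intro mult_right_mono ennreal_leI; simp)
      qed
      have "(\<integral>\<^sup>+ s\<in>{\<theta> a..\<theta> ?U}. (ennreal (norm (b' s (X' s \<omega>))) + hs_norm_sq (in_second (\<sigma>' s) :: 'h \<Rightarrow>\<^sub>L ('h \<times> 'h))) \<partial>lborel)
        \<le> ennreal (N * (\<theta> ?U - \<theta> a)) + ennreal (Q * P\<^sup>2) * (\<integral>\<^sup>+u\<in>{a..?U}. ?G u \<partial>lborel)"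
      proof (rule nn_integral_affine_time_change_le[where \<theta>=\<theta> and \<theta>'=\<theta>' and \<phi>=\<phi>])
        show "continuous_on {a..?U} \<theta>'" by (rule continuous_on_subset[OF C1_from_continuous[OF C1_\<theta>']]) auto
        show "\<theta>' u \<le> Q" if "u \<in> {a..?U}" for u using Q(2)[of u] that by auto
        show "0 \<le> \<theta>' u" if "u \<in> {a..?U}" for u using pos[of u] that by auto
      qed (use deriv_at \<phi>(3) U Q(1) P(1) N(1) pt start T in auto)
      also have "\<dots> < \<infinity>"
      proof -
        have "(\<integral>\<^sup>+u\<in>{a..?U}. ?G u \<partial>lborel)
            \<le> (\<integral>\<^sup>+ s\<in>{a..?U}. (ennreal (norm (b s (X s \<omega>))) + ?G s) \<partial>lborel)"
          by (intro nn_integral_mono) (auto simp: indicator_def)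
        also have "\<dots> < \<infinity>" by (rule elim(1))
        finally show ?thesis by (simp add: ennreal_mult_less_top)
      qed
      finally show ?case unfolding start U(2) .
    qed
    then show "AE \<omega> in M. (\<integral>\<^sup>+ s\<in>{a'..T}. (ennreal (norm (b' s (X' s \<omega>))) + hs_norm_sq (in_second (\<sigma>' s) :: 'h \<Rightarrow>\<^sub>L ('h \<times> 'h))) \<partial>lborel) < \<infinity>" .
  next
    fix s assume s: "a' \<le> s"
    have "AE \<omega> in M. \<forall>t\<ge>a. X t \<omega> = X a \<omega> + (LINT s:{a..t}|lborel. b s (X s \<omega>)) + I t \<omega>"
    proof (rule AE_eq_all_of_continuous[OF Xeq Xc])
      show "AE \<omega> in M. continuous_on {a..} (\<lambda>t. X a \<omega> + (LINT s:{a..t}|lborel. b s (X s \<omega>)) + I t \<omega>)"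
        using Xc II'
      proof eventually_elim
        case (elim \<omega>)
        have "continuous_on {a..} (\<lambda>t. LINT s:{a..t}|lborel. b s (X s \<omega>))"
          unfolding continuous_on_eq_continuous_within
          using LINT_has_vector_derivative[OF bc[OF elim(1)]] has_vector_derivative_continuous by fastforce
        then show ?case using elim(2) by (intro continuous_intros) auto
      qed
    qed
    with Xc II' show "AE \<omega> in M. X' s \<omega> = X' a' \<omega> + (LINT s:{a'..s}|lborel. b' s (X' s \<omega>)) + I' s \<omega>"
    proof eventually_elim
      case (elim \<omega>)
      obtain y1 y2 where y1: "path_integral a (\<lambda>_. 1) (\<lambda>_. 0) (\<lambda>u. proj_first (I u \<omega>)) y1"
        and y2: "path_integral a ?m ?m' (\<lambda>u. proj_second (I u \<omega>)) y2"
        and y: "\<And>u. a \<le> u \<Longrightarrow> I' (\<theta> u) \<omega> = y1 u + y2 u" using elim(2) by blast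
      let ?b = "\<lambda>u. b u (X u \<omega>)"
      \<comment> \<open>\<open>X\<close> need not be differentiable in time, but its difference from
        the stochastic integral is, with the drift as derivative.\<close>
      define D where "D u = X u \<omega> - I u \<omega>" for u
      have Deq: "D t = X a \<omega> + (LINT s:{a..t}|lborel. ?b s)" if "a \<le> t" for t
        using elim(3)[rule_format, OF that] unfolding D_def diff_eq_eq .
      have D: "(D has_vector_derivative ?b u) (at u within {a..})" if u: "a \<le> u" for u
      proof -
        have "((\<lambda>t. X a \<omega> + (LINT s:{a..t}|lborel. ?b s)) has_vector_derivative (0 + ?b u)) (at u within {a..})"
          by (intro has_vector_derivative_add LINT_has_vector_derivative[OF bc[OF elim(1)] u] has_vector_derivative_const)
        then show ?thesis
          by (subst has_vector_derivative_cong_ev[where g="\<lambda>t. X a \<omega> + (LINT s:{a..t}|lborel. ?b s)"])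
             (use Deq u in auto)
      qed
      \<comment> \<open>This is X' - I' read on the old clock, grouped so that every bracket is
        differentiable: those with \<open>y1\<close> and \<open>y2\<close> are so by the definition
        of \<open>path_integral\<close>.\<close>
      define R where "R u = proj_first (D u) + ?m u *\<^sub>R proj_second (D u)
         - (y1 u - 1 *\<^sub>R proj_first (I u \<omega>)) - (y2 u - ?m u *\<^sub>R proj_second (I u \<omega>))" for u
      have R: "(R has_vector_derivative \<theta>' u *\<^sub>R b' (\<theta> u) (fst (X u \<omega>), ?m u *\<^sub>R snd (X u \<omega>))) (at u within {a..})"
        if u: "a \<le> u" for u
      proof -
        have "(R has_vector_derivative
           (proj_first (?b u) + (?m u *\<^sub>R proj_second (?b u) + ?m' u *\<^sub>R proj_second (D u))
            - (- (0 *\<^sub>R proj_first (I u \<omega>))) - (- (?m' u *\<^sub>R proj_second (I u \<omega>))))) (at u within {a..})"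
          unfolding R_def[abs_def]
          by (intro has_vector_derivative_diff has_vector_derivative_add has_vector_derivative_scaleR
              bounded_linear.has_vector_derivative[OF blinfun.bounded_linear_right D[OF u]] C1_fromD[OF m u])
             (use y1 y2 u in \<open>auto simp: path_integral_def\<close>)
        \<comment> \<open>The derivative of the weight meets \<open>D\<close> in one term and
          \<open>I\<close> in another; together they give the term with \<open>X\<close> that
          \<open>drift\<close> contains.\<close>
        also have "proj_first (?b u) + (?m u *\<^sub>R proj_second (?b u) + ?m' u *\<^sub>R proj_second (D u))
            - (- (0 *\<^sub>R proj_first (I u \<omega>))) - (- (?m' u *\<^sub>R proj_second (I u \<omega>)))
          = proj_first (?b u) + ?m u *\<^sub>R proj_second (?b u) + ?m' u *\<^sub>R proj_second (X u \<omega>)"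
          by (simp add: D_def blinfun.diff_right algebra_simps)
        also have "\<dots> = (fst (?b u), ?m' u *\<^sub>R snd (X u \<omega>) + ?m u *\<^sub>R snd (?b u))"
          by (simp add: proj_first.rep_eq proj_second.rep_eq)
        finally show ?thesis unfolding drift[OF u] .
      qed
      have RX: "R (\<phi> t) = X' t \<omega> - I' t \<omega>" if t: "a' \<le> t" for t
        using y[OF \<phi>(1)[OF t]] \<phi>(2)[OF t]
        by (simp add: R_def D_def X'[OF t] pair_eq_proj blinfun.diff_right algebra_simps)
      have "((\<lambda>t. R (\<phi> t)) has_vector_derivative b' t (X' t \<omega>)) (at t within {a'..})" if t: "a' \<le> t" for t
      proof -
        have p: "0 < \<theta>' (\<phi> t)" using pos \<phi>(1)[OF t] by simp
        have "(R has_vector_derivative \<theta>' (\<phi> t) *\<^sub>R b' t (X' t \<omega>)) (at (\<phi> t) within \<phi> ` {a'..})"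
          using R[OF \<phi>(1)[OF t]] \<phi>(1) unfolding \<phi>(2)[OF t] X'[OF t]
          by (auto intro: has_vector_derivative_within_subset)
        from vector_diff_chain_within[OF _ this, of "1 / \<theta>' (\<phi> t)"]
        show ?thesis using C1_fromD[OF C1_\<phi> t] p
          by (simp add: has_real_derivative_iff_has_vector_derivative o_def)
      qed
      from LINT_eq_of_has_vector_derivative[OF b'c[OF elim(1)] s this]
      have "(LINT t:{a'..s}|lborel. b' t (X' t \<omega>)) = X' s \<omega> - I' s \<omega> - (X' a' \<omega> - I' a' \<omega>)"
        using RX s by simp
      \<comment> \<open>Path integrals start at 0, and \<theta> a is the new initial time.\<close>
      moreover have "I' a' \<omega> = 0" using y[of a] y1 y2 start by (simp add: path_integral_def)
      ultimately show ?case by simp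
    qed
  qed
qed

end

section \<open>The exponential clock and its logarithmic inverse\<close>

text \<open>\<kappa> solves \<kappa>' = \<kappa> / \<beta>, so its inverse \<tau> has derivative
  \<beta> / s. Interpreting the locale in both orientations yields both directions of the theorem
  from one argument.\<close>

lemma time_change_exp:
  fixes \<beta> t0 s0 :: real
  assumes \<beta>: "\<beta> > 0" and s0: "s0 > 0"
    and \<tau>: "\<tau> = (\<lambda>s. t0 + \<beta> * ln (s / s0))" and \<kappa>: "\<kappa> = (\<lambda>t. s0 * exp ((t - t0) / \<beta>))"
  shows "time_change t0 s0 \<kappa> (\<lambda>u. \<kappa> u / \<beta>) (\<lambda>u. \<kappa> u / \<beta>\<^sup>2) \<tau>"
    and "time_change s0 t0 \<tau> (\<lambda>s. \<beta> / s) (\<lambda>s. - \<beta> / s\<^sup>2) \<kappa>"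
proof -
  have \<kappa>pos: "0 < \<kappa> u" for u using s0 by (simp add: \<kappa>)
  have \<kappa>d: "(\<kappa> has_real_derivative \<kappa> u / \<beta>) (at u)" for u
    unfolding \<kappa> using \<beta> by (auto intro!: derivative_eq_intros)
  have \<tau>d: "(\<tau> has_real_derivative \<beta> / s) (at s)" if "s0 \<le> s" for s
    unfolding \<tau> using s0 that by (auto intro!: derivative_eq_intros)
  have \<tau>\<kappa>: "\<tau> (\<kappa> u) = u" for u using \<beta> s0 by (simp add: \<tau> \<kappa>)
  have \<kappa>\<tau>: "\<kappa> (\<tau> s) = s" if "s0 \<le> s" for s using \<beta> s0 that by (simp add: \<tau> \<kappa>)
  have \<kappa>ge: "s0 \<le> \<kappa> u" if "t0 \<le> u" for u using \<beta> s0 that by (simp add: \<kappa>)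
  have \<tau>ge: "t0 \<le> \<tau> s" if "s0 \<le> s" for s using \<beta> s0 that by (simp add: \<tau>)
  show "time_change t0 s0 \<kappa> (\<lambda>u. \<kappa> u / \<beta>) (\<lambda>u. \<kappa> u / \<beta>\<^sup>2) \<tau>"
  proof
    show "((\<lambda>u. \<kappa> u / \<beta>) has_real_derivative \<kappa> u / \<beta>\<^sup>2) (at u)" for u
      using DERIV_cdivide[OF \<kappa>d, of \<beta>] by (simp add: power2_eq_square)
    show "continuous_on {t0..} (\<lambda>u. \<kappa> u / \<beta>\<^sup>2)" unfolding \<kappa> using \<beta> by (intro continuous_intros) auto
    show "(\<tau> has_real_derivative 1 / (\<kappa> (\<tau> s) / \<beta>)) (at s)" if "s0 \<le> s" for s
      using \<tau>d[OF that] \<kappa>\<tau>[OF that] by simp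
  qed (use \<kappa>d \<kappa>pos \<beta> \<tau>ge \<kappa>\<tau> \<tau>\<kappa> in \<open>auto simp: \<kappa>\<close>)
  show "time_change s0 t0 \<tau> (\<lambda>s. \<beta> / s) (\<lambda>s. - \<beta> / s\<^sup>2) \<kappa>"
  proof
    show "((\<lambda>s. \<beta> / s) has_real_derivative - \<beta> / s\<^sup>2) (at s)" if "s0 \<le> s" for s
      using s0 that by (auto intro!: derivative_eq_intros simp: power2_eq_square)
    show "continuous_on {s0..} (\<lambda>s. - \<beta> / s\<^sup>2)" using s0 by (intro continuous_intros) auto
    show "(\<kappa> has_real_derivative 1 / (\<beta> / \<kappa> t)) (at t)" for t using \<kappa>d[of t] by simp
    show "\<tau> s0 = t0" using s0 by (simp add: \<tau>)
    show "0 < \<beta> / s" if "s0 \<le> s" for s using s0 \<beta> that by simp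
  qed (use \<tau>d \<kappa>ge \<kappa>\<tau> \<tau>\<kappa> in auto)
qed

theorem theorem2p6:
  fixes M :: "'w measure"
    and f :: "'h::{real_inner, banach, second_countable_topology} \<Rightarrow> real"
    and gradf :: "'h \<Rightarrow> 'h"
    and L \<alpha> t0 s0 :: real
    and \<tau> \<kappa> :: "real \<Rightarrow> real"
  assumes "prob_space M"
    and "convex_on UNIV f"
    and "\<And>x. GDERIV f x :> gradf x"
    and "L-lipschitz_on UNIV gradf"
    and "\<exists>x. is_arg_min f (\<lambda>_. True) x"
    and "\<alpha> > 1" and "t0 \<ge> 0" and "s0 > 0"
    and \<tau>_def: "\<tau> = (\<lambda>s. t0 + (\<alpha> - 1) * ln (s / s0))"
    and \<kappa>_def: "\<kappa> = (\<lambda>t. s0 * exp ((t - t0) / (\<alpha> - 1)))"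
  shows
    "(\<forall>(F :: real \<Rightarrow> 'w measure) (C :: 'h \<Rightarrow>\<^sub>L 'h) (W :: real \<Rightarrow> 'h \<Rightarrow> 'w \<Rightarrow> real)
        (\<sigma>Y :: real \<Rightarrow> 'h \<Rightarrow>\<^sub>L 'h) (Y0 :: 'w \<Rightarrow> 'h) (X0 :: 'w \<Rightarrow> 'h)
        (Y :: real \<Rightarrow> 'w \<Rightarrow> 'h) (X :: real \<Rightarrow> 'w \<Rightarrow> 'h).
        filtration_from M t0 F \<and> brownian_motion_from M t0 F C W \<and>
        diffusion_coefficient t0 \<sigma>Y \<and> solves_A M F W \<alpha> t0 s0 gradf \<sigma>Y Y0 X0 Y X \<longrightarrow>
        (let F' = (\<lambda>s. F (\<tau> s));
             \<sigma>Z = (\<lambda>s. (deriv \<tau> s) powr (3/2) *\<^sub>R \<sigma>Y (\<tau> s));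
             Z = (\<lambda>s. Y (\<tau> s));
             Q = (\<lambda>s \<omega>. ((\<alpha> - 1) / s) *\<^sub>R X (\<tau> s) \<omega>)
         in (\<forall>s\<ge>s0. \<sigma>Z s = ((\<alpha> - 1) / s) powr (3/2) *\<^sub>R \<sigma>Y (\<tau> s)) \<and>
            filtration_from M s0 F' \<and> diffusion_coefficient s0 \<sigma>Z \<and>
            (\<exists>W'. brownian_motion_from M s0 F' C W' \<and>
               (takes_values_in_space M t0 F W \<longrightarrow> takes_values_in_space M s0 F' W') \<and>
               time_changed_noise M t0 F W \<kappa> W' \<and>
               solves_B M F' W' \<alpha> s0 gradf \<sigma>Z Y0 (\<lambda>\<omega>. ((\<alpha> - 1) / s0) *\<^sub>R X0 \<omega>) Z Q)))
     \<and>
     (\<forall>(F :: real \<Rightarrow> 'w measure) (C :: 'h \<Rightarrow>\<^sub>L 'h) (W :: real \<Rightarrow> 'h \<Rightarrow> 'w \<Rightarrow> real)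
        (\<sigma>Z :: real \<Rightarrow> 'h \<Rightarrow>\<^sub>L 'h) (Z0 :: 'w \<Rightarrow> 'h) (Q0 :: 'w \<Rightarrow> 'h)
        (Z :: real \<Rightarrow> 'w \<Rightarrow> 'h) (Q :: real \<Rightarrow> 'w \<Rightarrow> 'h).
        filtration_from M s0 F \<and> brownian_motion_from M s0 F C W \<and>
        diffusion_coefficient s0 \<sigma>Z \<and> solves_B M F W \<alpha> s0 gradf \<sigma>Z Z0 Q0 Z Q \<longrightarrow>
        (let F' = (\<lambda>t. F (\<kappa> t));
             \<sigma>Y = (\<lambda>t. (deriv \<kappa> t) powr (3/2) *\<^sub>R \<sigma>Z (\<kappa> t));
             Y = (\<lambda>t. Z (\<kappa> t));
             X = (\<lambda>t \<omega>. (s0 / (\<alpha> - 1) * exp ((t - t0) / (\<alpha> - 1))) *\<^sub>R Q (\<kappa> t) \<omega>)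
         in (\<forall>t\<ge>t0. \<sigma>Y t
               = (s0 / (\<alpha> - 1) * exp ((t - t0) / (\<alpha> - 1))) powr (3/2) *\<^sub>R \<sigma>Z (\<kappa> t)) \<and>
            filtration_from M t0 F' \<and> diffusion_coefficient t0 \<sigma>Y \<and>
            (\<exists>W'. brownian_motion_from M t0 F' C W' \<and>
               (takes_values_in_space M s0 F W \<longrightarrow> takes_values_in_space M t0 F' W') \<and>
               time_changed_noise M s0 F W \<tau> W' \<and>
               solves_A M F' W' \<alpha> t0 s0 gradf \<sigma>Y Z0 (\<lambda>\<omega>. (s0 / (\<alpha> - 1)) *\<^sub>R Q0 \<omega>) Y X)))"
proof -
  define \<beta> where "\<beta> = \<alpha> - 1"
  have \<beta>: "\<beta> > 0" using \<open>\<alpha> > 1\<close> by (simp add: \<beta>_def)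
  have \<alpha>: "\<alpha> = \<beta> + 1" by (simp add: \<beta>_def)
  note s0 = \<open>s0 > 0\<close> and M = \<open>prob_space M\<close>
  have \<tau>': "\<tau> = (\<lambda>s. t0 + \<beta> * ln (s / s0))" by (simp add: \<tau>_def \<beta>_def)
  have \<kappa>': "\<kappa> = (\<lambda>t. s0 * exp ((t - t0) / \<beta>))" by (simp add: \<kappa>_def \<beta>_def)
  interpret A: time_change t0 s0 \<kappa> "\<lambda>u. \<kappa> u / \<beta>" "\<lambda>u. \<kappa> u / \<beta>\<^sup>2" \<tau>
    by (rule time_change_exp(1)[OF \<beta> s0 \<tau>' \<kappa>'])
  interpret B: time_change s0 t0 \<tau> "\<lambda>s. \<beta> / s" "\<lambda>s. - \<beta> / s\<^sup>2" \<kappa>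
    by (rule time_change_exp(2)[OF \<beta> s0 \<tau>' \<kappa>'])
  have gradf: "continuous_on UNIV gradf"
    using \<open>L-lipschitz_on UNIV gradf\<close> by (rule lipschitz_on_continuous_on)
  have gradf1: "continuous_on S (\<lambda>x. gradf (h x))" if "continuous_on S h" for S :: "(real \<times> 'h \<times> 'h) set" and h
    by (rule continuous_on_compose2[OF gradf that]) auto
  have \<kappa>pos: "0 < \<kappa> u" for u using s0 by (simp add: \<kappa>')
  have d\<tau>: "deriv \<tau> s = (\<alpha> - 1) / s" if "s0 \<le> s" for s
    using DERIV_imp_deriv[OF B.deriv_at[OF that]] by (simp add: \<beta>_def)
  have d\<kappa>: "deriv \<kappa> t = s0 / (\<alpha> - 1) * exp ((t - t0) / (\<alpha> - 1))" if "t0 \<le> t" for t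
    using DERIV_imp_deriv[OF A.deriv_at[OF that]] by (simp add: \<kappa>_def \<beta>_def)
  \<comment> \<open>The factor of the gradient in (A) is the square of \<kappa>', as differentiating
    twice through the clock produces.\<close>
  have \<kappa>sq: "(s0 / (\<alpha> - 1))\<^sup>2 * exp (2 * (t - t0) / (\<alpha> - 1)) = (\<kappa> t / \<beta>)\<^sup>2" for t
    unfolding \<kappa>_def \<beta>_def by (simp add: power2_eq_square exp_add[symmetric] add_divide_distrib[symmetric])
  \<comment> \<open>With generic scalars, the vector identities for the drift reduce to comparing
    coefficients.\<close>
  have lin1: "(A + B * (- 1)) *\<^sub>R x - (B * c) *\<^sub>R v = A *\<^sub>R x + B *\<^sub>R (- x - c *\<^sub>R v)"
    and lin2: "(A + B * c) *\<^sub>R x - B *\<^sub>R v = A *\<^sub>R x + B *\<^sub>R (c *\<^sub>R x - v)"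
    for A B c :: real and x v :: 'h
    by (simp_all add: algebra_simps)
  have contA: "continuous_on ({t0..} \<times> UNIV) (\<lambda>(t, z). case z of (y, x) \<Rightarrow>
      (x, - x - ((s0 / (\<alpha> - 1))\<^sup>2 * exp (2 * (t - t0) / (\<alpha> - 1))) *\<^sub>R gradf y))"
    unfolding case_prod_beta using \<open>\<alpha> > 1\<close> by (intro continuous_intros gradf1) auto
  have contB: "continuous_on ({s0..} \<times> UNIV) (\<lambda>(s, x). case x of (z, q) \<Rightarrow> (q, - (\<alpha> / s) *\<^sub>R q - gradf z))"
    unfolding case_prod_beta using s0 by (intro continuous_intros gradf1) auto
  show ?thesis
  proof (intro conjI allI impI, goal_cases)
    case (1 F C W \<sigma>Y Y0 X0 Y X)
    then have F: "filtration_from M t0 F" and W: "brownian_motion_from M t0 F C W"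
      and \<sigma>: "diffusion_coefficient t0 \<sigma>Y" by auto
    have sol: "solves_B M (\<lambda>s. F (\<tau> s)) (A.noise W) \<alpha> s0 gradf (\<lambda>s. (deriv \<tau> s) powr (3/2) *\<^sub>R \<sigma>Y (\<tau> s))
        Y0 (\<lambda>\<omega>. ((\<alpha> - 1) / s0) *\<^sub>R X0 \<omega>) (\<lambda>s. Y (\<tau> s)) (\<lambda>s \<omega>. ((\<alpha> - 1) / s) *\<^sub>R X (\<tau> s) \<omega>)"
      unfolding solves_B_def
    proof (rule A.strong_solution_time_change[OF M F W
          1[THEN conjunct2, THEN conjunct2, THEN conjunct2, unfolded solves_A_def] contA contB])
      fix u and z :: "'h \<times> 'h" assume u: "t0 \<le> u"
      obtain y x where z: "z = (y, x)" by (cases z)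
      have k: "\<kappa> u \<noteq> 0" "\<beta> \<noteq> 0" using \<kappa>pos[of u] \<beta> by auto
      \<comment> \<open>The friction of (B) has two sources: \<beta> / \<kappa> from the unit
        friction of (A), and 1 / \<kappa> from differentiating the velocity factor. Their sum is
        \<alpha> / \<kappa> since \<alpha> = \<beta> + 1.\<close>
      have 1: "(\<kappa> u / \<beta>) * (- (\<alpha> / \<kappa> u) * (\<beta> / \<kappa> u)) = - (\<kappa> u / \<beta>\<^sup>2) / (\<kappa> u / \<beta>)\<^sup>2 + (\<beta> / \<kappa> u) * (- 1)"
        using k unfolding \<alpha> by (simp add: field_simps power2_eq_square)
      have 2: "(\<beta> / \<kappa> u) * (\<kappa> u / \<beta>)\<^sup>2 = \<kappa> u / \<beta>" using k by (simp add: power2_eq_square)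
      have "(\<kappa> u / \<beta>) *\<^sub>R (- (\<alpha> / \<kappa> u) *\<^sub>R (\<beta> / \<kappa> u) *\<^sub>R x - gradf y)
          = ((\<kappa> u / \<beta>) * (- (\<alpha> / \<kappa> u) * (\<beta> / \<kappa> u))) *\<^sub>R x - (\<kappa> u / \<beta>) *\<^sub>R gradf y"
        by (simp add: scaleR_diff_right)
      also have "\<dots> = (- (\<kappa> u / \<beta>\<^sup>2) / (\<kappa> u / \<beta>)\<^sup>2) *\<^sub>R x + (\<beta> / \<kappa> u) *\<^sub>R (- x - (\<kappa> u / \<beta>)\<^sup>2 *\<^sub>R gradf y)"
        unfolding 1 using lin1[of "- (\<kappa> u / \<beta>\<^sup>2) / (\<kappa> u / \<beta>)\<^sup>2" "\<beta> / \<kappa> u" x "(\<kappa> u / \<beta>)\<^sup>2" "gradf y"]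
        unfolding 2 .
      finally show "(\<kappa> u / \<beta>) *\<^sub>R (case (fst z, (1 / (\<kappa> u / \<beta>)) *\<^sub>R snd z) of (z, q) \<Rightarrow>
            (q, - (\<alpha> / \<kappa> u) *\<^sub>R q - gradf z))
        = (fst (case z of (y, x) \<Rightarrow> (x, - x - ((s0 / (\<alpha> - 1))\<^sup>2 * exp (2 * (u - t0) / (\<alpha> - 1))) *\<^sub>R gradf y)),
           (- (\<kappa> u / \<beta>\<^sup>2) / (\<kappa> u / \<beta>)\<^sup>2) *\<^sub>R snd z + (1 / (\<kappa> u / \<beta>)) *\<^sub>R
             snd (case z of (y, x) \<Rightarrow> (x, - x - ((s0 / (\<alpha> - 1))\<^sup>2 * exp (2 * (u - t0) / (\<alpha> - 1))) *\<^sub>R gradf y)))"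
        using k unfolding \<kappa>sq z by simp
    qed (use A.\<phi>(2) d\<tau> A.start in \<open>simp_all add: \<beta>_def\<close>)
    have "continuous_on {s0..} (\<lambda>s. (deriv \<tau> s) powr (3/2))"
    proof (rule continuous_on_eq)
      show "continuous_on {s0..} (\<lambda>s. ((\<alpha> - 1) / s) powr (3/2))"
        using s0 \<open>\<alpha> > 1\<close> by (intro continuous_intros) auto
    qed (simp add: d\<tau>)
    note dc = A.diffusion_coefficient_time_change[OF \<sigma> this]
    show ?case
      unfolding Let_def
      by (intro conjI allI impI exI[of _ "A.noise W"] A.filtration_from_time_change[OF F] dc sol
          A.brownian_motion_noise[OF M F W] A.takes_values_in_space_noise[OF F]
          A.time_changed_noise_noise[OF M F W]) (simp_all add: d\<tau>)
  next
    case (2 F C W \<sigma>Z Z0 Q0 Z Q)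
    then have F: "filtration_from M s0 F" and W: "brownian_motion_from M s0 F C W"
      and \<sigma>: "diffusion_coefficient s0 \<sigma>Z" by auto
    have sol: "solves_A M (\<lambda>t. F (\<kappa> t)) (B.noise W) \<alpha> t0 s0 gradf (\<lambda>t. (deriv \<kappa> t) powr (3/2) *\<^sub>R \<sigma>Z (\<kappa> t))
        Z0 (\<lambda>\<omega>. (s0 / (\<alpha> - 1)) *\<^sub>R Q0 \<omega>) (\<lambda>t. Z (\<kappa> t))
        (\<lambda>t \<omega>. (s0 / (\<alpha> - 1) * exp ((t - t0) / (\<alpha> - 1))) *\<^sub>R Q (\<kappa> t) \<omega>)"
      unfolding solves_A_def
    proof (rule B.strong_solution_time_change[OF M F W
          2[THEN conjunct2, THEN conjunct2, THEN conjunct2, unfolded solves_B_def] contB contA])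
      fix s and x :: "'h \<times> 'h" assume s: "s0 \<le> s"
      obtain z q where x: "x = (z, q)" by (cases x)
      have k: "s \<noteq> 0" "\<beta> \<noteq> 0" using s s0 \<beta> by auto
      \<comment> \<open>Conversely, differentiating the velocity factor s / \<beta> contributes 1 /
        \<beta>, which reduces the friction \<alpha> / \<beta> to 1.\<close>
      have 1: "(\<beta> / s) * (- 1 * (s / \<beta>)) = - (- \<beta> / s\<^sup>2) / (\<beta> / s)\<^sup>2 + (s / \<beta>) * (- (\<alpha> / s))"
        using k unfolding \<alpha> by (simp add: field_simps power2_eq_square)
      have 2: "(\<beta> / s) * (s / \<beta>)\<^sup>2 = s / \<beta>" using k by (simp add: power2_eq_square)
      have "(\<beta> / s) *\<^sub>R (- ((s / \<beta>) *\<^sub>R q) - (s / \<beta>)\<^sup>2 *\<^sub>R gradf z)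
          = ((\<beta> / s) * (- 1 * (s / \<beta>))) *\<^sub>R q - ((\<beta> / s) * (s / \<beta>)\<^sup>2) *\<^sub>R gradf z"
        by (simp add: scaleR_diff_right)
      also have "\<dots> = (- (- \<beta> / s\<^sup>2) / (\<beta> / s)\<^sup>2) *\<^sub>R q + (s / \<beta>) *\<^sub>R (- (\<alpha> / s) *\<^sub>R q - gradf z)"
        unfolding 1 2 by (rule lin2)
      finally show "(\<beta> / s) *\<^sub>R (case (fst x, (1 / (\<beta> / s)) *\<^sub>R snd x) of (y, x) \<Rightarrow>
            (x, - x - ((s0 / (\<alpha> - 1))\<^sup>2 * exp (2 * (\<tau> s - t0) / (\<alpha> - 1))) *\<^sub>R gradf y))
        = (fst (case x of (z, q) \<Rightarrow> (q, - (\<alpha> / s) *\<^sub>R q - gradf z)),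
           (- (- \<beta> / s\<^sup>2) / (\<beta> / s)\<^sup>2) *\<^sub>R snd x + (1 / (\<beta> / s)) *\<^sub>R
             snd (case x of (z, q) \<Rightarrow> (q, - (\<alpha> / s) *\<^sub>R q - gradf z)))"
        using k unfolding \<kappa>sq x A.\<phi>(2)[OF s] by simp
    qed (use d\<kappa> B.start in \<open>simp_all add: \<beta>_def \<kappa>_def\<close>)
    have "continuous_on {t0..} (\<lambda>t. (deriv \<kappa> t) powr (3/2))"
    proof (rule continuous_on_eq)
      show "continuous_on {t0..} (\<lambda>t. (s0 / (\<alpha> - 1) * exp ((t - t0) / (\<alpha> - 1))) powr (3/2))"
        using s0 \<open>\<alpha> > 1\<close> by (intro continuous_intros) auto
    qed (simp add: d\<kappa>)
    note dc = B.diffusion_coefficient_time_change[OF \<sigma> this]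
    show ?case
      unfolding Let_def
      by (intro conjI allI impI exI[of _ "B.noise W"] B.filtration_from_time_change[OF F] dc sol
          B.brownian_motion_noise[OF M F W] B.takes_values_in_space_noise[OF F]
          B.time_changed_noise_noise[OF M F W]) (simp_all add: d\<kappa>)
  qed
qed

end
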